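(* Let $(M, F=\alpha^2/\beta : A\to\mathbb{R}^+)$ be a globally defined strong Kropina space with navigation data $(h,W)$. Let $p$ be any point of $M$, and let $\{\varphi_t\}_{t\in I_\epsilon}$, $I_\epsilon=(-\epsilon,\epsilon)$, be a local $1$-parameter group of local isometries of $(M,h)$ (defined around $p$) which generates the unit vector field $W$. Then the following two statements hold: (i) If the curve $\rho(t)$ is an $h$-geodesic on $(M,h)$, parameterized so that $|\dot\rho(t)|_h=1$, and satisfies $\rho(0)=p$ and $\dot\rho(0)\neq -W_{\rho(0)}$, then the curve $\mathcal P(t):=\varphi_t(\rho(t))$, $t\in I_\epsilon$, is an $F$-geodesic of the Kropina space $(M,F)$ which is parameterized so that $F(\mathcal P(t),\dot{\mathcal P}(t))=1$. (ii) If the curve $\mathcal P(t)$, $t\in I_\epsilon$, is an $F$-geodesic of the Kropina space $(M,F)$ parameterized so that $F(\mathcal P(t),\dot{\mathcal P}(t))=1$, then the curve $\rho(t):=\varphi_{-t}(\mathcal P(t))$, $t\in I_\epsilon$, is an $h$-geodesic of $(M,h)$ which is parameterized so that $|\dot\rho(t)|_h=1$.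
   Context: Let $h$ be a Riemannian metric on a smooth manifold $M$ and $W$ a vector field with $|W|_h=1$ everywhere. The Kropina metric with navigation data $(h,W)$ is $$F(x,y)=\frac{|y|_h^2}{2h(y,W)}=\frac{\alpha^2}{\beta},$$ defined on the conic domain $A=\{(x,y)\in TM: h(y,W)>0\}$, $A_x=A\cap T_xM$. (Here $\alpha=|y|_a$ with $a=e^{-\kappa}h$, and $\beta=2e^{-\kappa}h(\cdot,W)$ for a smooth function $\kappa$ on $M$; $F$ does not depend on $\kappa$.) It is a strong Kropina metric if $W$ is moreover a Killing vector field of $(M,h)$ (so $W$ is an $h$-unit Killing field). A curve $c$ is $F$-admissible if $\dot c(t)\in A_{c(t)}$ for all $t$. An $F$-geodesic (Kropina geodesic) is a smooth $F$-admissible curve satisfying $\ddot c^i+2G^i(c,\dot c)=0$, where $G^i=\tfrac14 g^{ij}\big(\tfrac{\partial^2F^2}{\partial y^j\partial x^k}y^k-\tfrac{\partial F^2}{\partial x^j}\big)$ and $g_{ij}=\tfrac12\tfrac{\partial^2F^2}{\partial y^i\partial y^j}$ on $A$ (i.e. the constant-speed solutions of the Euler–Lagrange equations of $F^2$). All curves are taken on parameter intervals on which the compositions with $\varphi_{\pm t}$ are defined. *)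

theory Defs
  imports "HOL-Analysis.Analysis"
begin

section \<open>Smooth functions on open sets\<close>

(* Only used for open S and finite-dimensional domains. *)
primrec Ck_on :: "nat \<Rightarrow> 'a::real_normed_vector set \<Rightarrow> ('a \<Rightarrow> 'b::real_normed_vector) \<Rightarrow> bool" where
  "Ck_on 0 S f \<longleftrightarrow> continuous_on S f"
| "Ck_on (Suc k) S f \<longleftrightarrow>
     (\<forall>x\<in>S. f differentiable (at x)) \<and> (\<forall>v. Ck_on k S (\<lambda>x. frechet_derivative f (at x) v))"

definition smooth_on :: "'a::real_normed_vector set \<Rightarrow> ('a \<Rightarrow> 'b::real_normed_vector) \<Rightarrow> bool" where
  "smooth_on S f \<longleftrightarrow> (\<forall>k. Ck_on k S f)"

definition partial :: "'n::finite \<Rightarrow> (real^'n \<Rightarrow> real) \<Rightarrow> real^'n \<Rightarrow> real" where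
  "partial i f x = frechet_derivative f (at x) (axis i 1)"

section \<open>Smooth manifolds, tangent vectors, velocities\<close>

(* A chart is a coordinate domain together with the coordinate map; the map is irrelevant
   outside the domain. *)
type_synonym ('a, 'n) chart = "'a set \<times> ('a \<Rightarrow> real^'n)"

abbreviation chart_dom :: "('a, 'n) chart \<Rightarrow> 'a set" where
  "chart_dom c \<equiv> fst c"

abbreviation chart_map :: "('a, 'n) chart \<Rightarrow> 'a \<Rightarrow> real^'n" where
  "chart_map c \<equiv> snd c"

abbreviation chart_img :: "('a, 'n) chart \<Rightarrow> (real^'n) set" where
  "chart_img c \<equiv> chart_map c ` chart_dom c"

definition chart_inv :: "('a, 'n) chart \<Rightarrow> real^'n \<Rightarrow> 'a" where
  "chart_inv c = inv_into (chart_dom c) (chart_map c)"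

definition is_chart :: "('a::topological_space, 'n::finite) chart \<Rightarrow> bool" where
  "is_chart c \<longleftrightarrow> open (chart_dom c) \<and> open (chart_img c) \<and>
     homeomorphism (chart_dom c) (chart_img c) (chart_map c) (chart_inv c)"

definition transition :: "('a, 'n) chart \<Rightarrow> ('a, 'n) chart \<Rightarrow> real^'n \<Rightarrow> real^'n" where
  "transition c d = chart_map d \<circ> chart_inv c"

(* The manifold M is the union of the chart domains, an open subset of a Hausdorff second
   countable space. *)
definition carrier :: "('a, 'n) chart set \<Rightarrow> 'a set" where
  "carrier \<A> = (\<Union>c\<in>\<A>. chart_dom c)"

definition smooth_manifold ::
  "('a::{t2_space, second_countable_topology}, 'n::finite) chart set \<Rightarrow> bool" where
  "smooth_manifold \<A> \<longleftrightarrow> (\<forall>c\<in>\<A>. is_chart c) \<and>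
     (\<forall>c\<in>\<A>. \<forall>d\<in>\<A>. smooth_on (chart_map c ` (chart_dom c \<inter> chart_dom d)) (transition c d))"

(* A tangent vector at p is the family of its coordinate vectors, one for every chart around p,
   related by the Jacobians of the coordinate changes (and 0 by convention for the other pairs). *)
type_synonym ('a, 'n) tvec = "('a, 'n) chart \<Rightarrow> real^'n"

definition tangent_space :: "('a, 'n::finite) chart set \<Rightarrow> 'a \<Rightarrow> ('a, 'n) tvec set" where
  "tangent_space \<A> p = {v.
     (\<forall>c. \<not> (c \<in> \<A> \<and> p \<in> chart_dom c) \<longrightarrow> v c = 0) \<and>
     (\<forall>c\<in>\<A>. \<forall>d\<in>\<A>. p \<in> chart_dom c \<and> p \<in> chart_dom d \<longrightarrow>
        v d = frechet_derivative (transition c d) (at (chart_map c p)) (v c))}"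

(* The tangent vector at p with coordinates u in the chart c. *)
definition tangent_of ::
  "('a, 'n::finite) chart set \<Rightarrow> ('a, 'n) chart \<Rightarrow> 'a \<Rightarrow> real^'n \<Rightarrow> ('a, 'n) tvec" where
  "tangent_of \<A> c p u = (\<lambda>d. if d \<in> \<A> \<and> p \<in> chart_dom d
     then frechet_derivative (transition c d) (at (chart_map c p)) u else 0)"

definition smooth_curve ::
  "('a::topological_space, 'n::finite) chart set \<Rightarrow> real set \<Rightarrow> (real \<Rightarrow> 'a) \<Rightarrow> bool" where
  "smooth_curve \<A> I \<gamma> \<longleftrightarrow> continuous_on I \<gamma> \<and> \<gamma> ` I \<subseteq> carrier \<A> \<and>
     (\<forall>c\<in>\<A>. smooth_on {t \<in> I. \<gamma> t \<in> chart_dom c} (chart_map c \<circ> \<gamma>))"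

definition velocity ::
  "('a, 'n::finite) chart set \<Rightarrow> (real \<Rightarrow> 'a) \<Rightarrow> real \<Rightarrow> ('a, 'n) tvec" where
  "velocity \<A> \<gamma> t = (\<lambda>c. if c \<in> \<A> \<and> \<gamma> t \<in> chart_dom c
     then vector_derivative (chart_map c \<circ> \<gamma>) (at t) else 0)"

definition acceleration :: "('a, 'n::finite) chart \<Rightarrow> (real \<Rightarrow> 'a) \<Rightarrow> real \<Rightarrow> real^'n" where
  "acceleration c \<gamma> t =
     vector_derivative (\<lambda>s. vector_derivative (chart_map c \<circ> \<gamma>) (at s)) (at t)"

definition smooth_map ::
  "('a::topological_space, 'n::finite) chart set \<Rightarrow> 'a set \<Rightarrow> ('a \<Rightarrow> 'a) \<Rightarrow> bool" where
  "smooth_map \<A> U f \<longleftrightarrow> continuous_on U f \<and> f ` U \<subseteq> carrier \<A> \<and>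
     (\<forall>c\<in>\<A>. \<forall>d\<in>\<A>. smooth_on (chart_map c ` {x \<in> U \<inter> chart_dom c. f x \<in> chart_dom d})
        (chart_map d \<circ> f \<circ> chart_inv c))"

(* The differential of f at p; for f smooth near p and v tangent at p the value does not depend
   on the chart c selected around p. *)
definition differential ::
  "('a, 'n::finite) chart set \<Rightarrow> ('a \<Rightarrow> 'a) \<Rightarrow> 'a \<Rightarrow> ('a, 'n) tvec \<Rightarrow> ('a, 'n) tvec" where
  "differential \<A> f p v =
     (let c = (SOME c. c \<in> \<A> \<and> p \<in> chart_dom c) in
      (\<lambda>d. if d \<in> \<A> \<and> f p \<in> chart_dom d
        then frechet_derivative (chart_map d \<circ> f \<circ> chart_inv c) (at (chart_map c p)) (v c)
        else 0))"

section \<open>Riemannian metrics, Killing fields, Riemannian geodesics\<close>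

type_synonym ('a, 'n) metric = "'a \<Rightarrow> ('a, 'n) tvec \<Rightarrow> ('a, 'n) tvec \<Rightarrow> real"
type_synonym ('a, 'n) vfield = "'a \<Rightarrow> ('a, 'n) tvec"

(* The coordinate expression of h in the chart c, as a form on real^'n for each x in chart_img c. *)
definition metric_form ::
  "('a, 'n::finite) chart set \<Rightarrow> ('a, 'n) metric \<Rightarrow> ('a, 'n) chart
    \<Rightarrow> real^'n \<Rightarrow> real^'n \<Rightarrow> real^'n \<Rightarrow> real" where
  "metric_form \<A> h c x u v = h (chart_inv c x)
     (tangent_of \<A> c (chart_inv c x) u) (tangent_of \<A> c (chart_inv c x) v)"

definition metric_coeff ::
  "('a, 'n::finite) chart set \<Rightarrow> ('a, 'n) metric \<Rightarrow> ('a, 'n) chart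
    \<Rightarrow> 'n \<Rightarrow> 'n \<Rightarrow> real^'n \<Rightarrow> real" where
  "metric_coeff \<A> h c i j x = metric_form \<A> h c x (axis i 1) (axis j 1)"

definition riemannian_metric ::
  "('a, 'n::finite) chart set \<Rightarrow> ('a, 'n) metric \<Rightarrow> bool" where
  "riemannian_metric \<A> h \<longleftrightarrow> (\<forall>c\<in>\<A>.
     (\<forall>x\<in>chart_img c. bilinear (metric_form \<A> h c x) \<and>
        (\<forall>u v. metric_form \<A> h c x u v = metric_form \<A> h c x v u) \<and>
        (\<forall>u. u \<noteq> 0 \<longrightarrow> 0 < metric_form \<A> h c x u u)) \<and>
     (\<forall>i j. smooth_on (chart_img c) (metric_coeff \<A> h c i j)))"

definition metric_norm :: "('a, 'n) metric \<Rightarrow> 'a \<Rightarrow> ('a, 'n) tvec \<Rightarrow> real" where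
  "metric_norm h p y = sqrt (h p y y)"

definition vfield_coeff :: "('a, 'n) vfield \<Rightarrow> ('a, 'n) chart \<Rightarrow> 'n \<Rightarrow> real^'n \<Rightarrow> real" where
  "vfield_coeff W c i x = W (chart_inv c x) c $ i"

definition smooth_vector_field ::
  "('a, 'n::finite) chart set \<Rightarrow> ('a, 'n) vfield \<Rightarrow> bool" where
  "smooth_vector_field \<A> W \<longleftrightarrow> (\<forall>p\<in>carrier \<A>. W p \<in> tangent_space \<A> p) \<and>
     (\<forall>c\<in>\<A>. \<forall>i. smooth_on (chart_img c) (vfield_coeff W c i))"

(* The Lie derivative of h along W vanishes:
   W^k d_k h_ij + h_kj d_i W^k + h_ik d_j W^k = 0 in every chart. *)
definition killing_field ::
  "('a, 'n::finite) chart set \<Rightarrow> ('a, 'n) metric \<Rightarrow> ('a, 'n) vfield \<Rightarrow> bool" where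
  "killing_field \<A> h W \<longleftrightarrow> smooth_vector_field \<A> W \<and>
     (\<forall>c\<in>\<A>. \<forall>x\<in>chart_img c. \<forall>i j.
        (\<Sum>k\<in>UNIV. vfield_coeff W c k x * partial k (metric_coeff \<A> h c i j) x
           + metric_coeff \<A> h c k j x * partial i (vfield_coeff W c k) x
           + metric_coeff \<A> h c i k x * partial j (vfield_coeff W c k) x) = 0)"

definition christoffel ::
  "('a, 'n::finite) chart set \<Rightarrow> ('a, 'n) metric \<Rightarrow> ('a, 'n) chart
    \<Rightarrow> 'n \<Rightarrow> 'n \<Rightarrow> 'n \<Rightarrow> real^'n \<Rightarrow> real" where
  "christoffel \<A> h c i j k x = 1/2 * (\<Sum>l\<in>UNIV.
     matrix_inv (\<chi> a b. metric_coeff \<A> h c a b x) $ i $ l *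
     (partial j (metric_coeff \<A> h c l k) x + partial k (metric_coeff \<A> h c l j) x
       - partial l (metric_coeff \<A> h c j k) x))"

definition riemannian_geodesic ::
  "('a::topological_space, 'n::finite) chart set \<Rightarrow> ('a, 'n) metric
    \<Rightarrow> real set \<Rightarrow> (real \<Rightarrow> 'a) \<Rightarrow> bool" where
  "riemannian_geodesic \<A> h I \<gamma> \<longleftrightarrow> smooth_curve \<A> I \<gamma> \<and>
     (\<forall>c\<in>\<A>. \<forall>t\<in>I. \<gamma> t \<in> chart_dom c \<longrightarrow> (\<forall>i.
        acceleration c \<gamma> t $ i
          + (\<Sum>j\<in>UNIV. \<Sum>k\<in>UNIV. christoffel \<A> h c i j k (chart_map c (\<gamma> t))
               * velocity \<A> \<gamma> t c $ j * velocity \<A> \<gamma> t c $ k) = 0))"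

section \<open>Kropina metrics and their geodesics\<close>

definition kropina :: "('a, 'n) metric \<Rightarrow> ('a, 'n) vfield \<Rightarrow> 'a \<Rightarrow> ('a, 'n) tvec \<Rightarrow> real" where
  "kropina h W p y = (metric_norm h p y)\<^sup>2 / (2 * h p y (W p))"

(* The fibre over p of the conic domain on which the Kropina metric is defined. *)
definition kropina_cone ::
  "('a, 'n::finite) chart set \<Rightarrow> ('a, 'n) metric \<Rightarrow> ('a, 'n) vfield \<Rightarrow> 'a \<Rightarrow> ('a, 'n) tvec set" where
  "kropina_cone \<A> h W p = {y \<in> tangent_space \<A> p. h p y (W p) > 0}"

definition kropina_space ::
  "('a::{t2_space, second_countable_topology}, 'n::finite) chart set
    \<Rightarrow> ('a, 'n) metric \<Rightarrow> ('a, 'n) vfield \<Rightarrow> bool" where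
  "kropina_space \<A> h W \<longleftrightarrow> smooth_manifold \<A> \<and> riemannian_metric \<A> h \<and>
     smooth_vector_field \<A> W \<and> (\<forall>p\<in>carrier \<A>. metric_norm h p (W p) = 1)"

definition strong_kropina_space ::
  "('a::{t2_space, second_countable_topology}, 'n::finite) chart set
    \<Rightarrow> ('a, 'n) metric \<Rightarrow> ('a, 'n) vfield \<Rightarrow> bool" where
  "strong_kropina_space \<A> h W \<longleftrightarrow> kropina_space \<A> h W \<and> killing_field \<A> h W"

(* L x y stands for the square of a Finsler function in coordinates (x, y). *)
definition fundamental_tensor :: "(real^'n::finite \<Rightarrow> real^'n \<Rightarrow> real) \<Rightarrow> real^'n \<Rightarrow> real^'n \<Rightarrow> real^'n^'n" where
  "fundamental_tensor L x y = (\<chi> i j. 1/2 * partial i (\<lambda>z. partial j (L x) z) y)"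

definition spray_coeff ::
  "(real^'n::finite \<Rightarrow> real^'n \<Rightarrow> real) \<Rightarrow> 'n \<Rightarrow> real^'n \<Rightarrow> real^'n \<Rightarrow> real" where
  "spray_coeff L i x y = 1/4 * (\<Sum>j\<in>UNIV. matrix_inv (fundamental_tensor L x y) $ i $ j *
     ((\<Sum>k\<in>UNIV. partial k (\<lambda>z. partial j (L z) y) x * y $ k) - partial j (\<lambda>z. L z y) x))"

definition kropina_sq_coord ::
  "('a, 'n::finite) chart set \<Rightarrow> ('a, 'n) metric \<Rightarrow> ('a, 'n) vfield \<Rightarrow> ('a, 'n) chart
    \<Rightarrow> real^'n \<Rightarrow> real^'n \<Rightarrow> real" where
  "kropina_sq_coord \<A> h W c x y =
     (kropina h W (chart_inv c x) (tangent_of \<A> c (chart_inv c x) y))\<^sup>2"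

definition kropina_geodesic ::
  "('a::topological_space, 'n::finite) chart set \<Rightarrow> ('a, 'n) metric \<Rightarrow> ('a, 'n) vfield
    \<Rightarrow> real set \<Rightarrow> (real \<Rightarrow> 'a) \<Rightarrow> bool" where
  "kropina_geodesic \<A> h W I \<gamma> \<longleftrightarrow> smooth_curve \<A> I \<gamma> \<and>
     (\<forall>t\<in>I. velocity \<A> \<gamma> t \<in> kropina_cone \<A> h W (\<gamma> t)) \<and>
     (\<forall>c\<in>\<A>. \<forall>t\<in>I. \<gamma> t \<in> chart_dom c \<longrightarrow> (\<forall>i.
        acceleration c \<gamma> t $ i
          + 2 * spray_coeff (kropina_sq_coord \<A> h W c) i (chart_map c (\<gamma> t)) (velocity \<A> \<gamma> t c)
        = 0))"

section \<open>Local one-parameter groups of local isometries\<close>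

definition local_isometry ::
  "('a::topological_space, 'n::finite) chart set \<Rightarrow> ('a, 'n) metric \<Rightarrow> 'a set \<Rightarrow> ('a \<Rightarrow> 'a) \<Rightarrow> bool" where
  "local_isometry \<A> h U f \<longleftrightarrow>
     open U \<and> U \<subseteq> carrier \<A> \<and> open (f ` U) \<and> inj_on f U \<and>
     smooth_map \<A> U f \<and> smooth_map \<A> (f ` U) (inv_into U f) \<and>
     (\<forall>x\<in>U. \<forall>v\<in>tangent_space \<A> x. \<forall>w\<in>tangent_space \<A> x.
        h (f x) (differential \<A> f x v) (differential \<A> f x w) = h x v w)"

(* Each \<phi> t is only meaningful on U, and only for t in {-\<epsilon><..<\<epsilon>}. The third condition is
   smoothness of (t, x) \<mapsto> \<phi> t x, jointly in t and the coordinates of x. *)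
definition local_isometry_group ::
  "('a::topological_space, 'n::finite) chart set \<Rightarrow> ('a, 'n) metric \<Rightarrow> 'a set \<Rightarrow> real
    \<Rightarrow> (real \<Rightarrow> 'a \<Rightarrow> 'a) \<Rightarrow> bool" where
  "local_isometry_group \<A> h U \<epsilon> \<phi> \<longleftrightarrow>
     (\<forall>t\<in>{-\<epsilon><..<\<epsilon>}. local_isometry \<A> h U (\<phi> t)) \<and>
     continuous_on ({-\<epsilon><..<\<epsilon>} \<times> U) (\<lambda>(t, x). \<phi> t x) \<and>
     (\<forall>c\<in>\<A>. \<forall>d\<in>\<A>. smooth_on
        {(t, u). t \<in> {-\<epsilon><..<\<epsilon>} \<and> u \<in> chart_map c ` (U \<inter> chart_dom c) \<and>
                 \<phi> t (chart_inv c u) \<in> chart_dom d}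
        (\<lambda>(t, u). chart_map d (\<phi> t (chart_inv c u)))) \<and>
     (\<forall>x\<in>U. \<phi> 0 x = x) \<and>
     (\<forall>s\<in>{-\<epsilon><..<\<epsilon>}. \<forall>t\<in>{-\<epsilon><..<\<epsilon>}. \<forall>x\<in>U. s + t \<in> {-\<epsilon><..<\<epsilon>} \<and> \<phi> t x \<in> U \<longrightarrow>
        \<phi> (s + t) x = \<phi> s (\<phi> t x))"

(* The orbits of \<phi> are integral curves of W. *)
definition generates ::
  "('a, 'n::finite) chart set \<Rightarrow> 'a set \<Rightarrow> real \<Rightarrow> (real \<Rightarrow> 'a \<Rightarrow> 'a) \<Rightarrow> ('a, 'n) vfield \<Rightarrow> bool" where
  "generates \<A> U \<epsilon> \<phi> W \<longleftrightarrow>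
     (\<forall>x\<in>U. \<forall>t\<in>{-\<epsilon><..<\<epsilon>}. velocity \<A> (\<lambda>s. \<phi> s x) t = W (\<phi> t x))"

end

theory Submission
  imports Defs
begin

text \<open>
The idea is Zermelo navigation.  Since \<open>|W| = 1\<close>, a vector \<open>y\<close> with \<open>h(y, W) > 0\<close> satisfies
\<open>F(y) = 1\<close> exactly when \<open>|y|\<^sup>2 = 2 h(y, W)\<close>, that is when \<open>y = v + W\<close> with \<open>|v| = 1\<close>: curves of
Kropina speed one move with unit velocity \<open>v\<close> relative to a wind \<open>W\<close>.  For a real number \<open>s\<close>, call
\<open>x\<close> a drift geodesic with parameter \<open>s\<close> if its relative velocity \<open>v = x' - s W\<close> satisfies, in every
chart and for every constant vector \<open>a\<close>,
  \<open>d/dt h(v, a) = 1/2 (D_a h)(v, v) - s h(v, D_a W)\<close>.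
These are Hamilton's equations of \<open>1/2 |p|\<^sup>2 + s p(W)\<close> for the momentum \<open>p = h(v, -)\<close>.  The theorem
follows from three facts.

For \<open>s = 0\<close> the equation is the Riemannian geodesic equation with its index lowered
(\<open>geodesic_iff_momentum_eq\<close>).

For \<open>s = 1\<close> it is the Kropina geodesic equation, on curves with \<open>F = 1\<close>
(\<open>kropina_geodesic_iff_momentum_eq\<close>).  The fundamental tensor is positive definite on the cone, so
the spray equation is the Euler--Lagrange equation of \<open>F\<^sup>2\<close>; on \<open>F = 1\<close> the momentum of \<open>F\<^sup>2\<close> is
\<open>2 h(v, -) / \<beta>\<close> with \<open>\<beta> = h(x', W) = 1 + h(v, W)\<close>, and the two equations differ by a multiple of
\<open>\<beta>'\<close>.  The Killing equation makes \<open>\<beta>\<close> constant: along drift geodesics by Noether's theorem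
(\<open>noether\<close>), and along Kropina geodesics by pairing the Euler--Lagrange equation with \<open>v\<close>.

The map \<open>x(t) \<mapsto> \<phi>(r t, x(t))\<close> turns drift geodesics with parameter \<open>s\<close> into drift geodesics with
parameter \<open>s + r\<close> (\<open>flow_maps_momentum_eq\<close>), because the flow is isometric, preserves \<open>W\<close>, and has
symmetric second derivatives.

Part (i) is the case \<open>s = 0\<close>, \<open>r = 1\<close> and part (ii) the case \<open>s = 1\<close>, \<open>r = -1\<close>.  In part (i)
the image curve is admissible because \<open>h(\<rho>', W) + 1\<close> is constant along \<open>\<rho>\<close> and, by Cauchy--Schwarz,
vanishes at \<open>0\<close> only if \<open>\<rho>'(0) = - W\<close>.
\<close>

section \<open>Calculus of smooth functions\<close>

lemma Ck_on_Suc_imp: "Ck_on (Suc k) S f \<Longrightarrow> Ck_on k S f"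
proof (induction k arbitrary: f)
  case 0
  then show ?case
    by (auto intro!: differentiable_imp_continuous_on
        simp: differentiable_on_eq_differentiable_at differentiable_on_def differentiable_at_withinI)
next
  case (Suc k)
  then show ?case by (metis Ck_on.simps(2))
qed

lemma Ck_on_subset: "Ck_on k S f \<Longrightarrow> T \<subseteq> S \<Longrightarrow> Ck_on k T f"
  by (induction k arbitrary: f) (auto intro: continuous_on_subset)

lemma frechet_derivative_cong_open:
  assumes "open S" "x \<in> S" "\<And>y. y \<in> S \<Longrightarrow> f y = g y"
  shows "frechet_derivative f (at x) = frechet_derivative g (at x)"
proof -
  have "(f has_derivative D) (at x) \<longleftrightarrow> (g has_derivative D) (at x)" for D
    using assms by (metis has_derivative_transform_within_open)
  then show ?thesis unfolding frechet_derivative_def by simp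
qed

lemma vector_derivative_cong_open:
  assumes "open S" "x \<in> S" "\<And>y. y \<in> S \<Longrightarrow> f y = g y"
  shows "vector_derivative f (at x) = vector_derivative g (at x)"
  using assms
  by (intro vector_derivative_cong_eq) (auto simp: eventually_nhds)

lemma Ck_on_cong:
  assumes "open S" "\<And>x. x \<in> S \<Longrightarrow> f x = g x"
  shows "Ck_on k S f \<Longrightarrow> Ck_on k S g"
  using assms(2)
proof (induction k arbitrary: f g)
  case 0
  then show ?case by (metis Ck_on.simps(1) continuous_on_cong)
next
  case (Suc k)
  have "g differentiable (at x)" if "x \<in> S" for x
    using Suc.prems that assms(1)
    by (metis Ck_on.simps(2) differentiable_def has_derivative_transform_within_open)
  moreover have "Ck_on k S (\<lambda>x. frechet_derivative g (at x) v)" for v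
  proof (rule Suc.IH)
    show "Ck_on k S (\<lambda>x. frechet_derivative f (at x) v)" using Suc.prems by simp
    show "frechet_derivative f (at x) v = frechet_derivative g (at x) v" if "x \<in> S" for x
      using frechet_derivative_cong_open[OF assms(1) that, of f g] Suc.prems(2) by simp
  qed
  ultimately show ?case by simp
qed

lemma Ck_on_local:
  assumes "\<And>x. x \<in> S \<Longrightarrow> \<exists>T. open T \<and> x \<in> T \<and> Ck_on k T f"
  shows "Ck_on k S f"
  using assms
proof (induction k arbitrary: f)
  case 0
  then show ?case
    by (metis Ck_on.simps(1) continuous_at_imp_continuous_on continuous_on_eq_continuous_at)
next
  case (Suc k)
  then show ?case by (metis Ck_on.simps(2))
qed

lemma has_derivative_frechet:
  "f differentiable (at x) \<Longrightarrow> (f has_derivative frechet_derivative f (at x)) (at x)"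
  by (simp add: frechet_derivative_works)

lemma frechet_eqI: "(f has_derivative f') (at x) \<Longrightarrow> frechet_derivative f (at x) = f'"
  by (metis frechet_derivative_at)

lemma Ck_on_const: "Ck_on k S (\<lambda>x. c)"
  by (induction k arbitrary: c) (auto simp: frechet_derivative_const)

lemma Ck_on_bounded_linear_comp:
  assumes "bounded_linear L" "open S"
  shows "Ck_on k S f \<Longrightarrow> Ck_on k S (\<lambda>x. L (f x))"
proof (induction k arbitrary: f)
  case 0
  then show ?case using assms
    by (auto intro!: bounded_linear.continuous_on[OF assms(1)])
next
  case (Suc k)
  have D: "((\<lambda>x. L (f x)) has_derivative (\<lambda>v. L (frechet_derivative f (at x) v))) (at x)"
    if "x \<in> S" for x
    using Suc.prems that
    by (intro bounded_linear.has_derivative[OF assms(1)] has_derivative_frechet) auto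
  have "Ck_on k S (\<lambda>x. frechet_derivative (\<lambda>x. L (f x)) (at x) v)" for v
    by (rule Ck_on_cong[OF assms(2) _ Suc.IH[of "\<lambda>x. frechet_derivative f (at x) v"]])
      (use Suc.prems in \<open>auto simp: frechet_eqI[OF D]\<close>)
  with D show ?case by (auto simp: differentiable_def)
qed

lemma Ck_on_add:
  assumes "open S"
  shows "Ck_on k S f \<Longrightarrow> Ck_on k S g \<Longrightarrow> Ck_on k S (\<lambda>x. f x + g x)"
proof (induction k arbitrary: f g)
  case 0
  then show ?case by (auto intro: continuous_on_add)
next
  case (Suc k)
  have D: "((\<lambda>x. f x + g x) has_derivative
      (\<lambda>v. frechet_derivative f (at x) v + frechet_derivative g (at x) v)) (at x)"
    if "x \<in> S" for x
    using Suc.prems that by (intro has_derivative_add has_derivative_frechet) auto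
  have "Ck_on k S (\<lambda>x. frechet_derivative (\<lambda>x. f x + g x) (at x) v)" for v
    by (rule Ck_on_cong[OF assms _ Suc.IH[of "\<lambda>x. frechet_derivative f (at x) v"
          "\<lambda>x. frechet_derivative g (at x) v"]])
      (use Suc.prems in \<open>auto simp: frechet_eqI[OF D]\<close>)
  with D show ?case by (auto simp: differentiable_def)
qed

lemma Ck_on_sum:
  assumes "open S" "finite A" "\<And>a. a \<in> A \<Longrightarrow> Ck_on k S (f a)"
  shows "Ck_on k S (\<lambda>x. \<Sum>a\<in>A. f a x)"
  using assms(2,3)
  by (induction A rule: finite_induct) (auto intro!: Ck_on_const Ck_on_add assms(1))

lemma Ck_on_scaleR:
  assumes "open S"
  shows "Ck_on k S f \<Longrightarrow> Ck_on k S g \<Longrightarrow> Ck_on k S (\<lambda>x. f x *\<^sub>R g x)"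
proof (induction k arbitrary: f g)
  case 0
  then show ?case by (auto intro: continuous_on_scaleR)
next
  case (Suc k)
  have D: "((\<lambda>x. f x *\<^sub>R g x) has_derivative
      (\<lambda>v. f x *\<^sub>R frechet_derivative g (at x) v + frechet_derivative f (at x) v *\<^sub>R g x)) (at x)"
    if "x \<in> S" for x
    using Suc.prems that by (intro has_derivative_scaleR has_derivative_frechet) auto
  have "Ck_on k S (\<lambda>x. frechet_derivative (\<lambda>x. f x *\<^sub>R g x) (at x) v)" for v
    by (rule Ck_on_cong[OF assms _ Ck_on_add[OF assms
            Suc.IH[of f "\<lambda>x. frechet_derivative g (at x) v"]
            Suc.IH[of "\<lambda>x. frechet_derivative f (at x) v" g]]])
      (use Suc.prems Ck_on_Suc_imp[OF Suc.prems(1)] Ck_on_Suc_imp[OF Suc.prems(2)]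
        in \<open>auto simp: frechet_eqI[OF D]\<close>)
  with D show ?case by (auto simp: differentiable_def)
qed

lemma linear_eq_sum_Basis:
  fixes L :: "'a::euclidean_space \<Rightarrow> 'b::real_vector"
  assumes "linear L"
  shows "L v = (\<Sum>b\<in>Basis. (v \<bullet> b) *\<^sub>R L b)"
  by (metis (no_types, lifting) assms euclidean_representation linear_sum linear_scale sum.cong)

text \<open>
The derivative of \<open>f \<circ> g\<close> in direction \<open>v\<close> applies a varying linear map to a varying vector, which is
not a composition of functions of class \<open>C^k\<close>.  Expanding the inner vector in a basis turns it into
a finite sum of products of such functions, so that the induction hypothesis applies.
\<close>

lemma Ck_on_compose:
  fixes g :: "'a::real_normed_vector \<Rightarrow> 'b::euclidean_space" and f :: "'b \<Rightarrow> 'c::real_normed_vector"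
  assumes "open T" "g ` T \<subseteq> S"
  shows "Ck_on k S f \<Longrightarrow> Ck_on k T g \<Longrightarrow> Ck_on k T (\<lambda>x. f (g x))"
proof (induction k arbitrary: f)
  case 0
  then show ?case using assms by (auto intro: continuous_on_compose2)
next
  case (Suc k)
  have D: "((\<lambda>x. f (g x)) has_derivative
      (\<lambda>v. frechet_derivative f (at (g x)) (frechet_derivative g (at x) v))) (at x)"
    if "x \<in> T" for x
  proof -
    have "f differentiable (at (g x))" "g differentiable (at x)" using Suc.prems that assms by auto
    then show ?thesis
      using has_derivative_compose[OF has_derivative_frechet has_derivative_frechet] by blast
  qed
  have "Ck_on k T (\<lambda>x. frechet_derivative (\<lambda>x. f (g x)) (at x) v)" for v
  proof (rule Ck_on_cong[OF assms(1)])
    show "Ck_on k T (\<lambda>x. \<Sum>b\<in>Basis. (frechet_derivative g (at x) v \<bullet> b) *\<^sub>R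
        frechet_derivative f (at (g x)) b)"
      using Suc.prems Ck_on_Suc_imp[OF Suc.prems(2)]
      by (intro Ck_on_sum Ck_on_scaleR assms Suc.IH
          Ck_on_bounded_linear_comp[OF bounded_linear_inner_left]) auto
    show "(\<Sum>b\<in>Basis. (frechet_derivative g (at x) v \<bullet> b) *\<^sub>R frechet_derivative f (at (g x)) b) =
        frechet_derivative (\<lambda>x. f (g x)) (at x) v" if "x \<in> T" for x
    proof -
      have "g x \<in> S" using that assms by auto
      then have "linear (frechet_derivative f (at (g x)))"
        using Suc.prems by (intro linear_frechet_derivative) auto
      from linear_eq_sum_Basis[OF this, of "frechet_derivative g (at x) v"]
      show ?thesis by (simp add: frechet_eqI[OF D[OF that]])
    qed
  qed
  with D show ?case by (auto simp: differentiable_def)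
qed

lemma smooth_on_imp_differentiable: "smooth_on S f \<Longrightarrow> x \<in> S \<Longrightarrow> f differentiable (at x)"
  by (metis Ck_on.simps(2) smooth_on_def)

lemma smooth_on_frechet_derivative:
  "smooth_on S f \<Longrightarrow> smooth_on S (\<lambda>x. frechet_derivative f (at x) v)"
  by (metis Ck_on.simps(2) smooth_on_def)

lemma smooth_on_continuous: "smooth_on S f \<Longrightarrow> continuous_on S f"
  by (metis Ck_on.simps(1) smooth_on_def)

lemma smooth_on_subset: "smooth_on S f \<Longrightarrow> T \<subseteq> S \<Longrightarrow> smooth_on T f"
  using Ck_on_subset unfolding smooth_on_def by blast

lemma smooth_on_cong:
  "smooth_on S f \<Longrightarrow> open S \<Longrightarrow> (\<And>x. x \<in> S \<Longrightarrow> f x = g x) \<Longrightarrow> smooth_on S g"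
  using Ck_on_cong unfolding smooth_on_def by blast

lemma smooth_on_local:
  "(\<And>x. x \<in> S \<Longrightarrow> \<exists>T. open T \<and> x \<in> T \<and> smooth_on T f) \<Longrightarrow> smooth_on S f"
  unfolding smooth_on_def by (intro allI Ck_on_local) meson

lemma smooth_on_compose:
  fixes g :: "'a::real_normed_vector \<Rightarrow> 'b::euclidean_space"
  shows "smooth_on S f \<Longrightarrow> smooth_on T g \<Longrightarrow> open T \<Longrightarrow> g ` T \<subseteq> S \<Longrightarrow> smooth_on T (\<lambda>x. f (g x))"
  using Ck_on_compose unfolding smooth_on_def by blast

lemma smooth_on_bounded_linear_comp:
  "bounded_linear L \<Longrightarrow> open S \<Longrightarrow> smooth_on S f \<Longrightarrow> smooth_on S (\<lambda>x. L (f x))"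
  using Ck_on_bounded_linear_comp unfolding smooth_on_def by blast

lemma smooth_on_add: "open S \<Longrightarrow> smooth_on S f \<Longrightarrow> smooth_on S g \<Longrightarrow> smooth_on S (\<lambda>x. f x + g x)"
  using Ck_on_add unfolding smooth_on_def by blast

lemma smooth_on_id: "smooth_on S (\<lambda>x. x)"
proof -
  have "Ck_on k S (\<lambda>x. x)" for k
    by (cases k) (auto simp: frechet_derivative_ident Ck_on_const)
  then show ?thesis by (simp add: smooth_on_def)
qed

lemma smooth_on_bounded_linear: "bounded_linear L \<Longrightarrow> smooth_on S L"
  by (rule smooth_on_subset[OF smooth_on_bounded_linear_comp[OF _ open_UNIV smooth_on_id]]) auto

lemma smooth_on_Pair:
  assumes "open S" "smooth_on S f" "smooth_on S g"
  shows "smooth_on S (\<lambda>x. (f x, g x))"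
proof -
  have "smooth_on S (\<lambda>x. (f x, 0) + (0, g x))"
    by (intro smooth_on_add assms smooth_on_bounded_linear_comp[of "\<lambda>y. (y, 0)"]
        smooth_on_bounded_linear_comp[of "\<lambda>y. (0, y)"] bounded_linear_Pair
        bounded_linear_zero bounded_linear_ident)
  then show ?thesis by simp
qed

text \<open>
Two applications of the mean value theorem, first along \<open>v\<close> and then along \<open>w\<close>.  The second
difference on the left is symmetric in \<open>v\<close> and \<open>w\<close>, and this forces the mixed derivatives to agree.
\<close>

lemma second_difference_eq_mixed_derivative:
  fixes f :: "'a::real_normed_vector \<Rightarrow> real"
  assumes S: "smooth_on S f" and r: "ball z r \<subseteq> S" and s: "0 < s" "s * (norm v + norm w) < r"
  shows "\<exists>p. dist z p \<le> s * (norm v + norm w) \<and>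
    f (z + s *\<^sub>R v + s *\<^sub>R w) - f (z + s *\<^sub>R v) - f (z + s *\<^sub>R w) + f z =
    s\<^sup>2 * frechet_derivative (\<lambda>x. frechet_derivative f (at x) v) (at p) w"
proof -
  let ?Dv = "\<lambda>x. frechet_derivative f (at x) v"
  have near: "dist z (z + \<xi> *\<^sub>R v + \<eta> *\<^sub>R w) \<le> s * (norm v + norm w)"
    if "0 \<le> \<xi>" "\<xi> \<le> s" "0 \<le> \<eta>" "\<eta> \<le> s" for \<xi> \<eta>
  proof -
    have "dist z (z + \<xi> *\<^sub>R v + \<eta> *\<^sub>R w) = norm (\<xi> *\<^sub>R v + \<eta> *\<^sub>R w)"
      by (metis add.assoc dist_norm add_diff_cancel_left' dist_commute)
    also have "\<dots> \<le> \<xi> * norm v + \<eta> * norm w"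
      using norm_triangle_ineq[of "\<xi> *\<^sub>R v" "\<eta> *\<^sub>R w"] that by simp
    also have "\<dots> \<le> s * norm v + s * norm w"
      using that by (intro add_mono mult_right_mono) auto
    finally show ?thesis by (simp add: distrib_left)
  qed
  have inS: "z + \<xi> *\<^sub>R v + \<eta> *\<^sub>R w \<in> S" if "0 \<le> \<xi>" "\<xi> \<le> s" "0 \<le> \<eta>" "\<eta> \<le> s" for \<xi> \<eta>
    using near[OF that] s r by (auto simp: subset_iff)
  have dline: "((\<lambda>\<sigma>. F (q + \<sigma> *\<^sub>R u)) has_real_derivative frechet_derivative F (at (q + \<sigma> *\<^sub>R u)) u) (at \<sigma>)"
    if "smooth_on S F" "q + \<sigma> *\<^sub>R u \<in> S" for F :: "'a \<Rightarrow> real" and q u \<sigma>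
  proof -
    have FD: "(F has_derivative frechet_derivative F (at (q + \<sigma> *\<^sub>R u))) (at (q + \<sigma> *\<^sub>R u))"
      using that smooth_on_imp_differentiable has_derivative_frechet by blast
    have "((\<lambda>\<sigma>. q + \<sigma> *\<^sub>R u) has_derivative (\<lambda>\<tau>. \<tau> *\<^sub>R u)) (at \<sigma>)"
      by (auto intro!: derivative_eq_intros)
    from has_derivative_compose[OF this FD]
    have "((\<lambda>\<sigma>. F (q + \<sigma> *\<^sub>R u)) has_derivative (\<lambda>\<tau>. frechet_derivative F (at (q + \<sigma> *\<^sub>R u)) (\<tau> *\<^sub>R u))) (at \<sigma>)" .
    moreover have "frechet_derivative F (at (q + \<sigma> *\<^sub>R u)) (\<tau> *\<^sub>R u) =
        frechet_derivative F (at (q + \<sigma> *\<^sub>R u)) u * \<tau>" for \<tau>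
      using linear_scale[OF linear_frechet_derivative[OF smooth_on_imp_differentiable[OF that]]]
      by simp
    ultimately show ?thesis by (simp add: has_field_derivative_def)
  qed
  define \<psi> where "\<psi> = (\<lambda>\<sigma>. f ((z + s *\<^sub>R w) + \<sigma> *\<^sub>R v) - f (z + \<sigma> *\<^sub>R v))"
  have "\<exists>\<xi>. 0 < \<xi> \<and> \<xi> < s \<and> \<psi> s - \<psi> 0 = (s - 0) * (?Dv ((z + s *\<^sub>R w) + \<xi> *\<^sub>R v) - ?Dv (z + \<xi> *\<^sub>R v))"
  proof (rule MVT2[OF s(1)])
    fix \<sigma> assume "0 \<le> \<sigma>" "\<sigma> \<le> s"
    then show "(\<psi> has_real_derivative
        ?Dv ((z + s *\<^sub>R w) + \<sigma> *\<^sub>R v) - ?Dv (z + \<sigma> *\<^sub>R v)) (at \<sigma>)"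
      unfolding \<psi>_def using inS[of \<sigma> s] inS[of \<sigma> 0] s
      by (intro DERIV_diff dline S) (auto simp: ac_simps)
  qed
  then obtain \<xi> where \<xi>: "0 < \<xi>" "\<xi> < s"
    "\<psi> s - \<psi> 0 = s * (?Dv ((z + s *\<^sub>R w) + \<xi> *\<^sub>R v) - ?Dv (z + \<xi> *\<^sub>R v))" by auto
  have "\<exists>\<eta>. 0 < \<eta> \<and> \<eta> < s \<and> ?Dv ((z + \<xi> *\<^sub>R v) + s *\<^sub>R w) - ?Dv ((z + \<xi> *\<^sub>R v) + 0 *\<^sub>R w) =
    (s - 0) * frechet_derivative ?Dv (at ((z + \<xi> *\<^sub>R v) + \<eta> *\<^sub>R w)) w"
  proof (rule MVT2[OF s(1)])
    fix \<sigma> assume "0 \<le> \<sigma>" "\<sigma> \<le> s"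
    then show "((\<lambda>\<sigma>. ?Dv ((z + \<xi> *\<^sub>R v) + \<sigma> *\<^sub>R w)) has_real_derivative
        frechet_derivative ?Dv (at ((z + \<xi> *\<^sub>R v) + \<sigma> *\<^sub>R w)) w) (at \<sigma>)"
      using inS[of \<xi> \<sigma>] \<xi> by (intro dline smooth_on_frechet_derivative S) auto
  qed
  then obtain \<eta> where \<eta>: "0 < \<eta>" "\<eta> < s" "?Dv ((z + \<xi> *\<^sub>R v) + s *\<^sub>R w) - ?Dv (z + \<xi> *\<^sub>R v) =
    s * frechet_derivative ?Dv (at ((z + \<xi> *\<^sub>R v) + \<eta> *\<^sub>R w)) w" by auto
  have "f (z + s *\<^sub>R v + s *\<^sub>R w) - f (z + s *\<^sub>R v) - f (z + s *\<^sub>R w) + f z = \<psi> s - \<psi> 0"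
    by (simp add: \<psi>_def algebra_simps)
  also have "\<dots> = s * (?Dv ((z + \<xi> *\<^sub>R v) + s *\<^sub>R w) - ?Dv (z + \<xi> *\<^sub>R v))"
    using \<xi> by (simp add: ac_simps)
  also have "\<dots> = s\<^sup>2 * frechet_derivative ?Dv (at (z + \<xi> *\<^sub>R v + \<eta> *\<^sub>R w)) w"
    using \<eta> by (simp add: power2_eq_square)
  finally show ?thesis using near[of \<xi> \<eta>] \<xi> \<eta> by force
qed

lemma mixed_derivatives_commute_real:
  fixes f :: "'a::real_normed_vector \<Rightarrow> real"
  assumes S: "smooth_on S f" "open S" "z \<in> S"
  shows "frechet_derivative (\<lambda>x. frechet_derivative f (at x) v) (at z) w =
    frechet_derivative (\<lambda>x. frechet_derivative f (at x) w) (at z) v"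
proof -
  define A where "A v w x = frechet_derivative (\<lambda>x. frechet_derivative f (at x) v) (at x) w" for v w x
  have cont: "isCont (A v w) z" for v w
  proof -
    have "smooth_on S (A v w)"
      unfolding A_def by (intro smooth_on_frechet_derivative S)
    from smooth_on_continuous[OF this] show ?thesis
      using continuous_on_eq_continuous_at[OF S(2)] S(3) by blast
  qed
  have "\<bar>A v w z - A w v z\<bar> \<le> e" if e: "e > 0" for e
  proof -
    obtain d1 where d1: "d1 > 0" "\<And>p. dist p z < d1 \<Longrightarrow> dist (A v w p) (A v w z) < e/2"
      using cont[of v w, unfolded continuous_at_eps_delta, rule_format, OF half_gt_zero[OF e]]
      by blast
    obtain d2 where d2: "d2 > 0" "\<And>p. dist p z < d2 \<Longrightarrow> dist (A w v p) (A w v z) < e/2"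
      using cont[of w v, unfolded continuous_at_eps_delta, rule_format, OF half_gt_zero[OF e]]
      by blast
    obtain r where r: "r > 0" "ball z r \<subseteq> S" using S by (meson openE)
    define m where "m = min r (min d1 d2)"
    have m: "m > 0" using r d1 d2 by (simp add: m_def)
    define N where "N = norm v + norm w + 1"
    have npos: "N > 0" by (simp add: N_def add_nonneg_pos)
    define s where "s = m / (2 * N)"
    have s: "s > 0" using m npos by (simp add: s_def)
    have "s * (norm v + norm w) \<le> s * N" using s by (simp add: N_def)
    also have "\<dots> = m / 2" using npos by (simp add: s_def)
    also have "\<dots> < m" using m by simp
    finally have sm: "s * (norm v + norm w) < m" .
    obtain p where p: "dist z p \<le> s * (norm v + norm w)"
      "f (z + s *\<^sub>R v + s *\<^sub>R w) - f (z + s *\<^sub>R v) - f (z + s *\<^sub>R w) + f z = s\<^sup>2 * A v w p"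
      using second_difference_eq_mixed_derivative[OF S(1) r(2) s, of v w] sm
      unfolding A_def m_def by auto
    obtain q where q: "dist z q \<le> s * (norm v + norm w)"
      "f (z + s *\<^sub>R w + s *\<^sub>R v) - f (z + s *\<^sub>R w) - f (z + s *\<^sub>R v) + f z = s\<^sup>2 * A w v q"
      using second_difference_eq_mixed_derivative[OF S(1) r(2) s, of w v] sm
      unfolding A_def m_def by (auto simp: add.commute)
    have "s\<^sup>2 * A v w p = s\<^sup>2 * A w v q"
      using p(2) q(2) by (simp add: algebra_simps)
    then have "A v w p = A w v q" using s by simp
    moreover have "dist (A v w p) (A v w z) < e/2"
      using p sm by (intro d1) (auto simp: m_def dist_commute)
    moreover have "dist (A w v q) (A w v z) < e/2"
      using q sm by (intro d2) (auto simp: m_def dist_commute)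
    ultimately show ?thesis unfolding dist_real_def by linarith
  qed
  then have "\<bar>A v w z - A w v z\<bar> \<le> 0" by (rule field_le_epsilon) simp
  then show ?thesis by (simp add: A_def)
qed

lemma mixed_derivatives_commute:
  fixes f :: "'a::real_normed_vector \<Rightarrow> 'b::euclidean_space"
  assumes S: "smooth_on S f" "open S" "z \<in> S"
  shows "frechet_derivative (\<lambda>x. frechet_derivative f (at x) v) (at z) w =
    frechet_derivative (\<lambda>x. frechet_derivative f (at x) w) (at z) v"
proof (rule euclidean_eqI)
  fix b :: 'b
  have comp: "frechet_derivative (\<lambda>x. F x \<bullet> b) (at x) u = frechet_derivative F (at x) u \<bullet> b"
    if "smooth_on S F" "x \<in> S" for F :: "'a \<Rightarrow> 'b" and x u
    using that
    by (subst frechet_eqI[OF bounded_linear.has_derivative[OF bounded_linear_inner_left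
            has_derivative_frechet[OF smooth_on_imp_differentiable]]]) auto
  have two: "frechet_derivative (\<lambda>x. frechet_derivative (\<lambda>x. f x \<bullet> b) (at x) v) (at z) w =
      frechet_derivative (\<lambda>x. frechet_derivative f (at x) v) (at z) w \<bullet> b" for v w
  proof -
    have "frechet_derivative (\<lambda>x. frechet_derivative (\<lambda>x. f x \<bullet> b) (at x) v) (at z) =
        frechet_derivative (\<lambda>x. frechet_derivative f (at x) v \<bullet> b) (at z)"
      using comp[OF S(1)] by (intro frechet_derivative_cong_open[OF S(2,3)]) auto
    then show ?thesis
      using comp[OF smooth_on_frechet_derivative[OF S(1)] S(3)] by simp
  qed
  have "smooth_on S (\<lambda>x. f x \<bullet> b)"
    using smooth_on_bounded_linear_comp[OF bounded_linear_inner_left S(2,1)] .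
  from mixed_derivatives_commute_real[OF this S(2,3), of v w]
  show "frechet_derivative (\<lambda>x. frechet_derivative f (at x) v) (at z) w \<bullet> b =
    frechet_derivative (\<lambda>x. frechet_derivative f (at x) w) (at z) v \<bullet> b"
    by (simp add: two)
qed

lemma frechet_derivative_chain:
  assumes "f differentiable (at x)" "g differentiable (at (f x))"
  shows "frechet_derivative (\<lambda>x. g (f x)) (at x) v =
    frechet_derivative g (at (f x)) (frechet_derivative f (at x) v)"
  using frechet_eqI[OF has_derivative_compose[OF has_derivative_frechet[OF assms(1)]
        has_derivative_frechet[OF assms(2)]]] by simp

lemma frechet_derivative_bounded_linear:
  "bounded_linear L \<Longrightarrow> f differentiable (at x) \<Longrightarrow>
    frechet_derivative (\<lambda>x. L (f x)) (at x) v = L (frechet_derivative f (at x) v)"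
  using frechet_eqI[OF bounded_linear.has_derivative[OF _ has_derivative_frechet]] by metis

lemma smooth_on_vec_lambda:
  fixes f :: "'i::finite \<Rightarrow> 'a::real_normed_vector \<Rightarrow> 'b::euclidean_space"
  assumes "open S" "\<And>i. smooth_on S (f i)"
  shows "smooth_on S (\<lambda>x. \<chi> i. f i x)"
proof -
  have L: "bounded_linear (axis i :: 'b \<Rightarrow> 'b^'i)" for i
    by (rule linear_conv_bounded_linear[THEN iffD1])
      (auto intro!: linearI simp: vec_eq_iff axis_def)
  have "smooth_on S (\<lambda>x. \<Sum>i\<in>UNIV. axis i (f i x))"
    using smooth_on_bounded_linear_comp[OF L assms(1,2)]
    unfolding smooth_on_def by (intro allI Ck_on_sum[OF assms(1)]) auto
  moreover have "(\<Sum>i\<in>UNIV. axis i (f i x)) = (\<chi> i. f i x)" for x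
    by (simp add: vec_eq_iff axis_def sum.delta)
  ultimately show ?thesis by simp
qed

lemma open_Collect_preimage:
  assumes "continuous_on S f" "open S" "open T"
  shows "open {x \<in> S. f x \<in> T}"
proof -
  have "{x \<in> S. f x \<in> T} = S \<inter> f -` T" by auto
  then show ?thesis using continuous_open_preimage[OF assms] by simp
qed

section \<open>Riemannian metrics on open sets of coordinate space\<close>

definition gform :: "real^'n^'n \<Rightarrow> real^'n \<Rightarrow> real^'n::finite \<Rightarrow> real" where
  "gform M u v = u \<bullet> (M *v v)"

lemma gform_bilinear [simp]:
  "gform M (u + u') v = gform M u v + gform M u' v"
  "gform M u (v + v') = gform M u v + gform M u v'"
  "gform M (u - u') v = gform M u v - gform M u' v"
  "gform M u (v - v') = gform M u v - gform M u v'"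
  "gform M (- u) v = - gform M u v"
  "gform M u (- v) = - gform M u v"
  "gform M (c *\<^sub>R u) v = c * gform M u v"
  "gform M u (c *\<^sub>R v) = c * gform M u v"
  "gform M 0 v = 0" "gform M u 0 = 0"
  by (simp_all add: gform_def inner_simps matrix_vector_right_distrib matrix_vector_mult_diff_distrib
      matrix_vector_mult_scaleR vec.neg)

lemma gform_matrix [simp]:
  "gform (M + M') u v = gform M u v + gform M' u v"
  "gform (c *\<^sub>R M) u v = c * gform M u v"
  by (simp_all add: gform_def matrix_vector_mult_add_rdistrib inner_add_right scaleR_matrix_vector_assoc[symmetric])

lemma gform_eq_sum: "gform M u v = (\<Sum>i\<in>UNIV. \<Sum>j\<in>UNIV. M $ i $ j * u $ i * v $ j)"
  by (simp add: gform_def inner_vec_def matrix_vector_mult_def sum_distrib_left ac_simps)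

lemma gform_axis [simp]: "gform M (axis i 1) (axis j 1) = M $ i $ j"
  by (simp add: gform_def matrix_vector_mul_component inner_axis' inner_axis)

lemma gform_axis_left: "gform M (axis i 1) v = (M *v v) $ i"
  by (simp add: gform_def inner_axis')

lemma bounded_bilinear_matrix_vector_mult:
  "bounded_bilinear (\<lambda>(M::real^'n::finite^'n) v. M *v v)"
  by (subst bilinear_conv_bounded_bilinear[symmetric])
    (auto simp: bilinear_def linear_iff matrix_vector_right_distrib matrix_vector_mult_add_rdistrib
      matrix_vector_mult_scaleR scaleR_matrix_vector_assoc[symmetric])

lemma has_derivative_gform:
  assumes "(M has_derivative M') (at x within S)" "(u has_derivative u') (at x within S)"
    "(v has_derivative v') (at x within S)"
  shows "((\<lambda>x. gform (M x) (u x) (v x)) has_derivative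
    (\<lambda>h. gform (M' h) (u x) (v x) + gform (M x) (u' h) (v x) + gform (M x) (u x) (v' h))) (at x within S)"
  unfolding gform_def
  by (rule has_derivative_eq_rhs[OF has_derivative_inner[OF assms(2)
      bounded_bilinear.FDERIV[OF bounded_bilinear_matrix_vector_mult assms(1,3)]]])
    (simp add: fun_eq_iff inner_add_right)

text \<open>
Coordinate equations are indexed by basis vectors, whereas the invariant computations below test
against arbitrary vectors; this passes between the two.
\<close>

lemma linear_zero_iff_axis:
  fixes f :: "real^'n::finite \<Rightarrow> real"
  assumes "linear f"
  shows "(\<forall>a. f a = 0) \<longleftrightarrow> (\<forall>i. f (axis i 1) = 0)"
proof
  assume *: "\<forall>i. f (axis i 1) = 0"
  show "\<forall>a. f a = 0"
  proof
    fix a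
    have "f a = (\<Sum>b\<in>Basis. (a \<bullet> b) *\<^sub>R f b)" by (rule linear_eq_sum_Basis[OF assms])
    also have "\<dots> = 0" using * by (intro sum.neutral) (auto simp: Basis_vec_def)
    finally show "f a = 0" .
  qed
qed simp

lemma linear_eq_sum_axis:
  fixes f :: "real^'n::finite \<Rightarrow> real"
  assumes "linear f"
  shows "f a = (\<Sum>i\<in>UNIV. a $ i * f (axis i 1))"
proof -
  have "f a = f (\<Sum>i\<in>UNIV. a $ i *\<^sub>R axis i 1)"
    by (rule arg_cong[of _ _ f]) (simp add: vec_eq_iff axis_def sum.delta' if_distrib cong: if_cong)
  then show ?thesis by (simp add: linear_sum[OF assms] linear_scale[OF assms])
qed

lemma invertible_if_positive_definite:
  fixes M :: "real^'n::finite^'n"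
  assumes "\<And>v. v \<noteq> 0 \<Longrightarrow> gform M v v > 0"
  shows "invertible M"
proof -
  have "M *v v = 0 \<Longrightarrow> v = 0" for v
    using assms[of v] by (auto simp: gform_def)
  then show ?thesis by (simp add: invertible_left_inverse matrix_left_invertible_ker)
qed

text \<open>
Lowering the index: a second-order equation solved for the acceleration, as geodesic equations are
usually written, is equivalent to one for the momentum.
\<close>

lemma add_matrix_inv_mult_eq_0_iff:
  fixes M :: "real^'n::finite^'n"
  assumes "invertible M"
  shows "u + matrix_inv M *v c = 0 \<longleftrightarrow> M *v u + c = 0"
proof -
  have inv: "M ** matrix_inv M = mat 1" "matrix_inv M ** M = mat 1"
    using someI_ex[OF assms[unfolded invertible_def]] by (auto simp: matrix_inv_def)
  have "M *v (u + matrix_inv M *v c) = M *v u + c"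
    by (simp add: matrix_vector_right_distrib matrix_vector_mul_assoc inv)
  moreover have "matrix_inv M *v (M *v u + c) = u + matrix_inv M *v c"
    by (simp add: matrix_vector_right_distrib matrix_vector_mul_assoc inv)
  ultimately show ?thesis by (metis matrix_vector_mult_0_right)
qed

lemma smooth_on_has_vector_derivative:
  fixes x :: "real \<Rightarrow> 'b::real_normed_vector"
  shows "smooth_on J x \<Longrightarrow> t \<in> J \<Longrightarrow> (x has_vector_derivative vector_derivative x (at t)) (at t)"
  using smooth_on_imp_differentiable vector_derivative_works differentiableI_vector
  by blast

lemma smooth_on_vector_derivative:
  fixes x :: "real \<Rightarrow> 'b::real_normed_vector"
  assumes "open J" "smooth_on J x"
  shows "smooth_on J (\<lambda>t. vector_derivative x (at t))"
  by (rule smooth_on_cong[OF smooth_on_frechet_derivative[OF assms(2), of 1] assms(1)])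
    (simp add: frechet_derivative_eq_vector_derivative smooth_on_imp_differentiable[OF assms(2)])

lemma has_vector_derivative_along_curve:
  assumes "(f has_derivative f') (at (x t))" "(x has_vector_derivative x') (at t)"
  shows "((\<lambda>\<tau>. f (x \<tau>)) has_vector_derivative f' x') (at t)"
  using vector_derivative_diff_chain_within[of x x' t UNIV f f'] assms
  by (simp add: o_def has_derivative_at_withinI)

locale riemannian_chart =
  fixes S :: "(real^'n::finite) set" and G :: "real^'n \<Rightarrow> real^'n^'n" and w :: "real^'n \<Rightarrow> real^'n"
  assumes open_S: "open S"
    and smooth_G: "smooth_on S G"
    and smooth_w: "smooth_on S w"
    and sym: "x \<in> S \<Longrightarrow> gform (G x) u v = gform (G x) v u"
    and pos: "x \<in> S \<Longrightarrow> u \<noteq> 0 \<Longrightarrow> gform (G x) u u > 0"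
begin

abbreviation DG where "DG x \<equiv> frechet_derivative G (at x)"
abbreviation Dw where "Dw x \<equiv> frechet_derivative w (at x)"

lemma G_has_derivative: "x \<in> S \<Longrightarrow> (G has_derivative DG x) (at x)"
  using smooth_on_imp_differentiable[OF smooth_G] has_derivative_frechet by blast

lemma w_has_derivative: "x \<in> S \<Longrightarrow> (w has_derivative Dw x) (at x)"
  using smooth_on_imp_differentiable[OF smooth_w] has_derivative_frechet by blast

lemma linear_DG: "x \<in> S \<Longrightarrow> linear (DG x)"
  using G_has_derivative has_derivative_linear by blast

lemma linear_Dw: "x \<in> S \<Longrightarrow> linear (Dw x)"
  using w_has_derivative has_derivative_linear by blast

lemma DG_sym:
  assumes x: "x \<in> S"
  shows "gform (DG x a) u v = gform (DG x a) v u"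
proof -
  have "((\<lambda>z. gform (G z) u v) has_derivative (\<lambda>h. gform (DG x h) u v)) (at x)" for u v
    using has_derivative_gform[OF G_has_derivative[OF x] has_derivative_const has_derivative_const] by simp
  note D = this
  have "((\<lambda>z. gform (G z) u v) has_derivative (\<lambda>h. gform (DG x h) v u)) (at x)"
    by (rule has_derivative_transform_within_open[OF D open_S x]) (rule sym)
  from has_derivative_unique[OF D this] show ?thesis by (rule fun_cong)
qed

lemma invertible_G: "x \<in> S \<Longrightarrow> invertible (G x)"
  using pos invertible_if_positive_definite by blast

definition drift_vel :: "real \<Rightarrow> (real \<Rightarrow> real^'n) \<Rightarrow> real \<Rightarrow> real^'n" where
  "drift_vel s x t = vector_derivative x (at t) - s *\<^sub>R w (x t)"

text \<open>
The drift geodesic equation at time \<open>t\<close>.  With \<open>v\<close> the relative velocity, the left-hand side is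
\<open>d/dt g(v, a)\<close> for a constant vector \<open>a\<close>, expanded by the product rule.
\<close>

definition momentum_eq :: "real \<Rightarrow> (real \<Rightarrow> real^'n) \<Rightarrow> real \<Rightarrow> bool" where
  "momentum_eq s x t \<longleftrightarrow> (\<forall>a.
     gform (DG (x t) (vector_derivative x (at t))) (drift_vel s x t) a
       + gform (G (x t)) (vector_derivative (drift_vel s x) (at t)) a
     = 1/2 * gform (DG (x t) a) (drift_vel s x t) (drift_vel s x t)
       - s * gform (G (x t)) (drift_vel s x t) (Dw (x t) a))"

lemma smooth_drift_vel:
  assumes "open J" "smooth_on J x" "x ` J \<subseteq> S"
  shows "smooth_on J (drift_vel s x)"
proof -
  have "smooth_on J (\<lambda>t. vector_derivative x (at t) + (-s) *\<^sub>R w (x t))"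
    by (intro smooth_on_add smooth_on_vector_derivative assms
        smooth_on_bounded_linear_comp[OF bounded_linear_scaleR_right]
        smooth_on_compose[OF smooth_w assms(2,1,3)])
  then show ?thesis by (simp add: drift_vel_def[abs_def])
qed

lemma pairing_has_derivative:
  assumes "x t \<in> S" "(x has_vector_derivative x') (at t)" "(u has_vector_derivative u') (at t)"
    "(v has_vector_derivative v') (at t)"
  shows "((\<lambda>\<tau>. gform (G (x \<tau>)) (u \<tau>) (v \<tau>)) has_real_derivative
    gform (DG (x t) x') (u t) (v t) + gform (G (x t)) u' (v t) + gform (G (x t)) (u t) v') (at t)"
proof -
  have "((\<lambda>\<tau>. G (x \<tau>)) has_vector_derivative DG (x t) x') (at t)"
    by (rule has_vector_derivative_along_curve[OF G_has_derivative assms(2)]) (rule assms)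
  from has_derivative_gform[OF this[unfolded has_vector_derivative_def]
      assms(3,4)[unfolded has_vector_derivative_def]]
  show ?thesis
    unfolding has_field_derivative_def
    by (rule has_derivative_eq_rhs) (simp add: fun_eq_iff algebra_simps)
qed

end

context riemannian_chart
begin

lemma drift_vel_cong:
  assumes "open J" "t \<in> J" "\<And>\<tau>. \<tau> \<in> J \<Longrightarrow> x \<tau> = y \<tau>"
  shows "drift_vel s x t = drift_vel s y t"
  using assms vector_derivative_cong_open[OF assms] by (simp add: drift_vel_def)

lemma momentum_eq_cong:
  assumes "open J" "t \<in> J" "\<And>\<tau>. \<tau> \<in> J \<Longrightarrow> x \<tau> = y \<tau>"
  shows "momentum_eq s x t \<longleftrightarrow> momentum_eq s y t"
proof -
  have "vector_derivative (drift_vel s x) (at t) = vector_derivative (drift_vel s y) (at t)"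
    using assms by (intro vector_derivative_cong_open[OF assms(1,2)] drift_vel_cong[OF assms(1)])
  then show ?thesis
    using drift_vel_cong[OF assms] vector_derivative_cong_open[OF assms] assms
    by (simp add: momentum_eq_def)
qed

end

locale unit_killing_chart = riemannian_chart S G w
  for S :: "(real^'n::finite) set" and G w +
  assumes unit: "x \<in> S \<Longrightarrow> gform (G x) (w x) (w x) = 1"
    and killing: "x \<in> S \<Longrightarrow>
      gform (DG x (w x)) a b + gform (G x) (Dw x a) b + gform (G x) a (Dw x b) = 0"
begin

lemma unit_derivative:
  assumes x: "x \<in> S"
  shows "gform (DG x a) (w x) (w x) + 2 * gform (G x) (w x) (Dw x a) = 0"
proof -
  have "((\<lambda>z. gform (G z) (w z) (w z)) has_derivative (\<lambda>h. gform (DG x h) (w x) (w x) +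
      gform (G x) (Dw x h) (w x) + gform (G x) (w x) (Dw x h))) (at x)"
    using x by (intro has_derivative_gform G_has_derivative w_has_derivative)
  moreover have "((\<lambda>z. gform (G z) (w z) (w z)) has_derivative (\<lambda>h. 0)) (at x)"
    by (rule has_derivative_transform_within_open[OF has_derivative_const open_S x]) (simp add: unit)
  ultimately have "(\<lambda>h. gform (DG x h) (w x) (w x) +
      gform (G x) (Dw x h) (w x) + gform (G x) (w x) (Dw x h)) = (\<lambda>h. 0)"
    by (rule has_derivative_unique)
  from fun_cong[OF this, of a] show ?thesis using sym[OF x, of "Dw x a" "w x"] by simp
qed

text \<open>
On the diagonal the Killing equation says that the derivative of \<open>1/2 g(v, v)\<close> along the flow of
\<open>w\<close> vanishes.  This is the only form in which it enters the computations along curves.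
\<close>

lemma killing_diag:
  "x \<in> S \<Longrightarrow> gform (DG x (w x)) v v + 2 * gform (G x) v (Dw x v) = 0"
  using killing[of x v v] sym[of x "Dw x v" v] by simp

text \<open>
The symmetry \<open>w\<close> conserves the momentum in its own direction, for every drift parameter: the two
terms containing \<open>s\<close> cancel, and what remains is the Killing equation evaluated at \<open>v\<close>.
\<close>

lemma noether:
  assumes J: "open J" "smooth_on J x" "x ` J \<subseteq> S" "t \<in> J" and eq: "momentum_eq s x t"
  shows "((\<lambda>\<tau>. gform (G (x \<tau>)) (drift_vel s x \<tau>) (w (x \<tau>))) has_real_derivative 0) (at t)"
proof -
  define v where "v = drift_vel s x t"
  have xS: "x t \<in> S" using J by auto
  have x': "vector_derivative x (at t) = v + s *\<^sub>R w (x t)" by (simp add: v_def drift_vel_def)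
  have D: "((\<lambda>\<tau>. gform (G (x \<tau>)) (drift_vel s x \<tau>) (w (x \<tau>))) has_real_derivative
     gform (DG (x t) (vector_derivative x (at t))) v (w (x t))
     + gform (G (x t)) (vector_derivative (drift_vel s x) (at t)) (w (x t))
     + gform (G (x t)) v (Dw (x t) (vector_derivative x (at t)))) (at t)"
    unfolding v_def
    using J xS by (intro pairing_has_derivative smooth_on_has_vector_derivative smooth_drift_vel
        has_vector_derivative_along_curve[OF w_has_derivative]) auto
  have "gform (DG (x t) (vector_derivative x (at t))) v (w (x t))
     + gform (G (x t)) (vector_derivative (drift_vel s x) (at t)) (w (x t))
     + gform (G (x t)) v (Dw (x t) (vector_derivative x (at t))) =
     1/2 * gform (DG (x t) (w (x t))) v v - s * gform (G (x t)) v (Dw (x t) (w (x t)))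
     + gform (G (x t)) v (Dw (x t) (v + s *\<^sub>R w (x t)))"
    using eq unfolding momentum_eq_def v_def[symmetric] x'[symmetric] by simp
  also have "\<dots> = 1/2 * (gform (DG (x t) (w (x t))) v v + 2 * gform (G (x t)) v (Dw (x t) v))"
    by (simp add: linear_add[OF linear_Dw[OF xS]] linear_scale[OF linear_Dw[OF xS]] algebra_simps)
  also have "\<dots> = 0" by (simp only: killing_diag[OF xS])
  finally show ?thesis using D by simp
qed

end

text \<open>
Contracted twice with the velocity, the first two terms of the Christoffel symbols coincide, so
their sum with the third is \<open>(D_v g)(v, a) - 1/2 (D_a g)(v, v)\<close>, up to raising the index of \<open>a\<close>.
\<close>

lemma (in riemannian_chart) geodesic_iff_momentum_eq:
  assumes J: "open J" "smooth_on J x" "x ` J \<subseteq> S" "t \<in> J"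
  defines "v \<equiv> vector_derivative x (at t)"
  defines "v' \<equiv> vector_derivative (\<lambda>\<tau>. vector_derivative x (at \<tau>)) (at t)"
  shows "(\<forall>i. v' $ i + (\<Sum>j\<in>UNIV. \<Sum>k\<in>UNIV.
      (1/2 * (\<Sum>l\<in>UNIV. matrix_inv (G (x t)) $ i $ l *
        (DG (x t) (axis j 1) $ l $ k + DG (x t) (axis k 1) $ l $ j - DG (x t) (axis l 1) $ j $ k)))
      * v $ j * v $ k) = 0) \<longleftrightarrow> momentum_eq 0 x t"
proof -
  have xS: "x t \<in> S" using J by auto
  define c :: "real^'n" where
    "c = (\<chi> l. gform (DG (x t) v) v (axis l 1) - 1/2 * gform (DG (x t) (axis l 1)) v v)"
  have lin1: "linear (\<lambda>a. gform (DG (x t) a) u y)" for u y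
    by (intro linearI) (simp_all add: linear_add[OF linear_DG[OF xS]] linear_scale[OF linear_DG[OF xS]])
  have Dv: "(\<Sum>j\<in>UNIV. v $ j * DG (x t) (axis j 1) $ l $ k) = DG (x t) v $ l $ k" for l k
    using linear_eq_sum_axis[OF lin1[of "axis l 1" "axis k 1"], of v] by simp
  have c: "1/2 * (\<Sum>j\<in>UNIV. \<Sum>k\<in>UNIV. (DG (x t) (axis j 1) $ l $ k + DG (x t) (axis k 1) $ l $ j
      - DG (x t) (axis l 1) $ j $ k) * v $ j * v $ k) = c $ l" for l
  proof -
    have row: "(\<Sum>k\<in>UNIV. DG (x t) v $ l $ k * v $ k) = gform (DG (x t) v) v (axis l 1)"
      by (subst DG_sym[OF xS]) (simp add: gform_axis_left matrix_vector_mult_def)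
    have "(\<Sum>j\<in>UNIV. \<Sum>k\<in>UNIV. DG (x t) (axis j 1) $ l $ k * v $ j * v $ k) =
        (\<Sum>k\<in>UNIV. (\<Sum>j\<in>UNIV. v $ j * DG (x t) (axis j 1) $ l $ k) * v $ k)"
      by (subst sum.swap) (simp add: sum_distrib_left ac_simps)
    then have 1: "(\<Sum>j\<in>UNIV. \<Sum>k\<in>UNIV. DG (x t) (axis j 1) $ l $ k * v $ j * v $ k) =
        gform (DG (x t) v) v (axis l 1)" by (simp add: Dv row)
    have 2: "(\<Sum>j\<in>UNIV. \<Sum>k\<in>UNIV. DG (x t) (axis k 1) $ l $ j * v $ j * v $ k) =
        gform (DG (x t) v) v (axis l 1)"
      using 1 by (subst sum.swap) (simp add: ac_simps)
    have 3: "(\<Sum>j\<in>UNIV. \<Sum>k\<in>UNIV. DG (x t) (axis l 1) $ j $ k * v $ j * v $ k) =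
        gform (DG (x t) (axis l 1)) v v"
      by (simp add: gform_eq_sum)
    show ?thesis
      by (simp add: left_diff_distrib distrib_right sum.distrib sum_subtractf 1 2 3 c_def)
  qed
  have "(\<Sum>j\<in>UNIV. \<Sum>k\<in>UNIV.
      (1/2 * (\<Sum>l\<in>UNIV. matrix_inv (G (x t)) $ i $ l *
        (DG (x t) (axis j 1) $ l $ k + DG (x t) (axis k 1) $ l $ j - DG (x t) (axis l 1) $ j $ k)))
      * v $ j * v $ k) = (matrix_inv (G (x t)) *v c) $ i" for i
  proof -
    have "(\<Sum>j\<in>UNIV. \<Sum>k\<in>UNIV. (1/2 * (\<Sum>l\<in>UNIV. M l * B j k l)) * v $ j * v $ k) =
       (\<Sum>l\<in>UNIV. M l * (1/2 * (\<Sum>j\<in>UNIV. \<Sum>k\<in>UNIV. B j k l * v $ j * v $ k)))"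
      for M :: "'n \<Rightarrow> real" and B
    proof -
      have "(\<Sum>j\<in>UNIV. \<Sum>k\<in>UNIV. (1/2 * (\<Sum>l\<in>UNIV. M l * B j k l)) * v $ j * v $ k) =
         (\<Sum>j\<in>UNIV. \<Sum>k\<in>UNIV. \<Sum>l\<in>UNIV. M l * (1/2 * (B j k l * v $ j * v $ k)))"
        by (simp add: sum_distrib_left sum_distrib_right sum_divide_distrib ac_simps)
      also have "\<dots> = (\<Sum>j\<in>UNIV. \<Sum>l\<in>UNIV. \<Sum>k\<in>UNIV. M l * (1/2 * (B j k l * v $ j * v $ k)))"
        by (intro sum.cong refl sum.swap)
      also have "\<dots> = (\<Sum>l\<in>UNIV. \<Sum>j\<in>UNIV. \<Sum>k\<in>UNIV. M l * (1/2 * (B j k l * v $ j * v $ k)))"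
        by (rule sum.swap)
      finally show ?thesis by (simp add: sum_distrib_left)
    qed
    then show ?thesis by (simp only: c matrix_vector_mul_component matrix_vector_mult_def vec_lambda_beta)
  qed
  then have "?thesis \<longleftrightarrow> ((\<forall>i. (v' + matrix_inv (G (x t)) *v c) $ i = 0) \<longleftrightarrow> momentum_eq 0 x t)"
    by simp
  moreover have "(\<forall>i. (v' + matrix_inv (G (x t)) *v c) $ i = 0) \<longleftrightarrow> G (x t) *v v' + c = 0"
    unfolding add_matrix_inv_mult_eq_0_iff[OF invertible_G[OF xS], symmetric] by (simp add: vec_eq_iff)
  moreover have "G (x t) *v v' + c = 0 \<longleftrightarrow> (\<forall>l. gform (G (x t)) v' (axis l 1) + c $ l = 0)"
    by (simp add: vec_eq_iff sym[OF xS, of v'] gform_axis_left)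
  moreover have "\<dots> \<longleftrightarrow> momentum_eq 0 x t"
  proof -
    let ?f = "\<lambda>a. gform (G (x t)) v' a + (gform (DG (x t) v) v a - 1/2 * gform (DG (x t) a) v v)"
    have "linear ?f"
      by (intro linearI)
        (simp_all add: linear_add[OF linear_DG[OF xS]] linear_scale[OF linear_DG[OF xS]] algebra_simps)
    from linear_zero_iff_axis[OF this]
    have "(\<forall>l. gform (G (x t)) v' (axis l 1) + c $ l = 0) \<longleftrightarrow> (\<forall>a. ?f a = 0)"
      by (simp add: c_def)
    also have "\<dots> \<longleftrightarrow> momentum_eq 0 x t"
      by (simp add: momentum_eq_def drift_vel_def[abs_def] v_def v'_def algebra_simps)
    finally show ?thesis .
  qed
  ultimately show ?thesis by simp
qed

section \<open>Isometric flows shift the drift parameter\<close>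

text \<open>
The product rule for a derivative that is applied to a moving vector.  Only directional derivatives
along fixed vectors are known to be smooth, hence the expansion in a basis.
\<close>

lemma has_derivative_frechet_derivative_apply:
  fixes f :: "'a::euclidean_space \<Rightarrow> 'b::real_normed_vector"
  assumes f: "smooth_on S f" "open S" "p \<in> S" and k: "(k has_derivative k') (at p)"
  shows "((\<lambda>q. frechet_derivative f (at q) (k q)) has_derivative
    (\<lambda>h. frechet_derivative (\<lambda>q. frechet_derivative f (at q) (k p)) (at p) h
      + frechet_derivative f (at p) (k' h))) (at p)"
proof -
  let ?D = "\<lambda>q. frechet_derivative f (at q)"
  have lin: "linear (?D q)" if "q \<in> S" for q
    using f(1) that by (intro linear_frechet_derivative smooth_on_imp_differentiable)
  have b: "((\<lambda>q. ?D q b) has_derivative frechet_derivative (\<lambda>q. ?D q b) (at p)) (at p)" for b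
    by (intro has_derivative_frechet
        smooth_on_imp_differentiable[OF smooth_on_frechet_derivative[OF f(1)] f(3)])
  have expand: "((\<lambda>q. ?D q (k q)) has_derivative (\<lambda>h. \<Sum>b\<in>Basis.
      (k p \<bullet> b) *\<^sub>R frechet_derivative (\<lambda>q. ?D q b) (at p) h + (k' h \<bullet> b) *\<^sub>R ?D p b)) (at p)"
    if k: "(k has_derivative k') (at p)" for k k'
  proof (rule has_derivative_transform_within_open[OF _ f(2,3)])
    show "((\<lambda>q. \<Sum>b\<in>Basis. (k q \<bullet> b) *\<^sub>R ?D q b) has_derivative (\<lambda>h. \<Sum>b\<in>Basis.
      (k p \<bullet> b) *\<^sub>R frechet_derivative (\<lambda>q. ?D q b) (at p) h + (k' h \<bullet> b) *\<^sub>R ?D p b)) (at p)"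
      by (rule has_derivative_sum, rule has_derivative_scaleR[OF has_derivative_inner_left[OF k] b])
    show "(\<Sum>b\<in>Basis. (k q \<bullet> b) *\<^sub>R ?D q b) = ?D q (k q)" if "q \<in> S" for q
      by (rule linear_eq_sum_Basis[OF lin[OF that], symmetric])
  qed
  have "frechet_derivative (\<lambda>q. ?D q (k p)) (at p) h =
      (\<Sum>b\<in>Basis. (k p \<bullet> b) *\<^sub>R frechet_derivative (\<lambda>q. ?D q b) (at p) h)" for h
    using frechet_eqI[OF expand[OF has_derivative_const, of "k p"]] by simp
  moreover have "?D p (k' h) = (\<Sum>b\<in>Basis. (k' h \<bullet> b) *\<^sub>R ?D p b)" for h
    by (rule linear_eq_sum_Basis[OF lin[OF f(3)]])
  ultimately show ?thesis using expand[OF k] by (simp add: sum.distrib)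
qed

text \<open>
The map \<open>\<Phi>\<close> is the coordinate expression of \<open>(t, x) \<mapsto> \<phi>(r t, x)\<close>, with derivative \<open>d\<close>.  The
isometry condition makes the momentum natural: \<open>g2(V, d (0, a)) = g1(v, a)\<close> for the relative
velocities \<open>v\<close> and \<open>V = d (0, v)\<close> of a curve and its image.  Differentiating this along the curve
produces the second derivative of \<open>\<Phi>\<close> in the directions \<open>(1, x')\<close> and \<open>(0, a)\<close>.  As it is symmetric,
it can be computed by differentiating the three conditions on \<open>\<Phi>\<close> in the direction \<open>(0, a)\<close>, and
their contributions combine to the equation with parameter \<open>s + r\<close>.
\<close>

lemma flow_maps_momentum_eq:
  fixes \<Phi> :: "real \<times> (real^'n::finite) \<Rightarrow> real^'n"
  assumes C1: "riemannian_chart S1 G1 w1" and C2: "riemannian_chart S2 G2 w2"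
    and \<Phi>: "smooth_on D \<Phi>" "open D"
    and D1: "\<And>q. q \<in> D \<Longrightarrow> snd q \<in> S1" and D2: "\<And>q. q \<in> D \<Longrightarrow> \<Phi> q \<in> S2"
    and time: "\<And>q. q \<in> D \<Longrightarrow> frechet_derivative \<Phi> (at q) (1, 0) = r *\<^sub>R w2 (\<Phi> q)"
    and invariant: "\<And>q. q \<in> D \<Longrightarrow> frechet_derivative \<Phi> (at q) (0, w1 (snd q)) = w2 (\<Phi> q)"
    and isometry: "\<And>q a b. q \<in> D \<Longrightarrow> gform (G2 (\<Phi> q)) (frechet_derivative \<Phi> (at q) (0, a))
        (frechet_derivative \<Phi> (at q) (0, b)) = gform (G1 (snd q)) a b"
    and J: "open J" "smooth_on J x" "\<And>\<tau>. \<tau> \<in> J \<Longrightarrow> (\<tau>, x \<tau>) \<in> D" "t \<in> J"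
  defines "y \<equiv> \<lambda>\<tau>. \<Phi> (\<tau>, x \<tau>)"
  shows "smooth_on J y" (is ?smooth)
    and "riemannian_chart.drift_vel w2 (s + r) y t =
      frechet_derivative \<Phi> (at (t, x t)) (0, riemannian_chart.drift_vel w1 s x t)" (is ?drift)
    and "riemannian_chart.momentum_eq G1 w1 s x t \<Longrightarrow>
      riemannian_chart.momentum_eq G2 w2 (s + r) y t"
proof -
  interpret C1: riemannian_chart S1 G1 w1 by (rule C1)
  interpret C2: riemannian_chart S2 G2 w2 by (rule C2)
  define d where "d q = frechet_derivative \<Phi> (at q)" for q
  have xS: "x ` J \<subseteq> S1" using J(3) D1 by force
  have yS: "y ` J \<subseteq> S2" using J(3) D2 by (auto simp: y_def)
  show smy: ?smooth
    unfolding y_def using J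
    by (intro smooth_on_compose[OF \<Phi>(1)] smooth_on_Pair smooth_on_id) auto
  have \<Phi>d: "(\<Phi> has_derivative d q) (at q)" if "q \<in> D" for q
    unfolding d_def using \<Phi> that smooth_on_imp_differentiable has_derivative_frechet by blast
  have lin: "linear (d q)" if "q \<in> D" for q
    using \<Phi>d[OF that] has_derivative_linear by blast
  have curve: "((\<lambda>\<tau>. (\<tau>, x \<tau>)) has_vector_derivative (1, vector_derivative x (at \<tau>))) (at \<tau>)"
    if "\<tau> \<in> J" for \<tau>
    by (intro has_vector_derivative_Pair has_vector_derivative_id
        smooth_on_has_vector_derivative[OF J(2) that])
  have y': "vector_derivative y (at \<tau>) = d (\<tau>, x \<tau>) (1, vector_derivative x (at \<tau>))" if "\<tau> \<in> J" for \<tau>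
    unfolding y_def
    by (rule vector_derivative_at[OF has_vector_derivative_along_curve[OF \<Phi>d[OF J(3)[OF that]] curve[OF that]]])
  have drift: "C2.drift_vel (s + r) y \<tau> = d (\<tau>, x \<tau>) (0, C1.drift_vel s x \<tau>)" if "\<tau> \<in> J" for \<tau>
  proof -
    have q: "(\<tau>, x \<tau>) \<in> D" using J that by auto
    have "(1::real, vector_derivative x (at \<tau>)) =
        (1, 0) + (0, C1.drift_vel s x \<tau>) + s *\<^sub>R (0, w1 (x \<tau>))"
      by (simp add: C1.drift_vel_def)
    then have "vector_derivative y (at \<tau>) =
        d (\<tau>, x \<tau>) (1, 0) + d (\<tau>, x \<tau>) (0, C1.drift_vel s x \<tau>) + s *\<^sub>R d (\<tau>, x \<tau>) (0, w1 (x \<tau>))"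
      by (simp only: y'[OF that] linear_add[OF lin[OF q]] linear_scale[OF lin[OF q]])
    then show ?thesis
      using time[OF q] invariant[OF q] by (simp add: C2.drift_vel_def y_def d_def algebra_simps)
  qed
  from drift[OF J(4)] show ?drift by (simp add: d_def)
  assume mom: "C1.momentum_eq s x t"
  define p where "p = (t, x t)"
  have p: "p \<in> D" using J by (simp add: p_def)
  have xt: "x t \<in> S1" and yt: "y t \<in> S2" using xS yS J by auto
  have \<Phi>p: "\<Phi> p = y t" by (simp add: p_def y_def)
  define H where "H h k = frechet_derivative (\<lambda>q. d q k) (at p) h" for h k
  have H: "((\<lambda>q. d q k) has_derivative (\<lambda>h. H h k)) (at p)" for k
    unfolding H_def d_def
    by (intro has_derivative_frechet
        smooth_on_imp_differentiable[OF smooth_on_frechet_derivative[OF \<Phi>(1)] p])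
  have Hsym: "H h k = H k h" for h k
    unfolding H_def d_def by (rule mixed_derivatives_commute[OF \<Phi> p])
  have Hlin: "linear (H h)" for h
    using has_derivative_linear[OF H[of h]] by (simp add: Hsym[of _ h])
  define v where "v = C1.drift_vel s x t"
  define V where "V = C2.drift_vel (s + r) y t"
  have V: "V = d p (0, v)" using drift[OF J(4)] by (simp add: V_def v_def p_def)
  have x': "vector_derivative x (at t) = v + s *\<^sub>R w1 (x t)" by (simp add: v_def C1.drift_vel_def)
  \<comment> \<open>Differentiate the statement that the curves of constant \<open>x\<close> are
    integral curves of \<open>r w2\<close>.\<close>
  have H1: "H h (1, 0) = r *\<^sub>R C2.Dw (y t) (d p h)" for h
  proof -
    have "((\<lambda>q. r *\<^sub>R w2 (\<Phi> q)) has_derivative (\<lambda>h. r *\<^sub>R C2.Dw (y t) (d p h))) (at p)"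
      using has_derivative_compose[OF \<Phi>d[OF p] C2.w_has_derivative[OF D2[OF p]]]
      by (intro has_derivative_scaleR_right) (simp add: \<Phi>p)
    then have "((\<lambda>q. d q (1, 0)) has_derivative (\<lambda>h. r *\<^sub>R C2.Dw (y t) (d p h))) (at p)"
      by (rule has_derivative_transform_within_open[OF _ \<Phi>(2) p]) (simp add: time d_def)
    from has_derivative_unique[OF H this] show ?thesis by (rule fun_cong)
  qed
  \<comment> \<open>Differentiate the invariance of the field; here the vector that is mapped moves
    as well.\<close>
  have Hw: "H (0, a) (0, w1 (x t)) + d p (0, C1.Dw (x t) a) = C2.Dw (y t) (d p (0, a))" for a
  proof -
    have "((\<lambda>q. w1 (snd q)) has_derivative (\<lambda>h. C1.Dw (x t) (snd h))) (at p)"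
      using has_derivative_compose[OF has_derivative_snd[OF has_derivative_ident]
          C1.w_has_derivative[OF D1[OF p]]] by (simp add: p_def)
    from has_derivative_frechet_derivative_apply[OF \<Phi> p has_derivative_Pair[OF has_derivative_const this]]
    have "((\<lambda>q. d q (0, w1 (snd q))) has_derivative
        (\<lambda>h. H h (0, w1 (x t)) + d p (0, C1.Dw (x t) (snd h)))) (at p)"
      by (simp add: d_def H_def p_def)
    moreover have "((\<lambda>q. d q (0, w1 (snd q))) has_derivative (\<lambda>h. C2.Dw (y t) (d p h))) (at p)"
      by (rule has_derivative_transform_within_open[OF _ \<Phi>(2) p,
            where f="\<lambda>q. w2 (\<Phi> q)"])
        (use has_derivative_compose[OF \<Phi>d[OF p] C2.w_has_derivative[OF D2[OF p]]]
          in \<open>simp_all add: \<Phi>p invariant d_def\<close>)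
    ultimately have "(\<lambda>h. H h (0, w1 (x t)) + d p (0, C1.Dw (x t) (snd h))) = (\<lambda>h. C2.Dw (y t) (d p h))"
      by (rule has_derivative_unique)
    from fun_cong[OF this, of "(0, a)"] show ?thesis by simp
  qed
  \<comment> \<open>Differentiate the isometry condition at the fixed vector
    \<open>v\<close>.\<close>
  have Hv: "gform (C2.DG (y t) (d p (0, a))) V V + 2 * gform (G2 (y t)) V (H (0, a) (0, v))
      = gform (C1.DG (x t) a) v v" for a
  proof -
    have "((\<lambda>q. G2 (\<Phi> q)) has_derivative (\<lambda>h. C2.DG (y t) (d p h))) (at p)"
      using has_derivative_compose[OF \<Phi>d[OF p] C2.G_has_derivative[OF D2[OF p]]] by (simp add: \<Phi>p)
    from has_derivative_gform[OF this H H, of "(0, v)" "(0, v)"]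
    have 1: "((\<lambda>q. gform (G2 (\<Phi> q)) (d q (0, v)) (d q (0, v))) has_derivative
      (\<lambda>h. gform (C2.DG (y t) (d p h)) V V + gform (G2 (y t)) (H h (0, v)) V
        + gform (G2 (y t)) V (H h (0, v)))) (at p)"
      by (simp add: V \<Phi>p)
    have "((\<lambda>q. G1 (snd q)) has_derivative (\<lambda>h. C1.DG (x t) (snd h))) (at p)"
      using has_derivative_compose[OF has_derivative_snd[OF has_derivative_ident]
          C1.G_has_derivative[OF D1[OF p]]] by (simp add: p_def)
    from has_derivative_gform[OF this has_derivative_const has_derivative_const, of v v]
    have "((\<lambda>q. gform (G1 (snd q)) v v) has_derivative (\<lambda>h. gform (C1.DG (x t) (snd h)) v v)) (at p)"
      by simp
    then have "((\<lambda>q. gform (G2 (\<Phi> q)) (d q (0, v)) (d q (0, v))) has_derivative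
        (\<lambda>h. gform (C1.DG (x t) (snd h)) v v)) (at p)"
      by (rule has_derivative_transform_within_open[OF _ \<Phi>(2) p]) (simp add: isometry d_def)
    from fun_cong[OF has_derivative_unique[OF 1 this], of "(0, a)"]
    show ?thesis using C2.sym[OF yt, of "H (0, a) (0, v)" V] by simp
  qed
  have main: "gform (C2.DG (y t) (vector_derivative y (at t))) V (d p (0, a))
       + gform (G2 (y t)) (vector_derivative (C2.drift_vel (s + r) y) (at t)) (d p (0, a))
     = 1/2 * gform (C2.DG (y t) (d p (0, a))) V V
       - (s + r) * gform (G2 (y t)) V (C2.Dw (y t) (d p (0, a)))" for a
  proof -
    have "((\<lambda>\<tau>. d (\<tau>, x \<tau>) (0, a)) has_vector_derivative H (1, vector_derivative x (at t)) (0, a)) (at t)"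
      by (rule has_vector_derivative_along_curve[OF H[of "(0, a)", unfolded p_def] curve[OF J(4)]])
    then have 1: "((\<lambda>\<tau>. gform (G2 (y \<tau>)) (C2.drift_vel (s + r) y \<tau>) (d (\<tau>, x \<tau>) (0, a))) has_real_derivative
       gform (C2.DG (y t) (vector_derivative y (at t))) V (d p (0, a))
       + gform (G2 (y t)) (vector_derivative (C2.drift_vel (s + r) y) (at t)) (d p (0, a))
       + gform (G2 (y t)) V (H (1, vector_derivative x (at t)) (0, a))) (at t)"
      unfolding V_def p_def
      by (intro C2.pairing_has_derivative smooth_on_has_vector_derivative[OF _ J(4)] smy yt
          C2.smooth_drift_vel J yS)
    have "((\<lambda>\<tau>. gform (G1 (x \<tau>)) (C1.drift_vel s x \<tau>) a) has_real_derivative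
       gform (C1.DG (x t) (vector_derivative x (at t))) v a
       + gform (G1 (x t)) (vector_derivative (C1.drift_vel s x) (at t)) a
       + gform (G1 (x t)) v 0) (at t)"
      unfolding v_def
      by (intro C1.pairing_has_derivative smooth_on_has_vector_derivative[OF _ J(4)] xt
          C1.smooth_drift_vel J xS has_vector_derivative_const)
    then have "((\<lambda>\<tau>. gform (G1 (x \<tau>)) (C1.drift_vel s x \<tau>) a) has_real_derivative
       gform (C1.DG (x t) (vector_derivative x (at t))) v a
       + gform (G1 (x t)) (vector_derivative (C1.drift_vel s x) (at t)) a) (at t)"
      by simp
    then have "((\<lambda>\<tau>. gform (G2 (y \<tau>)) (C2.drift_vel (s + r) y \<tau>) (d (\<tau>, x \<tau>) (0, a))) has_real_derivative
       gform (C1.DG (x t) (vector_derivative x (at t))) v a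
       + gform (G1 (x t)) (vector_derivative (C1.drift_vel s x) (at t)) a) (at t)"
      unfolding has_field_derivative_def
    proof (rule has_derivative_transform_within_open[OF _ J(1,4)])
      fix \<tau> assume \<tau>: "\<tau> \<in> J"
      show "gform (G1 (x \<tau>)) (C1.drift_vel s x \<tau>) a =
          gform (G2 (y \<tau>)) (C2.drift_vel (s + r) y \<tau>) (d (\<tau>, x \<tau>) (0, a))"
        using isometry[OF J(3)[OF \<tau>], of "C1.drift_vel s x \<tau>" a]
        unfolding drift[OF \<tau>] by (simp add: d_def y_def)
    qed
    from DERIV_unique[OF 1 this]
    have "gform (C2.DG (y t) (vector_derivative y (at t))) V (d p (0, a))
       + gform (G2 (y t)) (vector_derivative (C2.drift_vel (s + r) y) (at t)) (d p (0, a))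
       + gform (G2 (y t)) V (H (1, vector_derivative x (at t)) (0, a))
       = 1/2 * gform (C1.DG (x t) a) v v - s * gform (G1 (x t)) v (C1.Dw (x t) a)"
      using mom unfolding C1.momentum_eq_def v_def[symmetric] by simp
    moreover have "H (1, vector_derivative x (at t)) (0, a) =
        r *\<^sub>R C2.Dw (y t) (d p (0, a)) + H (0, a) (0, v)
        + s *\<^sub>R (C2.Dw (y t) (d p (0, a)) - d p (0, C1.Dw (x t) a))"
    proof -
      have "(1::real, vector_derivative x (at t)) = (1, 0) + (0, v) + s *\<^sub>R (0, w1 (x t))"
        by (simp add: x')
      then have "H (1, vector_derivative x (at t)) (0, a) =
          H (0, a) (1, 0) + H (0, a) (0, v) + s *\<^sub>R H (0, a) (0, w1 (x t))"
        by (simp only: Hsym[of _ "(0, a)"] linear_add[OF Hlin] linear_scale[OF Hlin])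
      moreover have "H (0, a) (0, w1 (x t)) = C2.Dw (y t) (d p (0, a)) - d p (0, C1.Dw (x t) a)"
        using Hw[of a] by (simp add: algebra_simps)
      ultimately show ?thesis by (simp add: H1)
    qed
    moreover have "gform (G2 (y t)) V (d p (0, C1.Dw (x t) a)) = gform (G1 (x t)) v (C1.Dw (x t) a)"
      using isometry[OF p] by (simp add: V d_def \<Phi>p) (simp add: p_def)
    ultimately show ?thesis using Hv[of a] by (simp add: algebra_simps)
  qed
  show "C2.momentum_eq (s + r) y t"
    unfolding C2.momentum_eq_def V_def[symmetric]
  proof
    fix b
    \<comment> \<open>The directions \<open>d (0, a)\<close> exhaust the space, because an isometry
      is injective on tangent vectors.\<close>
    have lin0: "linear (\<lambda>a. d p (0, a))"
      using linear_compose[OF _ lin[OF p], of "\<lambda>a. (0, a)"] by (simp add: o_def linear_iff)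
    moreover have "d p (0, a) = 0 \<Longrightarrow> a = 0" for a
      using isometry[OF p, of a a] C1.pos[OF D1[OF p], of a] by (auto simp: d_def)
    ultimately have "surj (\<lambda>a. d p (0, a))"
      by (metis linear_injective_0 linear_injective_imp_surjective)
    then obtain a where "b = d p (0, a)" by (meson surjD)
    with main[of a] show "gform (C2.DG (y t) (vector_derivative y (at t))) V b
       + gform (G2 (y t)) (vector_derivative (C2.drift_vel (s + r) y) (at t)) b
     = 1/2 * gform (C2.DG (y t) b) V V - (s + r) * gform (G2 (y t)) V (C2.Dw (y t) b)"
      by simp
  qed
qed

section \<open>The Kropina geodesic equation in coordinates\<close>

lemma energy_quotient_rule:
  fixes A B :: "'a::real_normed_vector \<Rightarrow> real"
  assumes A: "(A has_derivative A') (at y)" and B: "(B has_derivative B') (at y)" and nz: "B y \<noteq> 0"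
  shows "((\<lambda>y. (A y / (2 * B y))\<^sup>2) has_derivative
    (\<lambda>h. A y / B y * (A' h / (2 * B y) - A y * B' h / (2 * (B y)\<^sup>2)))) (at y)"
proof -
  have I: "((\<lambda>y. inverse (B y)) has_derivative (\<lambda>h. - (B' h * (inverse (B y))\<^sup>2))) (at y)"
    using Deriv.has_derivative_inverse[OF nz B] by (simp add: power2_eq_square ac_simps)
  have eq: "(A y / (2 * B y))\<^sup>2 = (A y * inverse (B y)) * (A y * inverse (B y)) * (1/4)" for y
    by (simp add: field_simps power2_eq_square)
  show ?thesis
    unfolding eq
    by (rule has_derivative_eq_rhs[OF has_derivative_mult[OF has_derivative_mult[OF
            has_derivative_mult[OF A I] has_derivative_mult[OF A I]] has_derivative_const]])
      (use nz in \<open>simp add: fun_eq_iff field_simps power2_eq_square\<close>)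
qed

lemma momentum_quotient_rule:
  fixes A B P :: "'a::real_normed_vector \<Rightarrow> real" and q :: real
  assumes A: "(A has_derivative A') (at y)" and P: "(P has_derivative P') (at y)"
    and B: "(B has_derivative B') (at y)" and nz: "B y \<noteq> 0"
  shows "((\<lambda>y. A y / B y * (P y / B y - A y * q / (2 * (B y)\<^sup>2))) has_derivative
    (\<lambda>h. A' h * P y / (B y)\<^sup>2 + A y * P' h / (B y)\<^sup>2 - 2 * A y * P y * B' h / (B y)^3
      - A y * A' h * q / (B y)^3 + 3 * (A y)\<^sup>2 * q * B' h / (2 * (B y)^4))) (at y)"
proof -
  have I: "((\<lambda>y. inverse (B y)) has_derivative (\<lambda>h. - (B' h * (inverse (B y))\<^sup>2))) (at y)"
    using Deriv.has_derivative_inverse[OF nz B] by (simp add: power2_eq_square ac_simps)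
  have eq: "A y / B y * (P y / B y - A y * q / (2 * (B y)\<^sup>2)) =
      A y * inverse (B y) * (P y * inverse (B y) - A y * (q / 2) * (inverse (B y) * inverse (B y)))" for y
    by (simp add: field_simps power2_eq_square)
  show ?thesis
    unfolding eq
    by (rule has_derivative_eq_rhs[OF has_derivative_mult[OF has_derivative_mult[OF A I]
            has_derivative_diff[OF has_derivative_mult[OF P I] has_derivative_mult[OF
              has_derivative_mult[OF A has_derivative_const] has_derivative_mult[OF I I]]]]])
      (use nz in \<open>simp add: fun_eq_iff field_simps eval_nat_numeral\<close>)
qed

context unit_killing_chart
begin

abbreviation \<beta> :: "real^'n \<Rightarrow> real^'n \<Rightarrow> real" where
  "\<beta> z y \<equiv> gform (G z) y (w z)"

definition kropina_sq :: "real^'n \<Rightarrow> real^'n \<Rightarrow> real" where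
  "kropina_sq z y = (gform (G z) y y / (2 * \<beta> z y))\<^sup>2"

text \<open>
The derivative of \<open>F\<^sup>2\<close> with respect to \<open>y\<close> in direction \<open>a\<close>.
\<close>

definition kropina_momentum :: "real^'n \<Rightarrow> real^'n \<Rightarrow> real^'n \<Rightarrow> real" where
  "kropina_momentum a z y = (gform (G z) y y / \<beta> z y) *
     (gform (G z) y a / \<beta> z y - gform (G z) y y * gform (G z) (w z) a / (2 * (\<beta> z y)\<^sup>2))"

text \<open>
The second derivative of \<open>F\<^sup>2\<close> with respect to \<open>y\<close>, twice the fundamental tensor.
\<close>

definition kropina_hessian :: "real^'n \<Rightarrow> real^'n \<Rightarrow> real^'n \<Rightarrow> real^'n \<Rightarrow> real" where
  "kropina_hessian z y a b =
     2 * gform (G z) y a * gform (G z) y b / (\<beta> z y)\<^sup>2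
     + gform (G z) y y * gform (G z) a b / (\<beta> z y)\<^sup>2
     - 2 * gform (G z) y y * (gform (G z) y a * gform (G z) (w z) b
         + gform (G z) y b * gform (G z) (w z) a) / (\<beta> z y)^3
     + 3 * (gform (G z) y y)\<^sup>2 * gform (G z) (w z) a * gform (G z) (w z) b / (2 * (\<beta> z y)^4)"

lemma gform_has_derivative_right:
  "((\<lambda>y. gform M y a) has_derivative (\<lambda>b. gform M b a)) (at y)"
  by (rule has_derivative_eq_rhs[OF has_derivative_gform[OF has_derivative_const has_derivative_ident
          has_derivative_const]]) (simp add: gform_def)

lemma energy_has_derivative_right:
  assumes "z \<in> S"
  shows "((\<lambda>y. gform (G z) y y) has_derivative (\<lambda>b. 2 * gform (G z) y b)) (at y)"
  by (rule has_derivative_eq_rhs[OF has_derivative_gform[OF has_derivative_const has_derivative_ident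
          has_derivative_ident]])
    (simp add: fun_eq_iff sym[OF assms, of _ y], simp add: gform_def)

lemma kropina_sq_has_derivative:
  assumes z: "z \<in> S" and nz: "\<beta> z y \<noteq> 0"
  shows "((\<lambda>y. kropina_sq z y) has_derivative (\<lambda>a. kropina_momentum a z y)) (at y)"
  unfolding kropina_sq_def
  by (rule has_derivative_eq_rhs[OF energy_quotient_rule[OF energy_has_derivative_right[OF z]
          gform_has_derivative_right nz]])
    (simp add: kropina_momentum_def fun_eq_iff sym[OF z, of _ "w z"])

lemma kropina_momentum_has_derivative:
  assumes z: "z \<in> S" and nz: "\<beta> z y \<noteq> 0"
  shows "((\<lambda>y. kropina_momentum a z y) has_derivative (\<lambda>b. kropina_hessian z y a b)) (at y)"
  unfolding kropina_momentum_def
proof (rule has_derivative_eq_rhs[OF momentum_quotient_rule[OF energy_has_derivative_right[OF z]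
        gform_has_derivative_right gform_has_derivative_right nz]], rule ext)
  fix b
  show "2 * gform (G z) y b * gform (G z) y a / (\<beta> z y)\<^sup>2 + gform (G z) y y * gform (G z) b a / (\<beta> z y)\<^sup>2
      - 2 * gform (G z) y y * gform (G z) y a * gform (G z) b (w z) / (\<beta> z y)^3
      - gform (G z) y y * (2 * gform (G z) y b) * gform (G z) (w z) a / (\<beta> z y)^3
      + 3 * (gform (G z) y y)\<^sup>2 * gform (G z) (w z) a * gform (G z) b (w z) / (2 * (\<beta> z y)^4)
      = kropina_hessian z y a b"
    unfolding kropina_hessian_def sym[OF z, of b "w z"] sym[OF z, of b a]
    by (simp add: distrib_left add_divide_distrib ac_simps)
qed

lemma kropina_hessian_sym: "z \<in> S \<Longrightarrow> kropina_hessian z y a b = kropina_hessian z y b a"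
  using sym[of z a b] by (simp add: kropina_hessian_def algebra_simps)

lemma kropina_hessian_linear:
  "kropina_hessian z y a (b + c) = kropina_hessian z y a b + kropina_hessian z y a c"
  "kropina_hessian z y a (k *\<^sub>R b) = k * kropina_hessian z y a b"
  by (simp_all add: kropina_hessian_def field_simps add_divide_distrib)

text \<open>
Half the Hessian of \<open>F\<^sup>2\<close> is \<open>(F_b)\<^sup>2 + F F_bb\<close>, where subscripts are derivatives in the direction
\<open>b\<close>, and \<open>F_bb\<close> is a positive multiple of the squared length of \<open>u = b - (w(b) / \<beta>) y\<close> with
\<open>w(b) = g(w, b)\<close>.  It can vanish only if \<open>b\<close> is a multiple of \<open>y\<close>; by homogeneity \<open>F_b\<close> is then
the same multiple of \<open>F\<close>.
\<close>

lemma kropina_hessian_pos: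
  assumes z: "z \<in> S" and pos\<beta>: "\<beta> z y > 0" and b: "b \<noteq> 0"
  shows "kropina_hessian z y b b > 0"
proof -
  define B where "B = \<beta> z y"
  define A where "A = gform (G z) y y"
  define m where "m = gform (G z) (w z) b / B"
  define u where "u = b - m *\<^sub>R y"
  have B: "B > 0" using pos\<beta> by (simp add: B_def)
  have y: "y \<noteq> 0" using pos\<beta> by auto
  have A: "A > 0" unfolding A_def using pos z y by auto
  define Fb where "Fb = gform (G z) y b / B - A * gform (G z) (w z) b / (2 * B\<^sup>2)"
  have u: "gform (G z) u u = gform (G z) b b - 2 * m * gform (G z) y b + m\<^sup>2 * A"
    using sym[OF z, of b y] by (simp add: u_def A_def algebra_simps power2_eq_square)
  have eq: "kropina_hessian z y b b = 2 * Fb\<^sup>2 + A / B\<^sup>2 * gform (G z) u u"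
    unfolding u kropina_hessian_def B_def[symmetric] A_def[symmetric] m_def Fb_def
    using B by (simp add: field_simps eval_nat_numeral)
  have "2 * Fb\<^sup>2 + A / B\<^sup>2 * gform (G z) u u \<noteq> 0 \<and> 2 * Fb\<^sup>2 + A / B\<^sup>2 * gform (G z) u u \<ge> 0"
  proof (cases "u = 0")
    case True
    then have bm: "b = m *\<^sub>R y" by (simp add: u_def)
    have "gform (G z) (w z) b = m * B" using B by (simp add: m_def)
    moreover have "gform (G z) y b = m * A" by (simp add: bm A_def)
    ultimately have "Fb = m * A / (2 * B)" using B by (simp add: Fb_def field_simps power2_eq_square)
    moreover have "m \<noteq> 0" using b bm by auto
    ultimately show ?thesis using A B True by simp
  next
    case False
    then have "gform (G z) u u > 0" using pos z by auto
    then have "A / B\<^sup>2 * gform (G z) u u > 0" using A B by simp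
    moreover have "Fb\<^sup>2 \<ge> 0" by simp
    ultimately show ?thesis by linarith
  qed
  then show ?thesis unfolding eq by linarith
qed

lemma gform_joint_has_derivative:
  assumes z: "z \<in> S"
    and u: "(u has_derivative u') (at (z, y))" and v: "(v has_derivative v') (at (z, y))"
  shows "((\<lambda>p. gform (G (fst p)) (u p) (v p)) has_derivative (\<lambda>h. gform (DG z (fst h)) (u (z, y)) (v (z, y))
    + gform (G z) (u' h) (v (z, y)) + gform (G z) (u (z, y)) (v' h))) (at (z, y))"
proof -
  have "((\<lambda>p. G (fst p)) has_derivative (\<lambda>h. DG z (fst h))) (at (z, y))"
    using has_derivative_compose[OF has_derivative_fst[OF has_derivative_ident], of G "DG z" "(z, y)"]
      G_has_derivative[OF z] by simp
  from has_derivative_gform[OF this u v] show ?thesis by simp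
qed

lemma kropina_momentum_differentiable:
  assumes z: "z \<in> S" and nz: "\<beta> z y \<noteq> 0"
  shows "(\<lambda>p. kropina_momentum a (fst p) (snd p)) differentiable (at (z, y))"
proof -
  have w: "((\<lambda>p. w (fst p)) has_derivative (\<lambda>h. Dw z (fst h))) (at (z, y))"
    using has_derivative_compose[OF has_derivative_fst[OF has_derivative_ident], of w "Dw z" "(z, y)"]
      w_has_derivative[OF z] by simp
  have snd: "(snd has_derivative snd) (at (z, y))"
    by (rule bounded_linear_imp_has_derivative[OF bounded_linear_snd])
  have D: "(\<lambda>p. gform (G (fst p)) (u p) (v p)) differentiable (at (z, y))"
    if "(u has_derivative u') (at (z, y))" "(v has_derivative v') (at (z, y))" for u v u' v'
    using gform_joint_has_derivative[OF z that] by (auto simp: differentiable_def)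
  show ?thesis
    unfolding kropina_momentum_def
    by (intro differentiable_mult differentiable_divide differentiable_diff differentiable_power
        D[OF snd snd] D[OF snd w] D[OF snd has_derivative_const] D[OF w has_derivative_const]
        differentiable_const) (use nz in auto)
qed

lemma open_cone: "open {z \<in> S. \<beta> z y > 0}"
proof -
  have "continuous_on S (\<lambda>z. \<beta> z y)"
    using has_derivative_gform[OF G_has_derivative has_derivative_const w_has_derivative]
    by (intro continuous_at_imp_continuous_on ballI has_derivative_continuous) blast
  from continuous_open_preimage[OF this open_S open_greaterThan[of 0]]
  show ?thesis by (simp add: vimage_def Int_def)
qed

lemma open_cone_fibre: "open {y. \<beta> z y > 0}"
proof -
  have "continuous_on UNIV (\<lambda>y. \<beta> z y)"
    using gform_has_derivative_right
    by (intro continuous_at_imp_continuous_on ballI has_derivative_continuous) blast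
  from continuous_open_preimage[OF this open_UNIV open_greaterThan[of 0]]
  show ?thesis by (simp add: vimage_def)
qed

text \<open>
The spray equation says that \<open>d/dt N = R\<close>, where \<open>N\<close> and \<open>R\<close> are the derivatives of \<open>F\<^sup>2\<close> with respect to
velocity and position.  Along a curve with \<open>F = 1\<close> and relative velocity \<open>v = x' - w\<close> one finds
\<open>N = 2 g(v, a) / \<beta>\<close> and \<open>R = 2 Q / \<beta>\<close>, where \<open>Q\<close> is the right-hand side of the momentum equation.
Hence the equation reads \<open>d/dt g(v, a) - (\<beta>' / \<beta>) g(v, a) = Q\<close>, and it remains to see that either
equation forces \<open>\<beta>' = 0\<close>.
\<close>

lemma kropina_geodesic_iff_momentum_eq:
  assumes L: "\<And>z y. z \<in> S \<Longrightarrow> L z y = kropina_sq z y"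
    and J: "open J" "smooth_on J x" "x ` J \<subseteq> S" "t \<in> J"
    and cone: "\<And>\<tau>. \<tau> \<in> J \<Longrightarrow> \<beta> (x \<tau>) (vector_derivative x (at \<tau>)) > 0"
    and speed: "\<And>\<tau>. \<tau> \<in> J \<Longrightarrow> gform (G (x \<tau>)) (vector_derivative x (at \<tau>)) (vector_derivative x (at \<tau>))
      = 2 * \<beta> (x \<tau>) (vector_derivative x (at \<tau>))"
  shows "(\<forall>i. vector_derivative (\<lambda>\<tau>. vector_derivative x (at \<tau>)) (at t) $ i
      + 2 * spray_coeff L i (x t) (vector_derivative x (at t)) = 0) \<longleftrightarrow> momentum_eq 1 x t"
proof -
  let ?x' = "\<lambda>\<tau>. vector_derivative x (at \<tau>)"
  define z where "z = x t"
  define y where "y = ?x' t"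
  define x2 where "x2 = vector_derivative ?x' (at t)"
  have z: "z \<in> S" using J by (auto simp: z_def)
  have pos\<beta>: "\<beta> z y > 0" using cone J by (simp add: z_def y_def)
  have A: "gform (G z) y y = 2 * \<beta> z y" using speed J by (simp add: z_def y_def)
  have x1: "(x has_vector_derivative ?x' \<tau>) (at \<tau>)" if "\<tau> \<in> J" for \<tau>
    using smooth_on_has_vector_derivative[OF J(2) that] .
  have x2: "(?x' has_vector_derivative x2) (at t)"
    unfolding x2_def
    by (rule smooth_on_has_vector_derivative[OF smooth_on_vector_derivative[OF J(1,2)] J(4)])

  have part_y: "partial j (L z') y' = kropina_momentum (axis j 1) z' y'"
    if "z' \<in> S" "\<beta> z' y' > 0" for z' y' j
  proof -
    have "(L z' has_derivative (\<lambda>a. kropina_momentum a z' y')) (at y')"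
    proof -
      have "L z' = kropina_sq z'" using L[OF that(1)] by blast
      then show ?thesis using kropina_sq_has_derivative[of z' y'] that by simp
    qed
    then show ?thesis by (simp add: partial_def frechet_eqI)
  qed
  \<comment> \<open>The joint derivative in position and velocity gives all mixed partial
    derivatives of \<open>F\<^sup>2\<close> and, by the chain rule, the derivative of the momentum
    along the curve.\<close>
  define K where "K a = frechet_derivative (\<lambda>p. kropina_momentum a (fst p) (snd p)) (at (z, y))" for a
  have K: "((\<lambda>p. kropina_momentum a (fst p) (snd p)) has_derivative K a) (at (z, y))" for a
    unfolding K_def
    by (intro has_derivative_frechet kropina_momentum_differentiable z) (use pos\<beta> in auto)
  have linK: "linear (K a)" for a using K has_derivative_linear by blast
  have K_y: "K a (0, b) = kropina_hessian z y a b" for a b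
  proof -
    have "((\<lambda>y. (z, y)) has_derivative (\<lambda>b. (0, b))) (at y)"
      by (intro has_derivative_Pair has_derivative_const has_derivative_ident)
    from has_derivative_compose[OF this K]
    have "((\<lambda>y. kropina_momentum a z y) has_derivative (\<lambda>b. K a (0, b))) (at y)" by simp
    from fun_cong[OF has_derivative_unique[OF this kropina_momentum_has_derivative[OF z]], of b]
    show ?thesis using pos\<beta> by simp
  qed
  have part_yy: "partial i (\<lambda>y. partial j (L z) y) y = kropina_hessian z y (axis j 1) (axis i 1)" for i j
  proof -
    have "frechet_derivative (\<lambda>y. partial j (L z) y) (at y) =
        frechet_derivative (\<lambda>y. kropina_momentum (axis j 1) z y) (at y)"
      using part_y[OF z] pos\<beta> by (intro frechet_derivative_cong_open[OF open_cone_fibre]) auto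
    also have "\<dots> = (\<lambda>b. kropina_hessian z y (axis j 1) b)"
      using kropina_momentum_has_derivative[OF z] pos\<beta> by (intro frechet_eqI) auto
    finally show ?thesis by (simp add: partial_def)
  qed
  have part_xy: "(\<Sum>k\<in>UNIV. partial k (\<lambda>z. partial j (L z) y) z * y $ k) = K (axis j 1) (y, 0)" for j
  proof -
    have "((\<lambda>z. (z, y)) has_derivative (\<lambda>a. (a, 0))) (at z)"
      by (intro has_derivative_Pair has_derivative_const has_derivative_ident)
    from has_derivative_compose[OF this K]
    have D: "((\<lambda>z. kropina_momentum (axis j 1) z y) has_derivative (\<lambda>a. K (axis j 1) (a, 0))) (at z)" by simp
    have "frechet_derivative (\<lambda>z. partial j (L z) y) (at z) =
        frechet_derivative (\<lambda>z. kropina_momentum (axis j 1) z y) (at z)"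
      using part_y z pos\<beta> by (intro frechet_derivative_cong_open[OF open_cone]) auto
    then have "partial k (\<lambda>z. partial j (L z) y) z = K (axis j 1) (axis k 1, 0)" for k
      by (simp add: partial_def frechet_eqI[OF D])
    moreover have "K (axis j 1) (y, 0) = (\<Sum>k\<in>UNIV. y $ k * K (axis j 1) (axis k 1, 0))"
      by (rule linear_eq_sum_axis) (use has_derivative_linear[OF D] in simp)
    ultimately show ?thesis by (simp add: mult.commute)
  qed
  define R where "R a = (gform (DG z a) y y - 2 * (gform (DG z a) y (w z) + gform (G z) y (Dw z a))) / \<beta> z y" for a
  have part_x: "partial j (\<lambda>z. L z y) z = R (axis j 1)" for j
  proof -
    have A': "((\<lambda>z. gform (G z) y y) has_derivative (\<lambda>a. gform (DG z a) y y)) (at z)"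
      using has_derivative_gform[OF G_has_derivative[OF z] has_derivative_const has_derivative_const] by simp
    have B': "((\<lambda>z. \<beta> z y) has_derivative (\<lambda>a. gform (DG z a) y (w z) + gform (G z) y (Dw z a))) (at z)"
      using has_derivative_gform[OF G_has_derivative[OF z] has_derivative_const w_has_derivative[OF z]] by simp
    have "((\<lambda>z. kropina_sq z y) has_derivative R) (at z)"
      unfolding kropina_sq_def
      by (rule has_derivative_eq_rhs[OF energy_quotient_rule[OF A' B']])
        (use pos\<beta> in \<open>simp_all add: R_def fun_eq_iff A field_simps power2_eq_square\<close>)
    then have "((\<lambda>z. L z y) has_derivative R) (at z)"
      by (rule has_derivative_transform_within_open[OF _ open_S z]) (simp add: L)
    then show ?thesis by (simp add: partial_def frechet_eqI)
  qed

  define M where "M = fundamental_tensor L z y"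
  have M: "M $ i $ j = 1/2 * kropina_hessian z y (axis j 1) (axis i 1)" for i j
    by (simp add: M_def fundamental_tensor_def part_yy)
  have linH: "linear (kropina_hessian z y a)" for a
    by (intro linearI) (simp_all add: kropina_hessian_linear)
  have Mrow: "(M *v b) $ i = 1/2 * kropina_hessian z y (axis i 1) b" for b i
    using linear_eq_sum_axis[OF linH, of "axis i 1" b] kropina_hessian_sym[OF z, of y "axis i 1"]
    by (simp add: matrix_vector_mult_def M sum_distrib_left mult.commute sum_divide_distrib)
  have Mquad: "gform M b b = 1/2 * kropina_hessian z y b b" for b
  proof -
    have "gform M b b = 1/2 * (\<Sum>i\<in>UNIV. b $ i * kropina_hessian z y b (axis i 1))"
      by (simp add: gform_def inner_vec_def Mrow sum_distrib_left kropina_hessian_sym[OF z, of y b])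
    then show ?thesis using linear_eq_sum_axis[OF linH, of b b] by simp
  qed
  have inv: "invertible M"
  proof (rule invertible_if_positive_definite)
    show "gform M b b > 0" if "b \<noteq> 0" for b
      using kropina_hessian_pos[OF z pos\<beta> that] Mquad[of b] by linarith
  qed
  define c :: "real^'n" where "c = (\<chi> j. 1/2 * (K (axis j 1) (y, 0) - R (axis j 1)))"
  have spray: "2 * spray_coeff L i z y = (matrix_inv M *v c) $ i" for i
    by (simp add: spray_coeff_def M_def[symmetric] part_xy part_x c_def matrix_vector_mult_def
        sum_distrib_left)
  have "(\<forall>i. x2 $ i + 2 * spray_coeff L i z y = 0) \<longleftrightarrow> x2 + matrix_inv M *v c = 0"
    by (simp add: spray vec_eq_iff)
  also have "\<dots> \<longleftrightarrow> M *v x2 + c = 0" by (rule add_matrix_inv_mult_eq_0_iff[OF inv])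
  also have "\<dots> \<longleftrightarrow> (\<forall>j. K (axis j 1) (y, x2) = R (axis j 1))"
  proof -
    have "K a (y, x2) = K a (y, 0) + kropina_hessian z y a x2" for a
      using linear_add[OF linK, of a "(y, 0)" "(0, x2)"] by (simp add: K_y)
    then have "(M *v x2 + c) $ j = 1/2 * (K (axis j 1) (y, x2) - R (axis j 1))" for j
      by (simp add: Mrow c_def algebra_simps add_divide_distrib diff_divide_distrib)
    note e = this
    have "(M *v x2 + c) $ j = 0 \<longleftrightarrow> K (axis j 1) (y, x2) = R (axis j 1)" for j
      unfolding e by simp
    then show ?thesis unfolding vec_eq_iff zero_index by (simp only:)
  qed
  finally have EL: "(\<forall>i. x2 $ i + 2 * spray_coeff L i z y = 0) \<longleftrightarrow>
    (\<forall>j. K (axis j 1) (y, x2) = R (axis j 1))" .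

  define v where "v = drift_vel 1 x t"
  define v' where "v' = vector_derivative (drift_vel 1 x) (at t)"
  have yv: "y = v + w z" by (simp add: v_def drift_vel_def y_def z_def)
  have dv: "(drift_vel 1 x has_vector_derivative v') (at t)"
    unfolding v'_def by (rule smooth_on_has_vector_derivative[OF smooth_drift_vel[OF J(1-3)] J(4)])
  have xS: "x \<tau> \<in> S" if "\<tau> \<in> J" for \<tau> using J that by auto
  define P where "P a = gform (DG z y) v a + gform (G z) v' a" for a
  have P: "((\<lambda>\<tau>. gform (G (x \<tau>)) (drift_vel 1 x \<tau>) a) has_real_derivative P a) (at t)" for a
    using pairing_has_derivative[OF xS[OF J(4)] x1[OF J(4)] dv has_vector_derivative_const[of a]]
    by (simp add: P_def z_def y_def v_def)
  obtain b' where b': "((\<lambda>\<tau>. gform (G (x \<tau>)) (drift_vel 1 x \<tau>) (w (x \<tau>))) has_real_derivative b') (at t)"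
    using pairing_has_derivative[OF xS[OF J(4)] x1[OF J(4)] dv
        has_vector_derivative_along_curve[OF w_has_derivative[OF xS[OF J(4)]] x1[OF J(4)]]] by blast
  have \<beta>_eq: "\<beta> (x \<tau>) (?x' \<tau>) = gform (G (x \<tau>)) (drift_vel 1 x \<tau>) (w (x \<tau>)) + 1" if "\<tau> \<in> J" for \<tau>
    using unit[OF xS[OF that]] by (simp add: drift_vel_def)
  have b'': "((\<lambda>\<tau>. \<beta> (x \<tau>) (?x' \<tau>)) has_real_derivative b') (at t)"
    unfolding has_field_derivative_def
    by (rule has_derivative_transform_within_open[OF _ J(1,4), where
          f="\<lambda>\<tau>. gform (G (x \<tau>)) (drift_vel 1 x \<tau>) (w (x \<tau>)) + 1"])
      (use DERIV_add[OF b' DERIV_const[of 1]] \<beta>_eq in \<open>auto simp: has_field_derivative_def\<close>)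
  have K_eq: "K a (y, x2) = 2 * (P a * \<beta> z y - gform (G z) v a * b') / (\<beta> z y)\<^sup>2" for a
  proof -
    have "((\<lambda>\<tau>. (x \<tau>, ?x' \<tau>)) has_vector_derivative (y, x2)) (at t)"
      using has_vector_derivative_Pair[OF x1[OF J(4)] x2] by (simp add: y_def)
    from has_vector_derivative_along_curve[OF K[unfolded z_def y_def] this]
    have 1: "((\<lambda>\<tau>. kropina_momentum a (x \<tau>) (?x' \<tau>)) has_real_derivative K a (y, x2)) (at t)"
      by (simp add: has_real_derivative_iff_has_vector_derivative)
    have "((\<lambda>\<tau>. 2 * (gform (G (x \<tau>)) (drift_vel 1 x \<tau>) a / \<beta> (x \<tau>) (?x' \<tau>))) has_real_derivative
        2 * ((P a * \<beta> z y - gform (G z) v a * b') / (\<beta> z y * \<beta> z y))) (at t)"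
      using DERIV_cmult[OF DERIV_divide[OF P b''], of 2 a] pos\<beta> by (simp add: z_def y_def v_def)
    then have "((\<lambda>\<tau>. kropina_momentum a (x \<tau>) (?x' \<tau>)) has_real_derivative
        2 * ((P a * \<beta> z y - gform (G z) v a * b') / (\<beta> z y * \<beta> z y))) (at t)"
      unfolding has_field_derivative_def
    proof (rule has_derivative_transform_within_open[OF _ J(1,4)])
      fix \<tau> assume \<tau>: "\<tau> \<in> J"
      show "2 * (gform (G (x \<tau>)) (drift_vel 1 x \<tau>) a / \<beta> (x \<tau>) (?x' \<tau>)) =
          kropina_momentum a (x \<tau>) (?x' \<tau>)"
        using cone[OF \<tau>] unfolding kropina_momentum_def speed[OF \<tau>]
        by (simp add: drift_vel_def field_simps power2_eq_square)
    qed
    from DERIV_unique[OF 1 this] show ?thesis by (simp add: power2_eq_square)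
  qed
  define Q where "Q a = 1/2 * gform (DG z a) v v - gform (G z) v (Dw z a)" for a
  \<comment> \<open>With \<open>y = v + w\<close>, the terms quadratic in \<open>w\<close> cancel
    because \<open>w\<close> has unit length.\<close>
  have R_eq: "R a = 2 * Q a / \<beta> z y" for a
  proof -
    have "gform (DG z a) y y - 2 * (gform (DG z a) y (w z) + gform (G z) y (Dw z a)) =
      gform (DG z a) v v - 2 * gform (G z) v (Dw z a)
      - (gform (DG z a) (w z) (w z) + 2 * gform (G z) (w z) (Dw z a))"
      using DG_sym[OF z, of a v "w z"] by (simp add: yv algebra_simps)
    also have "\<dots> = 2 * Q a" by (simp only: unit_derivative[OF z] Q_def) simp
    finally show ?thesis by (simp add: R_def)
  qed
  have mom: "momentum_eq 1 x t \<longleftrightarrow> (\<forall>a. P a = Q a)"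
    by (simp add: momentum_eq_def P_def Q_def v_def v'_def y_def z_def)
  have KR: "K a (y, x2) = R a \<longleftrightarrow> P a - gform (G z) v a * (b' / \<beta> z y) = Q a" for a
  proof -
    have "2 * (P a * \<beta> z y - gform (G z) v a * b') / (\<beta> z y)\<^sup>2 =
        2 * (P a - gform (G z) v a * (b' / \<beta> z y)) / \<beta> z y"
      using pos\<beta> by (simp add: field_simps power2_eq_square)
    then show ?thesis unfolding K_eq R_eq using pos\<beta> by (simp del: right_diff_distrib_numeral)
  qed
  have "(\<forall>j. K (axis j 1) (y, x2) = R (axis j 1)) \<longleftrightarrow>
    (\<forall>a. P a - gform (G z) v a * (b' / \<beta> z y) - Q a = 0)"
  proof -
    have "linear (\<lambda>a. P a - gform (G z) v a * (b' / \<beta> z y) - Q a)"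
      unfolding P_def Q_def
      by (intro linearI) (simp_all add: linear_add[OF linear_DG[OF z]] linear_scale[OF linear_DG[OF z]]
          linear_add[OF linear_Dw[OF z]] linear_scale[OF linear_Dw[OF z]] algebra_simps)
    from linear_zero_iff_axis[OF this] show ?thesis by (simp add: KR)
  qed
  also have "\<dots> \<longleftrightarrow> momentum_eq 1 x t"
  proof
    assume "momentum_eq 1 x t"
    with noether[OF J this] DERIV_unique[OF b'] have "b' = 0" by blast
    then show "\<forall>a. P a - gform (G z) v a * (b' / \<beta> z y) - Q a = 0"
      using \<open>momentum_eq 1 x t\<close> mom by simp
  next
    \<comment> \<open>Conversely, at \<open>a = v\<close> the constancy of \<open>|v|\<close> and
      the Killing equation give \<open>P v = Q v\<close>, so that the remaining term \<open>\<beta>'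
      / \<beta>\<close> vanishes.\<close>
    assume E: "\<forall>a. P a - gform (G z) v a * (b' / \<beta> z y) - Q a = 0"
    have norm: "gform (G (x \<tau>)) (drift_vel 1 x \<tau>) (drift_vel 1 x \<tau>) = 1" if "\<tau> \<in> J" for \<tau>
      using speed[OF that] unit[OF xS[OF that]] sym[OF xS[OF that], of "?x' \<tau>" "w (x \<tau>)"]
      by (simp add: drift_vel_def)
    have "((\<lambda>\<tau>. gform (G (x \<tau>)) (drift_vel 1 x \<tau>) (drift_vel 1 x \<tau>)) has_real_derivative
        gform (DG z y) v v + gform (G z) v' v + gform (G z) v v') (at t)"
      using pairing_has_derivative[OF xS[OF J(4)] x1[OF J(4)] dv dv] by (simp add: z_def y_def v_def)
    moreover have "((\<lambda>\<tau>. gform (G (x \<tau>)) (drift_vel 1 x \<tau>) (drift_vel 1 x \<tau>)) has_real_derivative 0) (at t)"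
      unfolding has_field_derivative_def
      by (rule has_derivative_transform_within_open[OF _ J(1,4), where f="\<lambda>\<tau>. 1"])
        (use norm DERIV_const[of "1::real" "at t"] in \<open>simp_all add: has_field_derivative_def\<close>)
    ultimately have "gform (DG z y) v v + 2 * gform (G z) v' v = 0"
      using DERIV_unique sym[OF z, of v v'] by fastforce
    then have "P v = 1/2 * gform (DG z y) v v" by (simp add: P_def)
    also have "\<dots> = 1/2 * gform (DG z v) v v + 1/2 * gform (DG z (w z)) v v"
      by (simp add: yv linear_add[OF linear_DG[OF z]])
    also have "\<dots> = Q v" using killing_diag[OF z, of v] by (simp add: Q_def)
    finally have "P v = Q v" .
    moreover have "gform (G z) v v = 1" using norm[OF J(4)] by (simp add: v_def z_def)
    ultimately have "b' = 0" using E[rule_format, of v] pos\<beta> by simp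
    then show "momentum_eq 1 x t" using E by (simp add: mom)
  qed
  finally show ?thesis using EL by (simp add: x2_def z_def y_def)
qed

end

section \<open>Charts and tangent vectors\<close>

lemma is_chart_facts:
  assumes "is_chart c"
  shows "open (chart_dom c)" "open (chart_img c)"
    "p \<in> chart_dom c \<Longrightarrow> chart_inv c (chart_map c p) = p"
    "u \<in> chart_img c \<Longrightarrow> chart_map c (chart_inv c u) = u"
    "u \<in> chart_img c \<Longrightarrow> chart_inv c u \<in> chart_dom c"
    "continuous_on (chart_dom c) (chart_map c)" "continuous_on (chart_img c) (chart_inv c)"
  using assms unfolding is_chart_def homeomorphism_def by auto

text \<open>
Identities between coordinate expressions hold only where the charts involved overlap; openness of
the overlap allows them to be differentiated.
\<close>

lemma open_chart_image:
  assumes "is_chart c" "open T"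
  shows "open (chart_map c ` (chart_dom c \<inter> T))"
proof -
  note c = is_chart_facts[OF assms(1)]
  have "chart_map c ` (chart_dom c \<inter> T) = chart_img c \<inter> chart_inv c -` T"
    using c(3-5) by force
  then show ?thesis using continuous_open_preimage[OF c(7,2) assms(2)] by simp
qed

locale smooth_atlas =
  fixes \<A> :: "('a::{t2_space, second_countable_topology}, 'n::finite) chart set"
  assumes manifold: "smooth_manifold \<A>"
begin

lemma chart: "c \<in> \<A> \<Longrightarrow> is_chart c"
  using manifold by (auto simp: smooth_manifold_def)

lemmas chart_facts = is_chart_facts[OF chart]
lemmas open_image = open_chart_image[OF chart]

lemma transition_differentiable:
  assumes "c \<in> \<A>" "d \<in> \<A>" "p \<in> chart_dom c" "p \<in> chart_dom d"
  shows "transition c d differentiable (at (chart_map c p))"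
  using manifold assms unfolding smooth_manifold_def
  by (intro smooth_on_imp_differentiable[of "chart_map c ` (chart_dom c \<inter> chart_dom d)"]) auto

lemma transition_apply:
  "c \<in> \<A> \<Longrightarrow> p \<in> chart_dom c \<Longrightarrow> transition c d (chart_map c p) = chart_map d p"
  by (simp add: transition_def chart_facts)

lemma transition_derivative_chain:
  assumes "c \<in> \<A>" "d \<in> \<A>" "e \<in> \<A>" "p \<in> chart_dom c" "p \<in> chart_dom d" "p \<in> chart_dom e"
  shows "frechet_derivative (transition c e) (at (chart_map c p)) u =
    frechet_derivative (transition d e) (at (chart_map d p))
      (frechet_derivative (transition c d) (at (chart_map c p)) u)"
proof -
  let ?S = "chart_map c ` (chart_dom c \<inter> chart_dom d)"
  have "frechet_derivative (transition c e) (at (chart_map c p)) =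
      frechet_derivative (\<lambda>x. transition d e (transition c d x)) (at (chart_map c p))"
  proof (rule frechet_derivative_cong_open[of ?S])
    show "open ?S" using assms chart_facts by (intro open_image) auto
    show "chart_map c p \<in> ?S" using assms by auto
    show "transition c e x = transition d e (transition c d x)" if "x \<in> ?S" for x
      using that assms by (auto simp: transition_apply)
  qed
  then show ?thesis
    using assms frechet_derivative_chain[OF transition_differentiable[of c d p],
        of "transition d e" u] transition_differentiable[of d e p]
    by (simp add: transition_apply)
qed

lemma transition_derivative_same:
  assumes "c \<in> \<A>" "p \<in> chart_dom c"
  shows "frechet_derivative (transition c c) (at (chart_map c p)) u = u"
proof -
  have "frechet_derivative (transition c c) (at (chart_map c p)) =
      frechet_derivative (\<lambda>x. x) (at (chart_map c p))"
    using assms chart_facts[OF assms(1)]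
    by (intro frechet_derivative_cong_open[of "chart_img c"]) (auto simp: transition_apply)
  then show ?thesis by (simp add: frechet_derivative_ident)
qed

lemma tangent_of_in_tangent_space:
  assumes "c \<in> \<A>" "p \<in> chart_dom c"
  shows "tangent_of \<A> c p u \<in> tangent_space \<A> p"
  using assms by (auto simp: tangent_space_def tangent_of_def intro: transition_derivative_chain)

lemma tangent_of_same:
  "c \<in> \<A> \<Longrightarrow> p \<in> chart_dom c \<Longrightarrow> tangent_of \<A> c p u c = u"
  by (simp add: tangent_of_def transition_derivative_same)

lemma tangent_space_transition:
  assumes "v \<in> tangent_space \<A> p" "c \<in> \<A>" "d \<in> \<A>" "p \<in> chart_dom c" "p \<in> chart_dom d"
  shows "v d = frechet_derivative (transition c d) (at (chart_map c p)) (v c)"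
  using assms unfolding tangent_space_def by blast

lemma tangent_space_minus:
  assumes "v \<in> tangent_space \<A> p"
  shows "- v \<in> tangent_space \<A> p"
  unfolding tangent_space_def
proof (intro CollectI conjI ballI allI impI)
  show "(- v) c = 0" if "\<not> (c \<in> \<A> \<and> p \<in> chart_dom c)" for c
  proof -
    have "v c = 0" using assms that unfolding tangent_space_def by blast
    then show ?thesis by simp
  qed
  fix c d assume cd: "c \<in> \<A>" "d \<in> \<A>" "p \<in> chart_dom c \<and> p \<in> chart_dom d"
  then show "(- v) d = frechet_derivative (transition c d) (at (chart_map c p)) ((- v) c)"
    using tangent_space_transition[OF assms, of c d]
      linear_neg[OF linear_frechet_derivative[OF transition_differentiable[of c d p]], of "v c"] by simp
qed

lemma tangent_of_tangent_vector:
  assumes "c \<in> \<A>" "p \<in> chart_dom c" "v \<in> tangent_space \<A> p"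
  shows "tangent_of \<A> c p (v c) = v"
proof
  fix d
  show "tangent_of \<A> c p (v c) d = v d"
  proof (cases "d \<in> \<A> \<and> p \<in> chart_dom d")
    case True
    then show ?thesis
      using tangent_space_transition[OF assms(3,1) _ assms(2), of d] by (simp add: tangent_of_def)
  next
    case False
    then have "v d = 0" using assms(3) unfolding tangent_space_def by blast
    with False show ?thesis by (auto simp: tangent_of_def)
  qed
qed

lemma carrier_chart:
  assumes "p \<in> carrier \<A>" obtains c where "c \<in> \<A>" "p \<in> chart_dom c"
  using assms by (auto simp: carrier_def)

lemma velocity_in_tangent_space:
  assumes I: "open I" "smooth_curve \<A> I \<gamma>" "t \<in> I"
  shows "velocity \<A> \<gamma> t \<in> tangent_space \<A> (\<gamma> t)"
  unfolding tangent_space_def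
proof (intro CollectI conjI ballI allI impI)
  show "velocity \<A> \<gamma> t c = 0" if "\<not> (c \<in> \<A> \<and> \<gamma> t \<in> chart_dom c)" for c
    using that by (auto simp: velocity_def)
  fix c d assume cd: "c \<in> \<A>" "d \<in> \<A>" "\<gamma> t \<in> chart_dom c \<and> \<gamma> t \<in> chart_dom d"
  let ?J = "{\<tau> \<in> I. \<gamma> \<tau> \<in> chart_dom c \<inter> chart_dom d}"
  have J: "open ?J"
    using I cd chart_facts(1) by (intro open_Collect_preimage open_Int) (auto simp: smooth_curve_def)
  have sm: "((chart_map c \<circ> \<gamma>) has_vector_derivative vector_derivative (chart_map c \<circ> \<gamma>) (at t)) (at t)"
    using I cd by (intro smooth_on_has_vector_derivative[of "{t \<in> I. \<gamma> t \<in> chart_dom c}"])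
      (auto simp: smooth_curve_def)
  have T: "(transition c d has_derivative frechet_derivative (transition c d) (at (chart_map c (\<gamma> t))))
      (at (chart_map c (\<gamma> t)))"
    using cd by (intro has_derivative_frechet transition_differentiable) auto
  have "vector_derivative (chart_map d \<circ> \<gamma>) (at t) =
      vector_derivative (\<lambda>\<tau>. transition c d ((chart_map c \<circ> \<gamma>) \<tau>)) (at t)"
    using I cd by (intro vector_derivative_cong_open[OF J]) (auto simp: transition_apply)
  also have "\<dots> = frechet_derivative (transition c d) (at (chart_map c (\<gamma> t)))
      (vector_derivative (chart_map c \<circ> \<gamma>) (at t))"
    by (rule vector_derivative_at, rule has_vector_derivative_along_curve[OF _ sm]) (use T in simp)
  finally show "velocity \<A> \<gamma> t d = frechet_derivative (transition c d) (at (chart_map c (\<gamma> t)))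
      (velocity \<A> \<gamma> t c)"
    using cd by (simp add: velocity_def)
qed

lemma curve_chart_domain:
  assumes "open I" "smooth_curve \<A> I \<gamma>" "c \<in> \<A>"
  shows "open {t \<in> I. \<gamma> t \<in> chart_dom c}"
    and "smooth_on {t \<in> I. \<gamma> t \<in> chart_dom c} (chart_map c \<circ> \<gamma>)"
    and "(chart_map c \<circ> \<gamma>) ` {t \<in> I. \<gamma> t \<in> chart_dom c} \<subseteq> chart_img c"
proof -
  show "open {t \<in> I. \<gamma> t \<in> chart_dom c}"
    using assms chart_facts(1) by (intro open_Collect_preimage) (auto simp: smooth_curve_def)
qed (use assms in \<open>auto simp: smooth_curve_def\<close>)

subsection \<open>The differential of a smooth map\<close>

text \<open>
The differential is defined through an arbitrary choice of a chart at \<open>p\<close>; by the chain rule for the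
change of charts, every chart gives the same value.
\<close>

lemma differential_in_chart:
  assumes f: "smooth_map \<A> U f" "open U" "p \<in> U"
    and c: "c \<in> \<A>" "p \<in> chart_dom c" and d: "d \<in> \<A>" "f p \<in> chart_dom d"
    and v: "v \<in> tangent_space \<A> p"
  shows "differential \<A> f p v d =
    frechet_derivative (chart_map d \<circ> f \<circ> chart_inv c) (at (chart_map c p)) (v c)"
proof -
  define c0 where "c0 = (SOME c. c \<in> \<A> \<and> p \<in> chart_dom c)"
  have c0: "c0 \<in> \<A>" "p \<in> chart_dom c0"
    using someI_ex[of "\<lambda>c. c \<in> \<A> \<and> p \<in> chart_dom c"] c unfolding c0_def by blast+
  let ?S = "chart_map c0 ` (chart_dom c0 \<inter> chart_dom c)"
  have "frechet_derivative (chart_map d \<circ> f \<circ> chart_inv c0) (at (chart_map c0 p)) =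
    frechet_derivative (\<lambda>x. (chart_map d \<circ> f \<circ> chart_inv c) (transition c0 c x)) (at (chart_map c0 p))"
  proof (rule frechet_derivative_cong_open[of ?S])
    show "open ?S" using c c0 chart_facts by (intro open_image) auto
  qed (use c c0 in \<open>auto simp: transition_apply chart_facts\<close>)
  moreover have "(chart_map d \<circ> f \<circ> chart_inv c) differentiable (at (chart_map c p))"
    using f c d unfolding smooth_map_def
    by (intro smooth_on_imp_differentiable[of "chart_map c ` {x \<in> U \<inter> chart_dom c. f x \<in> chart_dom d}"]) auto
  ultimately have "frechet_derivative (chart_map d \<circ> f \<circ> chart_inv c0) (at (chart_map c0 p)) (v c0) =
      frechet_derivative (chart_map d \<circ> f \<circ> chart_inv c) (at (chart_map c p))
        (frechet_derivative (transition c0 c) (at (chart_map c0 p)) (v c0))"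
    using frechet_derivative_chain[OF transition_differentiable[OF c0(1) c(1) c0(2) c(2)],
        of "chart_map d \<circ> f \<circ> chart_inv c" "v c0"] c c0
    by (simp add: transition_apply)
  moreover have "frechet_derivative (transition c0 c) (at (chart_map c0 p)) (v c0) = v c"
    using tangent_space_transition[OF v c0(1) c(1) c0(2) c(2)] by simp
  ultimately show ?thesis
    using d by (simp add: differential_def c0_def[symmetric] Let_def)
qed

lemma differential_in_tangent_space:
  assumes f: "smooth_map \<A> U f" "open U" "p \<in> U" and v: "v \<in> tangent_space \<A> p" "p \<in> carrier \<A>"
  shows "differential \<A> f p v \<in> tangent_space \<A> (f p)"
  unfolding tangent_space_def
proof (intro CollectI conjI ballI allI impI)
  show "differential \<A> f p v d = 0" if "\<not> (d \<in> \<A> \<and> f p \<in> chart_dom d)" for d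
    using that by (auto simp: differential_def Let_def)
  fix d e assume d: "d \<in> \<A>" "e \<in> \<A>" "f p \<in> chart_dom d \<and> f p \<in> chart_dom e"
  obtain c where c: "c \<in> \<A>" "p \<in> chart_dom c" using v carrier_chart by blast
  have T: "open (U \<inter> f -` (chart_dom d \<inter> chart_dom e))"
    using f d chart_facts(1) by (intro continuous_open_preimage open_Int) (auto simp: smooth_map_def)
  let ?S = "chart_map c ` (chart_dom c \<inter> (U \<inter> f -` (chart_dom d \<inter> chart_dom e)))"
  have "frechet_derivative (chart_map e \<circ> f \<circ> chart_inv c) (at (chart_map c p)) =
    frechet_derivative (\<lambda>x. transition d e ((chart_map d \<circ> f \<circ> chart_inv c) x)) (at (chart_map c p))"
  proof (rule frechet_derivative_cong_open[of ?S])
    show "open ?S" by (rule open_image[OF c(1) T])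
    show "chart_map c p \<in> ?S" using c d f by auto
  qed (use c d in \<open>auto simp: transition_apply chart_facts\<close>)
  moreover have "(chart_map d \<circ> f \<circ> chart_inv c) differentiable (at (chart_map c p))"
    using f c d unfolding smooth_map_def
    by (intro smooth_on_imp_differentiable[of "chart_map c ` {x \<in> U \<inter> chart_dom c. f x \<in> chart_dom d}"]) auto
  moreover have "(chart_map d \<circ> f \<circ> chart_inv c) (chart_map c p) = chart_map d (f p)"
    using c by (simp add: chart_facts)
  ultimately have "frechet_derivative (chart_map e \<circ> f \<circ> chart_inv c) (at (chart_map c p)) (v c) =
      frechet_derivative (transition d e) (at (chart_map d (f p)))
       (frechet_derivative (chart_map d \<circ> f \<circ> chart_inv c) (at (chart_map c p)) (v c))"
    using frechet_derivative_chain[of "chart_map d \<circ> f \<circ> chart_inv c" "chart_map c p" "transition d e" "v c"]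
      transition_differentiable[of d e "f p"] d by simp
  then show "differential \<A> f p v e =
      frechet_derivative (transition d e) (at (chart_map d (f p))) (differential \<A> f p v d)"
    using differential_in_chart[OF f c _ _ v(1)] d by simp
qed

end

section \<open>Kropina data in a chart\<close>

definition metric_matrix ::
  "('a, 'n::finite) chart set \<Rightarrow> ('a, 'n) metric \<Rightarrow> ('a, 'n) chart \<Rightarrow> real^'n \<Rightarrow> real^'n^'n" where
  "metric_matrix \<A> h c x = (\<chi> i j. metric_coeff \<A> h c i j x)"

definition field_coord :: "('a, 'n) vfield \<Rightarrow> ('a, 'n) chart \<Rightarrow> real^'n \<Rightarrow> real^'n" where
  "field_coord W c x = W (chart_inv c x) c"

locale kropina_manifold =
  fixes \<A> :: "('a::{t2_space, second_countable_topology}, 'n::finite) chart set"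
    and h :: "('a, 'n) metric" and W :: "('a, 'n) vfield"
  assumes strong: "strong_kropina_space \<A> h W"

sublocale kropina_manifold \<subseteq> smooth_atlas
  using strong by unfold_locales (simp add: strong_kropina_space_def kropina_space_def)

context kropina_manifold
begin

abbreviation g where "g c \<equiv> metric_matrix \<A> h c"
abbreviation w where "w c \<equiv> field_coord W c"

lemma metric_form_eq_gform:
  assumes c: "c \<in> \<A>" "x \<in> chart_img c"
  shows "metric_form \<A> h c x u v = gform (g c x) u v"
proof -
  have bil: "bilinear (metric_form \<A> h c x)"
    using strong c by (auto simp: strong_kropina_space_def kropina_space_def riemannian_metric_def)
  have 1: "linear (\<lambda>u. metric_form \<A> h c x u v)" for v using bil by (simp add: bilinear_def)
  have 2: "linear (\<lambda>v. metric_form \<A> h c x u v)" for u using bil by (simp add: bilinear_def)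
  have "metric_form \<A> h c x u v =
      (\<Sum>i\<in>UNIV. u $ i * (\<Sum>j\<in>UNIV. v $ j * metric_form \<A> h c x (axis i 1) (axis j 1)))"
    by (subst linear_eq_sum_axis[OF 1], subst linear_eq_sum_axis[OF 2]) simp
  then show ?thesis
    by (simp add: gform_eq_sum metric_matrix_def metric_coeff_def sum_distrib_left ac_simps)
qed

lemma W_tangent: "p \<in> carrier \<A> \<Longrightarrow> W p \<in> tangent_space \<A> p"
  using strong by (auto simp: strong_kropina_space_def killing_field_def smooth_vector_field_def)

lemma in_carrier: "c \<in> \<A> \<Longrightarrow> p \<in> chart_dom c \<Longrightarrow> p \<in> carrier \<A>"
  by (auto simp: carrier_def)

text \<open>
The bridge between the manifold and coordinates: statements about \<open>h\<close> are moved to a chart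
by this identity.
\<close>

lemma h_eq_gform:
  assumes "c \<in> \<A>" "p \<in> chart_dom c" "u \<in> tangent_space \<A> p" "v \<in> tangent_space \<A> p"
  shows "h p u v = gform (g c (chart_map c p)) (u c) (v c)"
  using assms metric_form_eq_gform[of c "chart_map c p" "u c" "v c"]
  by (simp add: metric_form_def chart_facts tangent_of_tangent_vector)

lemma w_chart: "c \<in> \<A> \<Longrightarrow> p \<in> chart_dom c \<Longrightarrow> w c (chart_map c p) = W p c"
  by (simp add: field_coord_def chart_facts)

lemma smooth_metric_matrix: "c \<in> \<A> \<Longrightarrow> smooth_on (chart_img c) (g c)"
  unfolding metric_matrix_def[abs_def] using strong chart_facts(2)
  by (intro smooth_on_vec_lambda)
    (auto simp: strong_kropina_space_def kropina_space_def riemannian_metric_def)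

lemma smooth_field_coord: "c \<in> \<A> \<Longrightarrow> smooth_on (chart_img c) (w c)"
proof -
  assume c: "c \<in> \<A>"
  have "smooth_on (chart_img c) (\<lambda>x. \<chi> i. vfield_coeff W c i x)"
    using strong chart_facts(2) c
    by (intro smooth_on_vec_lambda)
      (auto simp: strong_kropina_space_def killing_field_def smooth_vector_field_def)
  then show ?thesis by (simp add: vfield_coeff_def field_coord_def[abs_def])
qed

lemma partial_metric_coeff:
  assumes "c \<in> \<A>" "x \<in> chart_img c"
  shows "partial k (metric_coeff \<A> h c i j) x = frechet_derivative (g c) (at x) (axis k 1) $ i $ j"
proof -
  have d: "g c differentiable (at x)"
    using smooth_on_imp_differentiable[OF smooth_metric_matrix] assms by blast
  have "bounded_linear (\<lambda>M::real^'n^'n. M $ i $ j)"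
    by (intro bounded_linear_compose[OF bounded_linear_vec_nth bounded_linear_vec_nth])
  from frechet_derivative_bounded_linear[OF this d]
  show ?thesis by (simp add: partial_def metric_matrix_def)
qed

lemma partial_vfield_coeff:
  assumes "c \<in> \<A>" "x \<in> chart_img c"
  shows "partial k (vfield_coeff W c i) x = frechet_derivative (w c) (at x) (axis k 1) $ i"
proof -
  have d: "w c differentiable (at x)"
    using smooth_on_imp_differentiable[OF smooth_field_coord] assms by blast
  from frechet_derivative_bounded_linear[OF bounded_linear_vec_nth d, of i "axis k 1"]
  show ?thesis by (simp add: partial_def vfield_coeff_def[abs_def] field_coord_def[abs_def])
qed

text \<open>
The geometric hypotheses are component-wise statements in every chart; here they become the
invariant assumptions on bilinear forms that the coordinate computations use.
\<close>

lemma chart_unit_killing: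
  assumes c: "c \<in> \<A>"
  shows "unit_killing_chart (chart_img c) (g c) (w c)"
proof -
  have R: "riemannian_chart (chart_img c) (g c) (w c)"
  proof
    show "open (chart_img c)" using chart_facts c by blast
    show "smooth_on (chart_img c) (g c)" "smooth_on (chart_img c) (w c)"
      using smooth_metric_matrix smooth_field_coord c by blast+
    fix x u v assume x: "x \<in> chart_img c"
    show "gform (g c x) u v = gform (g c x) v u" "u \<noteq> 0 \<Longrightarrow> gform (g c x) u u > 0"
      using strong c x unfolding strong_kropina_space_def kropina_space_def riemannian_metric_def
      by (auto simp: metric_form_eq_gform[symmetric])
  qed
  then interpret riemannian_chart "chart_img c" "g c" "w c" .
  show ?thesis
  proof
    fix x assume x: "x \<in> chart_img c"
    define p where "p = chart_inv c x"
    have p: "p \<in> chart_dom c" "chart_map c p = x" using chart_facts[OF c] x by (auto simp: p_def)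
    have "metric_norm h p (W p) = 1"
      using strong in_carrier[OF c p(1)] by (auto simp: strong_kropina_space_def kropina_space_def)
    then have "h p (W p) (W p) = 1" by (simp add: metric_norm_def)
    then show "gform (g c x) (w c x) (w c x) = 1"
      using h_eq_gform[OF c p(1) W_tangent W_tangent] in_carrier[OF c p(1)] w_chart[OF c p(1)] p by simp
    fix a b
    let ?K = "\<lambda>a b. gform (DG x (w c x)) a b + gform (g c x) (Dw x a) b + gform (g c x) a (Dw x b)"
    have "?K (axis i 1) (axis j 1) = 0" for i j
    proof -
      have lin: "linear (\<lambda>u. DG x u $ i $ j)"
        using linear_DG[OF x] by (intro linearI) (simp_all add: linear_add linear_scale)
      have "(\<Sum>k\<in>UNIV. vfield_coeff W c k x * partial k (metric_coeff \<A> h c i j) x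
           + metric_coeff \<A> h c k j x * partial i (vfield_coeff W c k) x
           + metric_coeff \<A> h c i k x * partial j (vfield_coeff W c k) x) = 0"
        using strong c x unfolding strong_kropina_space_def killing_field_def by blast
      then have "DG x (w c x) $ i $ j + (\<Sum>k\<in>UNIV. g c x $ k $ j * Dw x (axis i 1) $ k)
          + (\<Sum>k\<in>UNIV. g c x $ i $ k * Dw x (axis j 1) $ k) = 0"
        using linear_eq_sum_axis[OF lin, of "w c x"]
        by (simp add: partial_metric_coeff[OF c x] partial_vfield_coeff[OF c x] sum.distrib
            vfield_coeff_def field_coord_def metric_matrix_def)
      moreover have "gform (g c x) (Dw x (axis i 1)) (axis j 1) =
          (\<Sum>k\<in>UNIV. g c x $ k $ j * Dw x (axis i 1) $ k)"
        using linear_eq_sum_axis[of "\<lambda>u. gform (g c x) u (axis j 1)" "Dw x (axis i 1)"]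
        by (simp add: linear_iff mult.commute)
      moreover have "gform (g c x) (axis i 1) (Dw x (axis j 1)) =
          (\<Sum>k\<in>UNIV. g c x $ i $ k * Dw x (axis j 1) $ k)"
        using linear_eq_sum_axis[of "\<lambda>u. gform (g c x) (axis i 1) u" "Dw x (axis j 1)"]
        by (simp add: linear_iff mult.commute)
      ultimately show ?thesis by simp
    qed
    moreover have "linear (\<lambda>a. ?K a b)" "linear (\<lambda>b. ?K a b)" for a b
      by (auto intro!: linearI simp: linear_add[OF linear_Dw[OF x]] linear_scale[OF linear_Dw[OF x]] algebra_simps)
    ultimately show "?K a b = 0" using linear_zero_iff_axis by (metis (no_types, lifting))
  qed
qed

subsection \<open>Geodesics as solutions of the momentum equation\<close>

abbreviation drift_geodesic :: "real \<Rightarrow> ('a, 'n) chart \<Rightarrow> (real \<Rightarrow> 'a) \<Rightarrow> real \<Rightarrow> bool" where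
  "drift_geodesic s c \<gamma> t \<equiv> riemannian_chart.momentum_eq (g c) (w c) s (chart_map c \<circ> \<gamma>) t"

abbreviation drift :: "real \<Rightarrow> ('a, 'n) chart \<Rightarrow> (real \<Rightarrow> 'a) \<Rightarrow> real \<Rightarrow> real^'n" where
  "drift s c \<gamma> t \<equiv> riemannian_chart.drift_vel (w c) s (chart_map c \<circ> \<gamma>) t"

lemma drift_eq:
  assumes "c \<in> \<A>" "\<gamma> t \<in> chart_dom c"
  shows "drift s c \<gamma> t = velocity \<A> \<gamma> t c - s *\<^sub>R W (\<gamma> t) c"
proof -
  interpret unit_killing_chart "chart_img c" "g c" "w c" by (rule chart_unit_killing[OF assms(1)])
  show ?thesis using assms by (simp add: drift_vel_def velocity_def w_chart)
qed

lemma riemannian_geodesic_iff_drift: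
  assumes I: "open I"
  shows "riemannian_geodesic \<A> h I \<gamma> \<longleftrightarrow> smooth_curve \<A> I \<gamma> \<and>
    (\<forall>c\<in>\<A>. \<forall>t\<in>I. \<gamma> t \<in> chart_dom c \<longrightarrow> drift_geodesic 0 c \<gamma> t)"
proof -
  have "(\<forall>i. acceleration c \<gamma> t $ i
          + (\<Sum>j\<in>UNIV. \<Sum>k\<in>UNIV. christoffel \<A> h c i j k (chart_map c (\<gamma> t))
               * velocity \<A> \<gamma> t c $ j * velocity \<A> \<gamma> t c $ k) = 0) \<longleftrightarrow> drift_geodesic 0 c \<gamma> t"
    if sm: "smooth_curve \<A> I \<gamma>" and c: "c \<in> \<A>" and t: "t \<in> I" "\<gamma> t \<in> chart_dom c" for c t
  proof -
    interpret unit_killing_chart "chart_img c" "g c" "w c" by (rule chart_unit_killing[OF c])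
    have x: "chart_map c (\<gamma> t) \<in> chart_img c" using t by auto
    have "(\<chi> a b. metric_coeff \<A> h c a b x) = g c x" for x by (simp add: metric_matrix_def)
    then show ?thesis
      using geodesic_iff_momentum_eq[OF curve_chart_domain[OF I sm c], of t] t c
      by (simp add: acceleration_def christoffel_def velocity_def partial_metric_coeff[OF c x] o_def)
  qed
  then show ?thesis unfolding riemannian_geodesic_def by blast
qed

lemma kropina_sq_coord_eq:
  assumes c: "c \<in> \<A>" "x \<in> chart_img c"
  shows "kropina_sq_coord \<A> h W c x y = unit_killing_chart.kropina_sq (g c) (w c) x y"
proof -
  interpret unit_killing_chart "chart_img c" "g c" "w c" by (rule chart_unit_killing[OF c(1)])
  define p where "p = chart_inv c x"
  have p: "p \<in> chart_dom c" "chart_map c p = x" using chart_facts[OF c(1)] c(2) by (auto simp: p_def)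
  let ?y = "tangent_of \<A> c p y"
  have yT: "?y \<in> tangent_space \<A> p" "?y c = y"
    using tangent_of_in_tangent_space tangent_of_same c p by auto
  have "h p ?y ?y = gform (g c x) y y" "h p ?y (W p) = gform (g c x) y (w c x)"
    using h_eq_gform[OF c(1) p(1) yT(1)] yT W_tangent in_carrier[OF c(1) p(1)] w_chart[OF c(1) p(1)] p
    by simp_all
  moreover have "gform (g c x) y y \<ge> 0"
    using pos[OF c(2), of y] by (cases "y = 0") auto
  ultimately show ?thesis
    by (simp add: kropina_sq_coord_def kropina_def metric_norm_def kropina_sq_def p_def[symmetric])
qed

lemma h_self_nonneg:
  assumes "p \<in> carrier \<A>" "v \<in> tangent_space \<A> p"
  shows "h p v v \<ge> 0"
proof -
  obtain c where c: "c \<in> \<A>" "p \<in> chart_dom c" using assms carrier_chart by blast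
  interpret unit_killing_chart "chart_img c" "g c" "w c" by (rule chart_unit_killing[OF c(1)])
  show ?thesis
    using h_eq_gform[OF c assms(2,2)] pos[of "chart_map c p" "v c"] c by (cases "v c = 0") auto
qed

lemma kropina_eq_1_iff:
  assumes "p \<in> carrier \<A>" "v \<in> tangent_space \<A> p" "h p v (W p) > 0"
  shows "kropina h W p v = 1 \<longleftrightarrow> h p v v = 2 * h p v (W p)"
  using h_self_nonneg[OF assms(1,2)] assms(3) by (auto simp: kropina_def metric_norm_def field_simps)

lemma kropina_geodesic_iff_drift:
  assumes I: "open I" and sm: "smooth_curve \<A> I \<gamma>"
    and cone: "\<And>t. t \<in> I \<Longrightarrow> velocity \<A> \<gamma> t \<in> kropina_cone \<A> h W (\<gamma> t)"
    and speed: "\<And>t. t \<in> I \<Longrightarrow> kropina h W (\<gamma> t) (velocity \<A> \<gamma> t) = 1"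
  shows "kropina_geodesic \<A> h W I \<gamma> \<longleftrightarrow>
    (\<forall>c\<in>\<A>. \<forall>t\<in>I. \<gamma> t \<in> chart_dom c \<longrightarrow> drift_geodesic 1 c \<gamma> t)"
proof -
  have "(\<forall>i. acceleration c \<gamma> t $ i + 2 * spray_coeff (kropina_sq_coord \<A> h W c) i
      (chart_map c (\<gamma> t)) (velocity \<A> \<gamma> t c) = 0) \<longleftrightarrow> drift_geodesic 1 c \<gamma> t"
    if c: "c \<in> \<A>" and t: "t \<in> I" "\<gamma> t \<in> chart_dom c" for c t
  proof -
    interpret unit_killing_chart "chart_img c" "g c" "w c" by (rule chart_unit_killing[OF c])
    let ?J = "{t \<in> I. \<gamma> t \<in> chart_dom c}"
    let ?x = "chart_map c \<circ> \<gamma>"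
    have "gform (g c (?x \<tau>)) (vector_derivative ?x (at \<tau>)) (w c (?x \<tau>)) > 0 \<and>
        gform (g c (?x \<tau>)) (vector_derivative ?x (at \<tau>)) (vector_derivative ?x (at \<tau>))
          = 2 * gform (g c (?x \<tau>)) (vector_derivative ?x (at \<tau>)) (w c (?x \<tau>))" if \<tau>: "\<tau> \<in> ?J" for \<tau>
    proof -
      have carr: "\<gamma> \<tau> \<in> carrier \<A>" using in_carrier c \<tau> by auto
      have vel: "velocity \<A> \<gamma> \<tau> \<in> tangent_space \<A> (\<gamma> \<tau>)" "h (\<gamma> \<tau>) (velocity \<A> \<gamma> \<tau>) (W (\<gamma> \<tau>)) > 0"
        using cone \<tau> by (auto simp: kropina_cone_def)
      have "velocity \<A> \<gamma> \<tau> c = vector_derivative ?x (at \<tau>)" using c \<tau> by (simp add: velocity_def)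
      then show ?thesis
        using kropina_eq_1_iff[OF carr vel] speed \<tau> vel h_eq_gform[OF c _ vel(1)] W_tangent[OF carr]
          w_chart[OF c] by auto
    qed
    then show ?thesis
      using kropina_geodesic_iff_momentum_eq[OF kropina_sq_coord_eq[OF c] curve_chart_domain[OF I sm c],
          of t] t c
      by (simp add: acceleration_def velocity_def o_def)
  qed
  then show ?thesis using sm cone unfolding kropina_geodesic_def by blast
qed

end

section \<open>The flow of the Killing field\<close>

locale kropina_flow = kropina_manifold \<A> h W
  for \<A> :: "('a::{t2_space, second_countable_topology}, 'n::finite) chart set"
    and h :: "('a, 'n) metric" and W :: "('a, 'n) vfield" +
  fixes U :: "'a set" and \<epsilon> :: real and \<phi> :: "real \<Rightarrow> 'a \<Rightarrow> 'a"
  assumes open_U: "open U" and U_carrier: "U \<subseteq> carrier \<A>" and eps: "\<epsilon> > 0"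
    and flow_group: "local_isometry_group \<A> h U \<epsilon> \<phi>"
    and flow_generates: "generates \<A> U \<epsilon> \<phi> W"
begin

abbreviation T :: "real set" where "T \<equiv> {-\<epsilon><..<\<epsilon>}"

definition flow_domain :: "('a, 'n) chart \<Rightarrow> ('a, 'n) chart \<Rightarrow> (real \<times> (real^'n)) set" where
  "flow_domain c d = {(t, u). t \<in> T \<and> u \<in> chart_map c ` (U \<inter> chart_dom c) \<and>
     \<phi> t (chart_inv c u) \<in> chart_dom d}"

definition flow_coord :: "('a, 'n) chart \<Rightarrow> ('a, 'n) chart \<Rightarrow> real \<times> (real^'n) \<Rightarrow> real^'n" where
  "flow_coord c d = (\<lambda>(t, u). chart_map d (\<phi> t (chart_inv c u)))"

abbreviation flow_deriv where
  "flow_deriv c d q \<equiv> frechet_derivative (flow_coord c d) (at q)"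

lemma flow_isometric: "t \<in> T \<Longrightarrow> local_isometry \<A> h U (\<phi> t)"
  using flow_group unfolding local_isometry_group_def by blast

lemma flow_smooth_map: "t \<in> T \<Longrightarrow> smooth_map \<A> U (\<phi> t)"
  using flow_isometric unfolding local_isometry_def by blast

lemma flow_in_carrier: "t \<in> T \<Longrightarrow> x \<in> U \<Longrightarrow> \<phi> t x \<in> carrier \<A>"
  using flow_smooth_map unfolding smooth_map_def by blast

lemma flow_continuous: "continuous_on (T \<times> U) (\<lambda>(t, x). \<phi> t x)"
  using flow_group unfolding local_isometry_group_def by blast

lemma flow_continuous_compose:
  assumes "continuous_on S f" "continuous_on S k" "f ` S \<subseteq> T" "k ` S \<subseteq> U"
  shows "continuous_on S (\<lambda>x. \<phi> (f x) (k x))"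
  using continuous_on_compose2[OF flow_continuous continuous_on_Pair[OF assms(1,2)]] assms(3,4) by auto

lemma flow_0: "x \<in> U \<Longrightarrow> \<phi> 0 x = x"
  using flow_group unfolding local_isometry_group_def by blast

lemma flow_add: "s \<in> T \<Longrightarrow> t \<in> T \<Longrightarrow> x \<in> U \<Longrightarrow> s + t \<in> T \<Longrightarrow> \<phi> t x \<in> U \<Longrightarrow> \<phi> (s + t) x = \<phi> s (\<phi> t x)"
  using flow_group unfolding local_isometry_group_def by blast

lemma smooth_flow_coord: "c \<in> \<A> \<Longrightarrow> d \<in> \<A> \<Longrightarrow> smooth_on (flow_domain c d) (flow_coord c d)"
  using flow_group unfolding local_isometry_group_def flow_domain_def flow_coord_def by blast

lemma open_flow_domain:
  assumes c: "c \<in> \<A>" and d: "d \<in> \<A>"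
  shows "open (flow_domain c d)"
proof -
  let ?E = "T \<times> chart_map c ` (chart_dom c \<inter> U)"
  have cont: "continuous_on ?E (\<lambda>q. \<phi> (fst q) (chart_inv c (snd q)))"
  proof (rule flow_continuous_compose)
    show "continuous_on ?E (\<lambda>q. chart_inv c (snd q))"
      by (rule continuous_on_compose2[OF chart_facts(7)[OF c] continuous_on_snd[OF continuous_on_id]]) auto
  qed (use chart_facts[OF c] in \<open>auto intro: continuous_on_fst\<close>)
  have "open {q \<in> ?E. \<phi> (fst q) (chart_inv c (snd q)) \<in> chart_dom d}"
    using open_image[OF c open_U] chart_facts(1)[OF d]
    by (intro open_Collect_preimage[OF cont] open_Times) auto
  moreover have "{q \<in> ?E. \<phi> (fst q) (chart_inv c (snd q)) \<in> chart_dom d} = flow_domain c d"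
    by (auto simp: flow_domain_def)
  ultimately show ?thesis by simp
qed

lemma flow_domainI:
  "c \<in> \<A> \<Longrightarrow> x \<in> U \<Longrightarrow> x \<in> chart_dom c \<Longrightarrow> t \<in> T \<Longrightarrow> \<phi> t x \<in> chart_dom d \<Longrightarrow>
    (t, chart_map c x) \<in> flow_domain c d"
  by (auto simp: flow_domain_def chart_facts)

lemma flow_domainE:
  assumes "q \<in> flow_domain c d" "c \<in> \<A>"
  obtains t x where "q = (t, chart_map c x)" "t \<in> T" "x \<in> U" "x \<in> chart_dom c"
    "\<phi> t x \<in> chart_dom d" "flow_coord c d q = chart_map d (\<phi> t x)"
  using assms by (auto simp: flow_domain_def flow_coord_def chart_facts)

lemma flow_coord_has_derivative:
  "c \<in> \<A> \<Longrightarrow> d \<in> \<A> \<Longrightarrow> q \<in> flow_domain c d \<Longrightarrow>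
    (flow_coord c d has_derivative flow_deriv c d q) (at q)"
  using smooth_on_imp_differentiable[OF smooth_flow_coord] has_derivative_frechet by blast

lemma flow_deriv_time:
  assumes c: "c \<in> \<A>" and d: "d \<in> \<A>" and q: "q \<in> flow_domain c d"
  shows "flow_deriv c d q (1, 0) = w d (flow_coord c d q)"
proof -
  obtain t x where tx: "q = (t, chart_map c x)" "t \<in> T" "x \<in> U" "x \<in> chart_dom c"
    "\<phi> t x \<in> chart_dom d" "flow_coord c d q = chart_map d (\<phi> t x)"
    using flow_domainE[OF q c] .
  have "((\<lambda>s. (s, chart_map c x)) has_vector_derivative (1, 0)) (at t)"
    by (intro has_vector_derivative_Pair has_vector_derivative_id has_vector_derivative_const)
  from has_vector_derivative_along_curve[OF flow_coord_has_derivative[OF c d q, unfolded tx(1)] this]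
  have "((\<lambda>s. chart_map d (\<phi> s x)) has_vector_derivative flow_deriv c d q (1, 0)) (at t)"
    using tx chart_facts(3)[OF c] by (simp add: flow_coord_def)
  from vector_derivative_at[OF this]
  have "velocity \<A> (\<lambda>s. \<phi> s x) t d = flow_deriv c d q (1, 0)"
    using tx d by (simp add: velocity_def o_def)
  then show ?thesis
    using flow_generates tx w_chart[OF d tx(5)] by (simp add: generates_def)
qed

lemma flow_deriv_space:
  assumes c: "c \<in> \<A>" and d: "d \<in> \<A>" and q: "(t, u) \<in> flow_domain c d"
  shows "flow_deriv c d (t, u) (0, a) =
    frechet_derivative (chart_map d \<circ> \<phi> t \<circ> chart_inv c) (at u) a"
proof -
  have "((\<lambda>u. (t, u)) has_derivative (\<lambda>a. (0, a))) (at u)"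
    by (intro has_derivative_Pair has_derivative_const has_derivative_ident)
  from has_derivative_compose[OF this flow_coord_has_derivative[OF c d q]]
  show ?thesis by (simp add: flow_coord_def o_def frechet_eqI)
qed

lemma flow_deriv_isometry:
  assumes c: "c \<in> \<A>" and d: "d \<in> \<A>" and q: "q \<in> flow_domain c d"
  shows "gform (g d (flow_coord c d q)) (flow_deriv c d q (0, a)) (flow_deriv c d q (0, b))
    = gform (g c (snd q)) a b"
proof -
  obtain t x where tx: "q = (t, chart_map c x)" "t \<in> T" "x \<in> U" "x \<in> chart_dom c"
    "\<phi> t x \<in> chart_dom d" "flow_coord c d q = chart_map d (\<phi> t x)"
    using flow_domainE[OF q c] .
  have xc: "x \<in> carrier \<A>" using tx U_carrier by auto
  let ?v = "\<lambda>a. tangent_of \<A> c x a"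
  let ?dv = "\<lambda>a. differential \<A> (\<phi> t) x (?v a)"
  have v: "?v a \<in> tangent_space \<A> x" "?v a c = a" for a
    using tangent_of_in_tangent_space tangent_of_same c tx by auto
  have dv: "?dv a \<in> tangent_space \<A> (\<phi> t x)" for a
    by (rule differential_in_tangent_space[OF flow_smooth_map[OF tx(2)] open_U tx(3) v(1) xc])
  have dvd: "?dv a d = flow_deriv c d q (0, a)" for a
    using differential_in_chart[OF flow_smooth_map[OF tx(2)] open_U tx(3) c tx(4) d tx(5) v(1)]
      flow_deriv_space[OF c d q[unfolded tx(1)]] v(2) tx(1) by simp
  have "h (\<phi> t x) (?dv a) (?dv b) = h x (?v a) (?v b)"
    using flow_isometric[OF tx(2)] tx(3) v(1) unfolding local_isometry_def by blast
  then show ?thesis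
    using h_eq_gform[OF d tx(5) dv dv] h_eq_gform[OF c tx(4) v(1) v(1)] dvd v(2) tx by simp
qed

text \<open>
A flow preserves its generator: differentiate \<open>\<phi> (t + s) x = \<phi> t (\<phi> s x)\<close> with respect to \<open>s\<close> at
\<open>0\<close>.  Near \<open>0\<close> the points \<open>\<phi> s x\<close> stay in the domain on which the group law holds.
\<close>

lemma flow_deriv_invariant:
  assumes c: "c \<in> \<A>" and d: "d \<in> \<A>" and q: "q \<in> flow_domain c d"
  shows "flow_deriv c d q (0, w c (snd q)) = w d (flow_coord c d q)"
proof -
  obtain t x where tx: "q = (t, chart_map c x)" "t \<in> T" "x \<in> U" "x \<in> chart_dom c"
    "\<phi> t x \<in> chart_dom d" "flow_coord c d q = chart_map d (\<phi> t x)"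
    using flow_domainE[OF q c] .
  define u where "u = chart_map c x"
  have q': "(t, u) \<in> flow_domain c d" using q tx by (simp add: u_def)
  have q0: "(0, u) \<in> flow_domain c c"
    unfolding u_def using c tx eps flow_0 by (intro flow_domainI) auto
  have u0: "flow_coord c c (0, u) = u"
    using c tx flow_0 by (simp add: flow_coord_def u_def chart_facts)
  have curve: "((\<lambda>s. (s, u)) has_vector_derivative (1, 0)) (at s)" for s
    by (intro has_vector_derivative_Pair has_vector_derivative_id has_vector_derivative_const)
  have shifted: "((\<lambda>s. (t + s, u)) has_vector_derivative (1, 0)) (at 0)"
    by (auto intro!: derivative_eq_intros has_vector_derivative_Pair)
  have "(flow_coord c d has_derivative flow_deriv c d (t, u)) (at (t + 0, u))"
    using flow_coord_has_derivative[OF c d q'] by simp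
  from has_vector_derivative_along_curve[OF this shifted]
  have 1: "((\<lambda>s. flow_coord c d (t + s, u)) has_vector_derivative w d (flow_coord c d q)) (at 0)"
    using flow_deriv_time[OF c d q'] tx(1) by (simp add: u_def)
  have "((\<lambda>s. flow_coord c c (s, u)) has_vector_derivative w c u) (at 0)"
    using has_vector_derivative_along_curve[OF flow_coord_has_derivative[OF c c q0] curve]
      flow_deriv_time[OF c c q0] u0 by simp
  then have "((\<lambda>s. (t, flow_coord c c (s, u))) has_vector_derivative (0, w c u)) (at 0)"
    by (intro has_vector_derivative_Pair has_vector_derivative_const)
  from has_vector_derivative_along_curve[of "flow_coord c d" "flow_deriv c d (t, u)", OF _ this]
  have 2: "((\<lambda>s. flow_coord c d (t, flow_coord c c (s, u))) has_vector_derivative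
      flow_deriv c d (t, u) (0, w c u)) (at 0)"
    using flow_coord_has_derivative[OF c d q'] u0 by simp
  let ?T0 = "T \<inter> {-\<epsilon> - t<..<\<epsilon> - t}"
  let ?N = "{s \<in> ?T0. \<phi> s x \<in> U \<inter> chart_dom c}"
  have N: "open ?N"
    using open_U chart_facts(1)[OF c] tx
    by (intro open_Collect_preimage flow_continuous_compose open_Int continuous_on_id continuous_on_const) auto
  have "0 \<in> ?N" using tx eps flow_0 by auto
  have eq: "flow_coord c d (t, flow_coord c c (s, u)) = flow_coord c d (t + s, u)" if "s \<in> ?N" for s
    using that tx c flow_add[of t s x] by (simp add: flow_coord_def u_def chart_facts)
  have "((\<lambda>s. flow_coord c d (t + s, u)) has_vector_derivative flow_deriv c d (t, u) (0, w c u)) (at 0)"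
    using has_derivative_transform_within_open[OF 2[unfolded has_vector_derivative_def] N \<open>0 \<in> ?N\<close> eq]
    by (simp add: has_vector_derivative_def)
  from vector_derivative_unique_at[OF this 1] show ?thesis using tx(1) by (simp add: u_def)
qed

text \<open>
In the charts \<open>c\<close> and \<open>d\<close> the map \<open>(t, x) \<mapsto> \<phi> (r t) x\<close> is the flow precomposed with the linear map
\<open>L (t, u) = (r t, u)\<close>, which multiplies its time derivative by \<open>r\<close>.
\<close>

lemma flow_transfer_chart:
  assumes I: "open I" "smooth_curve \<A> I \<gamma>" "\<gamma> ` I \<subseteq> U" "\<And>t. t \<in> I \<Longrightarrow> r * t \<in> T"
    and c: "c \<in> \<A>" and d: "d \<in> \<A>" and t: "t \<in> I" "\<gamma> t \<in> chart_dom c" "\<phi> (r * t) (\<gamma> t) \<in> chart_dom d"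
  defines "P \<equiv> \<lambda>t. \<phi> (r * t) (\<gamma> t)"
  shows "\<exists>J. open J \<and> t \<in> J \<and> smooth_on J (chart_map d \<circ> P)"
    and "gform (g d (chart_map d (P t))) (drift (s + r) d P t) (drift (s + r) d P t) =
      gform (g c (chart_map c (\<gamma> t))) (drift s c \<gamma> t) (drift s c \<gamma> t)"
    and "gform (g d (chart_map d (P t))) (drift (s + r) d P t) (w d (chart_map d (P t))) =
      gform (g c (chart_map c (\<gamma> t))) (drift s c \<gamma> t) (w c (chart_map c (\<gamma> t)))"
    and "drift_geodesic s c \<gamma> t \<Longrightarrow> drift_geodesic (s + r) d P t"
proof -
  interpret C1: unit_killing_chart "chart_img c" "g c" "w c" by (rule chart_unit_killing[OF c])
  interpret C2: unit_killing_chart "chart_img d" "g d" "w d" by (rule chart_unit_killing[OF d])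
  define L where "L q = (r * fst q, snd q)" for q :: "real \<times> (real^'n)"
  have L: "bounded_linear L"
    unfolding L_def[abs_def]
    by (intro bounded_linear_Pair bounded_linear_const_mult bounded_linear_fst bounded_linear_snd)
  define D where "D = L -` flow_domain c d"
  define \<Phi> where "\<Phi> q = flow_coord c d (L q)" for q
  have D: "open D"
    unfolding D_def using L by (intro open_vimage open_flow_domain c d linear_continuous_on)
  have sm: "smooth_on D \<Phi>"
    unfolding \<Phi>_def[abs_def]
    by (rule smooth_on_compose[OF smooth_flow_coord[OF c d] smooth_on_bounded_linear[OF L] D])
      (auto simp: D_def)
  have d\<Phi>: "frechet_derivative \<Phi> (at q) k = flow_deriv c d (L q) (L k)" if "q \<in> D" for q k
  proof -
    have "(\<Phi> has_derivative (\<lambda>k. flow_deriv c d (L q) (L k))) (at q)"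
      unfolding \<Phi>_def[abs_def]
      by (rule has_derivative_compose[OF bounded_linear_imp_has_derivative[OF L] flow_coord_has_derivative])
        (use c d that in \<open>auto simp: D_def\<close>)
    then show ?thesis by (simp add: frechet_eqI)
  qed
  let ?x = "chart_map c \<circ> \<gamma>"
  let ?J = "{\<tau> \<in> {\<tau> \<in> I. \<gamma> \<tau> \<in> chart_dom c}. P \<tau> \<in> chart_dom d}"
  have contP: "continuous_on {\<tau> \<in> I. \<gamma> \<tau> \<in> chart_dom c} P"
    unfolding P_def using I
    by (intro flow_continuous_compose continuous_intros)
      (auto simp: smooth_curve_def intro: continuous_on_subset)
  have J: "open ?J"
    by (intro open_Collect_preimage contP curve_chart_domain(1) I c chart_facts(1) d)
  have tJ: "t \<in> ?J" using t by (simp add: P_def)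
  have smJ: "smooth_on ?J ?x"
    by (rule smooth_on_subset[OF curve_chart_domain(2)[OF I(1,2) c]]) auto
  have inD: "(\<tau>, ?x \<tau>) \<in> D" if "\<tau> \<in> ?J" for \<tau>
    using that I c by (auto simp: D_def L_def P_def intro!: flow_domainI)
  have y: "\<Phi> (\<tau>, ?x \<tau>) = (chart_map d \<circ> P) \<tau>" if "\<tau> \<in> ?J" for \<tau>
    using that c by (simp add: \<Phi>_def L_def flow_coord_def P_def chart_facts)
  note C = C1.riemannian_chart_axioms C2.riemannian_chart_axioms
  have snd: "snd q \<in> chart_img c" "\<Phi> q \<in> chart_img d" if "q \<in> D" for q
  proof -
    have Lq: "L q \<in> flow_domain c d" using that by (simp add: D_def)
    obtain t x where tx: "L q = (t, chart_map c x)" "t \<in> T" "x \<in> U" "x \<in> chart_dom c"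
      "\<phi> t x \<in> chart_dom d" "flow_coord c d (L q) = chart_map d (\<phi> t x)"
      using flow_domainE[OF Lq c] .
    then show "snd q \<in> chart_img c" "\<Phi> q \<in> chart_img d" by (auto simp: L_def \<Phi>_def)
  qed
  have time: "frechet_derivative \<Phi> (at q) (1, 0) = r *\<^sub>R w d (\<Phi> q)" if "q \<in> D" for q
  proof -
    have "L (1, 0) = r *\<^sub>R (1, 0)" by (simp add: L_def)
    moreover have "linear (flow_deriv c d (L q))"
      using flow_coord_has_derivative[OF c d, of "L q"] that has_derivative_linear by (auto simp: D_def)
    ultimately show ?thesis
      using flow_deriv_time[OF c d, of "L q"] that
      by (simp add: d\<Phi>[OF that] linear_scale D_def \<Phi>_def del: scaleR_Pair)
  qed
  have inv: "frechet_derivative \<Phi> (at q) (0, w c (snd q)) = w d (\<Phi> q)" if "q \<in> D" for q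
    using flow_deriv_invariant[OF c d, of "L q"] that
    by (simp add: d\<Phi>[OF that] D_def \<Phi>_def L_def)
  have isom: "gform (g d (\<Phi> q)) (frechet_derivative \<Phi> (at q) (0, a)) (frechet_derivative \<Phi> (at q) (0, b))
      = gform (g c (snd q)) a b" if "q \<in> D" for q a b
    using flow_deriv_isometry[OF c d, of "L q" a b] that
    by (simp add: d\<Phi>[OF that] D_def \<Phi>_def L_def)
  note transfer = flow_maps_momentum_eq[OF C sm D snd time inv isom J smJ inD tJ]
  have "smooth_on ?J (chart_map d \<circ> P)"
    by (rule smooth_on_cong[OF transfer(1) J y])
  then show "\<exists>J. open J \<and> t \<in> J \<and> smooth_on J (chart_map d \<circ> P)" using J tJ by blast
  have dr: "drift (s + r) d P t = frechet_derivative \<Phi> (at (t, ?x t)) (0, drift s c \<gamma> t)"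
  proof -
    have "C2.drift_vel (s + r) (\<lambda>\<tau>. \<Phi> (\<tau>, ?x \<tau>)) t = drift (s + r) d P t"
      by (rule C2.drift_vel_cong[OF J tJ]) (rule y)
    then show ?thesis using transfer(2)[of s] by (simp only:)
  qed
  have yt: "chart_map d (P t) = \<Phi> (t, ?x t)" using y[OF tJ] by simp
  show "gform (g d (chart_map d (P t))) (drift (s + r) d P t) (drift (s + r) d P t) =
      gform (g c (chart_map c (\<gamma> t))) (drift s c \<gamma> t) (drift s c \<gamma> t)"
    unfolding dr yt using isom[OF inD[OF tJ]] by simp
  show "gform (g d (chart_map d (P t))) (drift (s + r) d P t) (w d (chart_map d (P t))) =
      gform (g c (chart_map c (\<gamma> t))) (drift s c \<gamma> t) (w c (chart_map c (\<gamma> t)))"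
    unfolding dr yt
    using isom[OF inD[OF tJ], of "drift s c \<gamma> t" "w c (?x t)"] inv[OF inD[OF tJ]] by simp
  assume "drift_geodesic s c \<gamma> t"
  then have "C2.momentum_eq (s + r) (\<lambda>\<tau>. \<Phi> (\<tau>, ?x \<tau>)) t"
    by (intro transfer(3))
  moreover have "C2.momentum_eq (s + r) (\<lambda>\<tau>. \<Phi> (\<tau>, ?x \<tau>)) t \<longleftrightarrow> drift_geodesic (s + r) d P t"
    by (rule C2.momentum_eq_cong[OF J tJ]) (rule y)
  ultimately show "drift_geodesic (s + r) d P t" by (simp only:)
qed

lemma flow_transfer_smooth:
  assumes I: "open I" "smooth_curve \<A> I \<gamma>" "\<gamma> ` I \<subseteq> U" "\<And>t. t \<in> I \<Longrightarrow> r * t \<in> T"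
  shows "smooth_curve \<A> I (\<lambda>t. \<phi> (r * t) (\<gamma> t))"
  unfolding smooth_curve_def
proof (intro conjI ballI)
  show "continuous_on I (\<lambda>t. \<phi> (r * t) (\<gamma> t))"
    using I by (intro flow_continuous_compose continuous_intros) (auto simp: smooth_curve_def)
  show "(\<lambda>t. \<phi> (r * t) (\<gamma> t)) ` I \<subseteq> carrier \<A>"
    using I flow_in_carrier by auto
  fix d assume d: "d \<in> \<A>"
  show "smooth_on {t \<in> I. \<phi> (r * t) (\<gamma> t) \<in> chart_dom d} (chart_map d \<circ> (\<lambda>t. \<phi> (r * t) (\<gamma> t)))"
  proof (rule smooth_on_local)
    fix t assume t: "t \<in> {t \<in> I. \<phi> (r * t) (\<gamma> t) \<in> chart_dom d}"
    then have "\<gamma> t \<in> carrier \<A>" using I by (auto simp: smooth_curve_def)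
    then obtain c where "c \<in> \<A>" "\<gamma> t \<in> chart_dom c" using carrier_chart by blast
    with flow_transfer_chart(1)[OF I _ d, of c t] t
    show "\<exists>J. open J \<and> t \<in> J \<and> smooth_on J (chart_map d \<circ> (\<lambda>t. \<phi> (r * t) (\<gamma> t)))" by auto
  qed
qed

lemma drift_in_h:
  assumes I: "open I" "smooth_curve \<A> I \<gamma>" "t \<in> I" and c: "c \<in> \<A>" "\<gamma> t \<in> chart_dom c"
  shows "gform (g c (chart_map c (\<gamma> t))) (drift s c \<gamma> t) (w c (chart_map c (\<gamma> t))) =
      h (\<gamma> t) (velocity \<A> \<gamma> t) (W (\<gamma> t)) - s"
    and "gform (g c (chart_map c (\<gamma> t))) (drift s c \<gamma> t) (drift s c \<gamma> t) =
      h (\<gamma> t) (velocity \<A> \<gamma> t) (velocity \<A> \<gamma> t) - 2 * s * h (\<gamma> t) (velocity \<A> \<gamma> t) (W (\<gamma> t)) + s\<^sup>2"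
proof -
  interpret unit_killing_chart "chart_img c" "g c" "w c" by (rule chart_unit_killing[OF c(1)])
  let ?x = "chart_map c (\<gamma> t)" and ?v = "velocity \<A> \<gamma> t"
  have x: "?x \<in> chart_img c" using c by auto
  have W: "W (\<gamma> t) \<in> tangent_space \<A> (\<gamma> t)" by (rule W_tangent[OF in_carrier[OF c]])
  have v: "?v \<in> tangent_space \<A> (\<gamma> t)" by (rule velocity_in_tangent_space[OF I])
  have hv: "gform (g c ?x) (?v c) (w c ?x) = h (\<gamma> t) ?v (W (\<gamma> t))"
    "gform (g c ?x) (?v c) (?v c) = h (\<gamma> t) ?v ?v"
    using h_eq_gform[OF c v W] h_eq_gform[OF c v v] w_chart[OF c] by simp_all
  have d: "drift s c \<gamma> t = ?v c - s *\<^sub>R w c ?x" using drift_eq[of c \<gamma> t, OF c] w_chart[OF c] by simp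
  show "gform (g c ?x) (drift s c \<gamma> t) (w c ?x) = h (\<gamma> t) ?v (W (\<gamma> t)) - s"
    unfolding d using hv unit[OF x] by simp
  show "gform (g c ?x) (drift s c \<gamma> t) (drift s c \<gamma> t) = h (\<gamma> t) ?v ?v - 2 * s * h (\<gamma> t) ?v (W (\<gamma> t)) + s\<^sup>2"
    unfolding d using hv unit[OF x] sym[OF x, of "w c ?x" "?v c"] by (simp add: power2_eq_square algebra_simps)
qed

text \<open>
The velocity of \<open>\<gamma>\<close> and the relative velocity of \<open>P\<close> for the parameter \<open>r\<close> correspond under the
isometry, so they have the same length and the same product with \<open>W\<close>.  This determines how \<open>F\<close> of the
one curve and the length of the other are related.
\<close>

lemma flow_transfer:
  assumes I: "open I" "smooth_curve \<A> I \<gamma>" "\<gamma> ` I \<subseteq> U" "\<And>t. t \<in> I \<Longrightarrow> r * t \<in> T" and t: "t \<in> I"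
  defines "P \<equiv> \<lambda>t. \<phi> (r * t) (\<gamma> t)"
  shows "h (P t) (velocity \<A> P t) (W (P t)) = h (\<gamma> t) (velocity \<A> \<gamma> t) (W (\<gamma> t)) + r" (is ?W)
    and "h (P t) (velocity \<A> P t) (velocity \<A> P t) =
      h (\<gamma> t) (velocity \<A> \<gamma> t) (velocity \<A> \<gamma> t) + 2 * r * h (\<gamma> t) (velocity \<A> \<gamma> t) (W (\<gamma> t)) + r\<^sup>2" (is ?V)
proof -
  have smP: "smooth_curve \<A> I P" unfolding P_def by (rule flow_transfer_smooth[OF I])
  have "\<gamma> t \<in> carrier \<A>" "P t \<in> carrier \<A>" using I(2) smP t by (auto simp: smooth_curve_def)
  then obtain c d where c: "c \<in> \<A>" "\<gamma> t \<in> chart_dom c" and d: "d \<in> \<A>" "P t \<in> chart_dom d"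
    using carrier_chart by metis
  note tr = flow_transfer_chart(2,3)[OF I c(1) d(1) t c(2) d(2)[unfolded P_def], of 0, folded P_def]
  note c' = drift_in_h[OF I(1,2) t c, of 0] and d' = drift_in_h[OF I(1) smP t d, of r]
  show ?W using tr(2) c'(1) d'(1) by (simp add: P_def)
  then show ?V using tr(1) c'(2) d'(2) by (simp add: P_def algebra_simps power2_eq_square)
qed

text \<open>
Noether's theorem holds chart by chart and only gives a vanishing derivative; connectedness of the
parameter interval makes the quantity constant.
\<close>

lemma conserved_on_geodesic:
  assumes I: "open I" "connected I" "riemannian_geodesic \<A> h I \<rho>" and st: "s \<in> I" "t \<in> I"
  shows "h (\<rho> s) (velocity \<A> \<rho> s) (W (\<rho> s)) = h (\<rho> t) (velocity \<A> \<rho> t) (W (\<rho> t))"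
proof -
  let ?m = "\<lambda>t. h (\<rho> t) (velocity \<A> \<rho> t) (W (\<rho> t))"
  have geo: "smooth_curve \<A> I \<rho>" "\<And>c t. c \<in> \<A> \<Longrightarrow> t \<in> I \<Longrightarrow> \<rho> t \<in> chart_dom c \<Longrightarrow> drift_geodesic 0 c \<rho> t"
    using I riemannian_geodesic_iff_drift by blast+
  have "(?m has_real_derivative 0) (at t)" if t: "t \<in> I" for t
  proof -
    have "\<rho> t \<in> carrier \<A>" using geo(1) t by (auto simp: smooth_curve_def)
    then obtain c where c: "c \<in> \<A>" "\<rho> t \<in> chart_dom c" using carrier_chart by blast
    interpret unit_killing_chart "chart_img c" "g c" "w c" by (rule chart_unit_killing[OF c(1)])
    let ?J = "{t \<in> I. \<rho> t \<in> chart_dom c}"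
    note J = curve_chart_domain[OF I(1) geo(1) c(1)]
    have tJ: "t \<in> ?J" using t c by simp
    have "((\<lambda>\<tau>. gform (g c ((chart_map c \<circ> \<rho>) \<tau>)) (drift 0 c \<rho> \<tau>) (w c ((chart_map c \<circ> \<rho>) \<tau>)))
        has_real_derivative 0) (at t)"
      by (rule noether[OF J tJ geo(2)[OF c(1) t c(2)]])
    then show ?thesis
      unfolding has_field_derivative_def
      by (rule has_derivative_transform_within_open[OF _ J(1) tJ])
        (use drift_in_h(1)[OF I(1) geo(1) _ c(1), of _ 0] in auto)
  qed
  then have "?m constant_on I"
    by (rule has_field_derivative_0_imp_constant_on[OF _ I(2,1)])
  then show ?thesis using st by (auto simp: constant_on_def)
qed

lemma geodesic_to_kropina_geodesic:
  assumes I: "open I" "connected I" "0 \<in> I" "I \<subseteq> T" "\<rho> ` I \<subseteq> U"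
    and geo: "riemannian_geodesic \<A> h I \<rho>"
    and unit: "\<And>t. t \<in> I \<Longrightarrow> metric_norm h (\<rho> t) (velocity \<A> \<rho> t) = 1"
    and start: "velocity \<A> \<rho> 0 \<noteq> - W (\<rho> 0)"
  shows "kropina_geodesic \<A> h W I (\<lambda>t. \<phi> t (\<rho> t))"
    and "\<And>t. t \<in> I \<Longrightarrow> kropina h W (\<phi> t (\<rho> t)) (velocity \<A> (\<lambda>s. \<phi> s (\<rho> s)) t) = 1"
proof -
  let ?P = "\<lambda>t. \<phi> t (\<rho> t)"
  let ?m = "\<lambda>t. h (\<rho> t) (velocity \<A> \<rho> t) (W (\<rho> t))"
  have sm: "smooth_curve \<A> I \<rho>"
    and mov: "\<And>c t. c \<in> \<A> \<Longrightarrow> t \<in> I \<Longrightarrow> \<rho> t \<in> chart_dom c \<Longrightarrow> drift_geodesic 0 c \<rho> t"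
    using geo I riemannian_geodesic_iff_drift by blast+
  have vv: "h (\<rho> t) (velocity \<A> \<rho> t) (velocity \<A> \<rho> t) = 1" if "t \<in> I" for t
    using unit[OF that] by (simp add: metric_norm_def)
  have T: "1 * t \<in> T" if "t \<in> I" for t using I that by auto
  note flow = flow_transfer_smooth[OF I(1) sm I(5) T, simplified]
    flow_transfer[OF I(1) sm I(5) T, simplified]
  \<comment> \<open>Cauchy--Schwarz with its equality case: \<open>|\<rho>' + W|\<^sup>2 = 2 (1 +
    h(\<rho>', W))\<close>, and \<open>\<rho>' + W\<close> is the relative velocity for the
    parameter \<open>-1\<close>.\<close>
  have m0: "?m 0 > -1"
  proof -
    have "\<rho> 0 \<in> carrier \<A>" using I U_carrier by auto
    then obtain c where c: "c \<in> \<A>" "\<rho> 0 \<in> chart_dom c" using carrier_chart by blast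
    interpret unit_killing_chart "chart_img c" "g c" "w c" by (rule chart_unit_killing[OF c(1)])
    let ?d = "drift (-1) c \<rho> 0"
    have "?d \<noteq> 0"
    proof
      assume "?d = 0"
      then have "velocity \<A> \<rho> 0 c = - W (\<rho> 0) c" using drift_eq[of c \<rho> 0, OF c, of "-1"] by (simp add: eq_neg_iff_add_eq_0)
      moreover have "- W (\<rho> 0) \<in> tangent_space \<A> (\<rho> 0)"
        by (rule tangent_space_minus[OF W_tangent[OF in_carrier[OF c]]])
      ultimately have "velocity \<A> \<rho> 0 = - W (\<rho> 0)"
        using tangent_of_tangent_vector[OF c velocity_in_tangent_space[OF I(1) sm I(3)]]
          tangent_of_tangent_vector[OF c, of "- W (\<rho> 0)"] by simp
      with start show False by simp
    qed
    then have "gform (g c (chart_map c (\<rho> 0))) ?d ?d > 0" using pos c by auto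
    then show ?thesis using drift_in_h(2)[OF I(1) sm I(3) c, of "-1"] vv[OF I(3)] by simp
  qed
  have m: "?m t > -1" if "t \<in> I" for t
    using m0 conserved_on_geodesic[OF I(1,2) geo that I(3)] by simp
  have cone: "velocity \<A> ?P t \<in> kropina_cone \<A> h W (?P t)" if "t \<in> I" for t
    using velocity_in_tangent_space[OF I(1) flow(1) that] flow(2)[OF that] m[OF that]
    by (simp add: kropina_cone_def)
  show speed: "kropina h W (?P t) (velocity \<A> ?P t) = 1" if "t \<in> I" for t
  proof -
    have "?P t \<in> carrier \<A>" using flow(1) that by (auto simp: smooth_curve_def)
    then show ?thesis
      using kropina_eq_1_iff[of "?P t" "velocity \<A> ?P t"] cone[OF that] flow(2,3)[OF that] vv[OF that]
      by (simp add: kropina_cone_def)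
  qed
  have "\<forall>d\<in>\<A>. \<forall>t\<in>I. ?P t \<in> chart_dom d \<longrightarrow> drift_geodesic 1 d ?P t"
  proof (intro ballI impI)
    fix d t assume d: "d \<in> \<A>" "t \<in> I" "?P t \<in> chart_dom d"
    then have "\<rho> t \<in> carrier \<A>" using sm by (auto simp: smooth_curve_def)
    then obtain c where c: "c \<in> \<A>" "\<rho> t \<in> chart_dom c" using carrier_chart by blast
    show "drift_geodesic 1 d ?P t"
      using flow_transfer_chart(4)[OF I(1) sm I(5) T c(1) d(1,2) c(2) _ mov[OF c(1) d(2) c(2)]] d
      by simp
  qed
  then show "kropina_geodesic \<A> h W I ?P"
    using kropina_geodesic_iff_drift[OF I(1) flow(1) cone speed] by blast
qed

lemma kropina_geodesic_to_geodesic: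
  assumes I: "open I" "I \<subseteq> T" "P ` I \<subseteq> U"
    and geo: "kropina_geodesic \<A> h W I P"
    and speed: "\<And>t. t \<in> I \<Longrightarrow> kropina h W (P t) (velocity \<A> P t) = 1"
  shows "riemannian_geodesic \<A> h I (\<lambda>t. \<phi> (- t) (P t))"
    and "\<And>t. t \<in> I \<Longrightarrow> metric_norm h (\<phi> (- t) (P t)) (velocity \<A> (\<lambda>s. \<phi> (- s) (P s)) t) = 1"
proof -
  let ?\<rho> = "\<lambda>t. \<phi> (- t) (P t)"
  have sm: "smooth_curve \<A> I P"
    and cone: "\<And>t. t \<in> I \<Longrightarrow> velocity \<A> P t \<in> kropina_cone \<A> h W (P t)"
    using geo unfolding kropina_geodesic_def by blast+
  have mov: "\<And>c t. c \<in> \<A> \<Longrightarrow> t \<in> I \<Longrightarrow> P t \<in> chart_dom c \<Longrightarrow> drift_geodesic 1 c P t"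
    using geo kropina_geodesic_iff_drift[OF I(1) sm cone speed] by blast
  have T: "- 1 * t \<in> T" if "t \<in> I" for t using I that by auto
  note flow = flow_transfer_smooth[OF I(1) sm I(3) T, simplified]
    flow_transfer[OF I(1) sm I(3) T, simplified]
  show "metric_norm h (?\<rho> t) (velocity \<A> ?\<rho> t) = 1" if "t \<in> I" for t
  proof -
    have "P t \<in> carrier \<A>" using sm that by (auto simp: smooth_curve_def)
    then have "h (P t) (velocity \<A> P t) (velocity \<A> P t) = 2 * h (P t) (velocity \<A> P t) (W (P t))"
      using kropina_eq_1_iff[of "P t" "velocity \<A> P t"] cone[OF that] speed[OF that]
      by (simp add: kropina_cone_def)
    then show ?thesis using flow(3)[OF that] by (simp add: metric_norm_def)
  qed
  show "riemannian_geodesic \<A> h I ?\<rho>"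
    unfolding riemannian_geodesic_iff_drift[OF I(1)]
  proof (intro conjI ballI impI)
    show "smooth_curve \<A> I ?\<rho>" by (rule flow(1))
    fix d t assume d: "d \<in> \<A>" "t \<in> I" "?\<rho> t \<in> chart_dom d"
    then have "P t \<in> carrier \<A>" using sm by (auto simp: smooth_curve_def)
    then obtain c where c: "c \<in> \<A>" "P t \<in> chart_dom c" using carrier_chart by blast
    show "drift_geodesic 0 d ?\<rho> t"
      using flow_transfer_chart(4)[OF I(1) sm I(3) T c(1) d(1,2) c(2) _ mov[OF c(1) d(2) c(2)]] d
      by simp
  qed
qed

end

theorem theorem4p2:
  fixes \<A> :: "('a::{t2_space, second_countable_topology}, 'n::finite) chart set"
    and h :: "('a, 'n) metric"
    and W :: "('a, 'n) vfield"
    and p :: 'a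
    and U :: "'a set"
    and \<epsilon> :: real
    and \<phi> :: "real \<Rightarrow> 'a \<Rightarrow> 'a"
  assumes "strong_kropina_space \<A> h W"
    and "p \<in> carrier \<A>"
    and "open U" and "U \<subseteq> carrier \<A>" and "p \<in> U" and "\<epsilon> > 0"
    and "local_isometry_group \<A> h U \<epsilon> \<phi>"
    and "generates \<A> U \<epsilon> \<phi> W"
  shows "(\<forall>I \<rho>. open I \<and> connected I \<and> 0 \<in> I \<and> I \<subseteq> {-\<epsilon><..<\<epsilon>} \<and> \<rho> ` I \<subseteq> U \<and>
            riemannian_geodesic \<A> h I \<rho> \<and>
            (\<forall>t\<in>I. metric_norm h (\<rho> t) (velocity \<A> \<rho> t) = 1) \<and>
            \<rho> 0 = p \<and> velocity \<A> \<rho> 0 \<noteq> - W (\<rho> 0) \<longrightarrow>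
            kropina_geodesic \<A> h W I (\<lambda>t. \<phi> t (\<rho> t)) \<and>
            (\<forall>t\<in>I. kropina h W (\<phi> t (\<rho> t)) (velocity \<A> (\<lambda>s. \<phi> s (\<rho> s)) t) = 1)) \<and>
         (\<forall>I P. open I \<and> connected I \<and> I \<subseteq> {-\<epsilon><..<\<epsilon>} \<and> P ` I \<subseteq> U \<and>
            kropina_geodesic \<A> h W I P \<and>
            (\<forall>t\<in>I. kropina h W (P t) (velocity \<A> P t) = 1) \<longrightarrow>
            riemannian_geodesic \<A> h I (\<lambda>t. \<phi> (- t) (P t)) \<and>
            (\<forall>t\<in>I. metric_norm h (\<phi> (- t) (P t)) (velocity \<A> (\<lambda>s. \<phi> (- s) (P s)) t) = 1))"
proof -
  interpret kropina_flow \<A> h W U \<epsilon> \<phi>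
    using assms by unfold_locales
  show ?thesis
    by (intro conjI allI impI ballI; elim conjE;
        rule geodesic_to_kropina_geodesic kropina_geodesic_to_geodesic; (assumption | blast))
qed

end
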